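(* Let $G$ be a selfdual, second countable, totally disconnected, locally compact, Abelian topological group with a filtration by compact and open subgroups $\{H_n\}_{n\in\mathbb{Z}}$, $H_n\subset H_{n+1}$ for all $n$, such that: (1) $H_0=H$ is a fixed compact and open subgroup of $G$; (2) the indices $[H_{n+1}:H_n]$, $n\in\mathbb{Z}$, are uniformly bounded from above; (3) $\mathrm{Ann}_G(H_n)=H_{-n}$ for all $n\in\mathbb{Z}$; (4) $\bigcap_{n\in\mathbb{Z}}H_n=\{0\}$ and $\bigcup_{n\in\mathbb{Z}}H_n=G$. Let $\alpha>0$. If $f$ belongs to $\mathrm{Dom}(-D^\alpha)=\mathrm{Dom}(D^\alpha)\subset L^2(G)$, then the Cauchy problem $$\begin{cases}\dfrac{\partial u(x,t)}{\partial t}+D^\alpha u(x,t)=0, & x\in G,\ t\ge0,\\ u(x,0)=f(x),\end{cases}$$ has a classical solution $u(x,t)$ determined by the convolution of $f$ with the heat kernel $Z(x,t)$: $u(\cdot,t)=Z(\cdot,t)*f$ for $t>0$ and $u(\cdot,0)=f$. In addition, $Z(x,t)$ is the transition density (that is, $p(t,x,y)=Z(x-y,t)$) of a time and space homogeneous Markov process on $G$ which is bounded, right-continuous and has no discontinuities other than jumps.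
   Context: Selfduality: a fixed isomorphism of topological groups $\xi\mapsto\chi_\xi$ from $G$ onto its Pontryagin dual $\widehat G$ is given, and $\mathrm{Ann}_G(H_n)=\{\xi\in G:\chi_\xi(x)=1\text{ for all }x\in H_n\}$. Let $\mu$ be the Haar measure on $G$ normalized by $\mu(H)=1$ and let $\lambda_n=\mu(H_n)$. The group $G$ carries the translation invariant ultrametric $d_G(x,y)=\|x-y\|_G$ whose balls centred at zero are the $H_n$, with radius equal to Haar measure: $\|0\|_G=0$ and $\|x\|_G=\lambda_n$ if $x\in H_n\setminus H_{n-1}$. The Fourier transform is $\mathcal{F}f(\xi)=\int_G f(x)\chi_\xi(x)\,d\mu(x)$, extended to a unitary operator of $L^2(G)=L^2(G,\mu)$ (complex valued functions). For $\alpha>0$, $D^\alpha f=\mathcal{F}^{-1}_{\xi\to x}(\|\xi\|_G^\alpha\,\mathcal{F}f(\xi))$ with domain $\mathrm{Dom}(D^\alpha)=\{f\in L^2(G):\|\xi\|_G^\alpha\,\mathcal{F}f\in L^2(G)\}$. The heat kernel is $Z(x,t)=\mathcal{F}^{-1}_{\xi\to x}(\exp(-t\|\xi\|_G^\alpha))=\int_G\overline{\chi_\xi(x)}\exp(-t\|\xi\|_G^\alpha)\,d\mu(\xi)$ for $x\in G$, $t>0$. A classical solution is a function $u$ such that $t\mapsto u(\cdot,t)$ is continuously differentiable from $[0,\infty)$ to $L^2(G)$, $u(\cdot,t)\in\mathrm{Dom}(D^\alpha)$ for all $t\ge0$, and $u$ satisfies the equation (in $L^2(G)$) and the initial condition.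 Markov process terminology: the transition function is $P(t,x,B)=\int_B Z(x-y,t)\,d\mu(y)$ for $t>0$ and $P(0,x,B)=1$ if $x\in B$, $0$ otherwise, for $B$ Borel. That $Z$ is the transition density of such a process means that $P$ is a transition function (time homogeneous, and space homogeneous: $P(t,x+h,B+h)=P(t,x,B)$) and that there is a Markov process $(X_t)_{t\ge0}$ with state space $G$, with a law $\mathbb{P}_x$ for each starting point $x\in G$, having $P$ as its transition function, whose paths are right-continuous, have left limits at every $t>0$ (no discontinuities other than jumps), and are bounded on every bounded time interval. *)

theory Defs
  imports "HOL-Probability.Probability"
begin

section \<open>Groups, characters, Haar measure\<close>

definition add_subgroup :: "'a::ab_group_add set \<Rightarrow> bool" where
  "add_subgroup H \<longleftrightarrow> 0 \<in> H \<and> (\<forall>x\<in>H. \<forall>y\<in>H. x + y \<in> H) \<and> (\<forall>x\<in>H. - x \<in> H)"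

text \<open>The number of cosets. It is only used for an open subgroup of a compact group, where the set
  of cosets is finite, so that the convention for the cardinality of infinite sets plays no role.\<close>

definition subgroup_index :: "'a::ab_group_add set \<Rightarrow> 'a set \<Rightarrow> nat" where
  "subgroup_index G H = card ((\<lambda>x. (\<lambda>h. x + h) ` H) ` G)"

definition totally_disconnected_set :: "'a::topological_space set \<Rightarrow> bool" where
  "totally_disconnected_set S \<longleftrightarrow> (\<forall>C\<subseteq>S. connected C \<longrightarrow> (\<exists>x. C \<subseteq> {x}))"

definition characters :: "('a::topological_ab_group_add \<Rightarrow> complex) set" where
  "characters = {\<phi>. continuous_on UNIV \<phi> \<and> (\<forall>x. cmod (\<phi> x) = 1) \<and>
                    (\<forall>x y. \<phi> (x + y) = \<phi> x * \<phi> y)}"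

text \<open>The Pontryagin dual carries the compact-open topology.\<close>

definition dual_topology :: "('a::topological_ab_group_add \<Rightarrow> complex) topology" where
  "dual_topology =
     topology_generated_by {{\<phi> \<in> characters. \<phi> ` K \<subseteq> U} | K U. compact K \<and> open U}"

definition selfduality :: "('a::topological_ab_group_add \<Rightarrow> 'a \<Rightarrow> complex) \<Rightarrow> bool" where
  "selfduality ch \<longleftrightarrow>
     homeomorphic_map euclidean dual_topology ch \<and>
     (\<forall>\<xi> \<eta> x. ch (\<xi> + \<eta>) x = ch \<xi> x * ch \<eta> x)"

definition annihilator :: "('a \<Rightarrow> 'a \<Rightarrow> complex) \<Rightarrow> 'a set \<Rightarrow> 'a set" where
  "annihilator ch H = {\<xi>. \<forall>x\<in>H. ch \<xi> x = 1}"

text \<open>No regularity is required: on a second countable locally compact Hausdorff space every Borel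
  measure that is finite on compact sets is regular.\<close>

definition haar_measure :: "'a::topological_ab_group_add measure \<Rightarrow> bool" where
  "haar_measure \<mu> \<longleftrightarrow>
     sets \<mu> = sets borel \<and>
     (\<forall>x. \<forall>B\<in>sets borel. emeasure \<mu> ((\<lambda>y. x + y) ` B) = emeasure \<mu> B) \<and>
     (\<forall>K. compact K \<longrightarrow> emeasure \<mu> K < \<infinity>) \<and>
     emeasure \<mu> UNIV \<noteq> 0"

text \<open>For a nested family that exhausts the group and has trivial intersection, the index \<open>n\<close> below
  exists and is unique for every \<open>x \<noteq> 0\<close>.\<close>

definition gnorm :: "(int \<Rightarrow> 'a set) \<Rightarrow> 'a measure \<Rightarrow> 'a::ab_group_add \<Rightarrow> real" where
  "gnorm H \<mu> x = (if x = 0 then 0 else measure \<mu> (H (THE n. x \<in> H n - H (n - 1))))"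

section \<open>The space of square integrable functions and the Fourier transform\<close>

text \<open>Elements of the Hilbert space are represented by functions, and equality of its elements is
  equality almost everywhere.\<close>

definition L1 :: "'a measure \<Rightarrow> ('a \<Rightarrow> complex) set" where
  "L1 \<mu> = {f. integrable \<mu> f}"

definition L2 :: "'a measure \<Rightarrow> ('a \<Rightarrow> complex) set" where
  "L2 \<mu> = {f \<in> borel_measurable \<mu>. integrable \<mu> (\<lambda>x. (cmod (f x))\<^sup>2)}"

definition L2_norm :: "'a measure \<Rightarrow> ('a \<Rightarrow> complex) \<Rightarrow> real" where
  "L2_norm \<mu> f = sqrt (LINT x|\<mu>. (cmod (f x))\<^sup>2)"

definition fourier_L1 ::
    "'a measure \<Rightarrow> ('a \<Rightarrow> 'a \<Rightarrow> complex) \<Rightarrow> ('a \<Rightarrow> complex) \<Rightarrow> 'a \<Rightarrow> complex" where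
  "fourier_L1 \<mu> ch f \<xi> = (LINT x|\<mu>. f x * ch \<xi> x)"

text \<open>The continuous extension to the whole space of the transform given by the integral on the
  dense subspace of functions that are also integrable. It is determined up to null sets, and the
  value depends only on the class of \<open>f\<close> modulo null sets.\<close>

definition fourier ::
    "'a measure \<Rightarrow> ('a \<Rightarrow> 'a \<Rightarrow> complex) \<Rightarrow> ('a \<Rightarrow> complex) \<Rightarrow> 'a \<Rightarrow> complex" where
  "fourier \<mu> ch f = (SOME g. g \<in> L2 \<mu> \<and>
     (\<exists>F. (\<forall>n::nat. F n \<in> L1 \<mu> \<inter> L2 \<mu>) \<and>
          (\<lambda>n. L2_norm \<mu> (\<lambda>x. F n x - f x)) \<longlonglongrightarrow> 0 \<and>
          (\<lambda>n. L2_norm \<mu> (\<lambda>\<xi>. fourier_L1 \<mu> ch (F n) \<xi> - g \<xi>)) \<longlonglongrightarrow> 0))"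

definition inv_fourier ::
    "'a measure \<Rightarrow> ('a \<Rightarrow> 'a \<Rightarrow> complex) \<Rightarrow> ('a \<Rightarrow> complex) \<Rightarrow> 'a \<Rightarrow> complex" where
  "inv_fourier \<mu> ch g = (SOME f. f \<in> L2 \<mu> \<and> (AE \<xi> in \<mu>. fourier \<mu> ch f \<xi> = g \<xi>))"

section \<open>The operator and its heat kernel\<close>

definition D_symbol_mult ::
    "(int \<Rightarrow> 'a::ab_group_add set) \<Rightarrow> 'a measure \<Rightarrow> ('a \<Rightarrow> 'a \<Rightarrow> complex) \<Rightarrow> real \<Rightarrow>
     ('a \<Rightarrow> complex) \<Rightarrow> 'a \<Rightarrow> complex" where
  "D_symbol_mult H \<mu> ch \<alpha> f \<xi> = complex_of_real (gnorm H \<mu> \<xi> powr \<alpha>) * fourier \<mu> ch f \<xi>"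

definition Dom_D ::
    "(int \<Rightarrow> 'a::ab_group_add set) \<Rightarrow> 'a measure \<Rightarrow> ('a \<Rightarrow> 'a \<Rightarrow> complex) \<Rightarrow> real \<Rightarrow>
     ('a \<Rightarrow> complex) set" where
  "Dom_D H \<mu> ch \<alpha> = {f \<in> L2 \<mu>. D_symbol_mult H \<mu> ch \<alpha> f \<in> L2 \<mu>}"

definition D_op ::
    "(int \<Rightarrow> 'a::ab_group_add set) \<Rightarrow> 'a measure \<Rightarrow> ('a \<Rightarrow> 'a \<Rightarrow> complex) \<Rightarrow> real \<Rightarrow>
     ('a \<Rightarrow> complex) \<Rightarrow> 'a \<Rightarrow> complex" where
  "D_op H \<mu> ch \<alpha> f = inv_fourier \<mu> ch (D_symbol_mult H \<mu> ch \<alpha> f)"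

definition heat_kernel ::
    "(int \<Rightarrow> 'a::ab_group_add set) \<Rightarrow> 'a measure \<Rightarrow> ('a \<Rightarrow> 'a \<Rightarrow> complex) \<Rightarrow> real \<Rightarrow>
     'a \<Rightarrow> real \<Rightarrow> complex" where
  "heat_kernel H \<mu> ch \<alpha> x t =
     (LINT \<xi>|\<mu>. cnj (ch \<xi> x) * complex_of_real (exp (- t * gnorm H \<mu> \<xi> powr \<alpha>)))"

definition fun_convolution ::
    "'a::ab_group_add measure \<Rightarrow> ('a \<Rightarrow> complex) \<Rightarrow> ('a \<Rightarrow> complex) \<Rightarrow> 'a \<Rightarrow> complex" where
  "fun_convolution \<mu> f g x = (LINT y|\<mu>. f (x - y) * g y)"

section \<open>Classical solutions\<close>

definition C1_L2 ::
    "'a measure \<Rightarrow> (real \<Rightarrow> 'a \<Rightarrow> complex) \<Rightarrow> (real \<Rightarrow> 'a \<Rightarrow> complex) \<Rightarrow> bool" where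
  "C1_L2 \<mu> u v \<longleftrightarrow>
     (\<forall>t\<ge>0. u t \<in> L2 \<mu> \<and> v t \<in> L2 \<mu> \<and>
        ((\<lambda>s. L2_norm \<mu> (\<lambda>x. (u s x - u t x) /\<^sub>R (s - t) - v t x)) \<longlongrightarrow> 0) (at t within {0..}) \<and>
        ((\<lambda>s. L2_norm \<mu> (\<lambda>x. v s x - v t x)) \<longlongrightarrow> 0) (at t within {0..}))"

text \<open>The Cauchy problem is \<open>\<partial>u/\<partial>t + D u = 0\<close> for \<open>t \<ge> 0\<close> and \<open>u = f\<close> at \<open>t = 0\<close>; the time is the
  first argument of \<open>u\<close>.\<close>

definition classical_solution ::
    "(int \<Rightarrow> 'a::ab_group_add set) \<Rightarrow> 'a measure \<Rightarrow> ('a \<Rightarrow> 'a \<Rightarrow> complex) \<Rightarrow> real \<Rightarrow>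
     ('a \<Rightarrow> complex) \<Rightarrow> (real \<Rightarrow> 'a \<Rightarrow> complex) \<Rightarrow> bool" where
  "classical_solution H \<mu> ch \<alpha> f u \<longleftrightarrow>
     (\<exists>v. C1_L2 \<mu> u v \<and>
          (\<forall>t\<ge>0. u t \<in> Dom_D H \<mu> ch \<alpha> \<and>
                  (AE x in \<mu>. v t x + D_op H \<mu> ch \<alpha> (u t) x = 0)) \<and>
          (AE x in \<mu>. u 0 x = f x))"

section \<open>Markov processes\<close>

text \<open>A time homogeneous transition function: \<open>K t x\<close> is the distribution at time \<open>t\<close> when starting
  at \<open>x\<close>, and the last condition is the Chapman-Kolmogorov equation.\<close>

definition transition_function ::
    "(real \<Rightarrow> 'a::topological_space \<Rightarrow> 'a measure) \<Rightarrow> bool" where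
  "transition_function K \<longleftrightarrow>
     (\<forall>t\<ge>0. K t \<in> borel \<rightarrow>\<^sub>M prob_algebra borel) \<and>
     (\<forall>x. K 0 x = return borel x) \<and>
     (\<forall>s\<ge>0. \<forall>t\<ge>0. \<forall>x. \<forall>B\<in>sets borel.
        emeasure (K (s + t) x) B = (\<integral>\<^sup>+ y. emeasure (K t y) B \<partial>K s x))"

definition past :: "'w measure \<Rightarrow> (real \<Rightarrow> 'w \<Rightarrow> 'a::topological_space) \<Rightarrow> real \<Rightarrow> 'w measure" where
  "past \<Omega> X s = sigma (space \<Omega>) {X r -` B \<inter> space \<Omega> | r B. 0 \<le> r \<and> r \<le> s \<and> B \<in> sets borel}"

text \<open>\<open>Pr x\<close> is the law of the process started at \<open>x\<close>; all laws live on the \<open>\<sigma>\<close>-algebra of \<open>\<Omega>\<close>, whose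
  own measure is irrelevant.\<close>

definition markov_process ::
    "(real \<Rightarrow> 'a::topological_space \<Rightarrow> 'a measure) \<Rightarrow> 'w measure \<Rightarrow> (real \<Rightarrow> 'w \<Rightarrow> 'a) \<Rightarrow>
     ('a \<Rightarrow> 'w measure) \<Rightarrow> bool" where
  "markov_process K \<Omega> X Pr \<longleftrightarrow>
     (\<forall>t\<ge>0. X t \<in> \<Omega> \<rightarrow>\<^sub>M borel) \<and>
     Pr \<in> borel \<rightarrow>\<^sub>M prob_algebra \<Omega> \<and>
     (\<forall>x. AE \<omega> in Pr x. X 0 \<omega> = x) \<and>
     (\<forall>x. \<forall>s\<ge>0. \<forall>t\<ge>0. \<forall>B\<in>sets borel.
        AE \<omega> in Pr x.
          real_cond_exp (Pr x) (past \<Omega> X s) (\<lambda>\<omega>'. indicator B (X (s + t) \<omega>')) \<omega>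
            = measure (K t (X s \<omega>)) B)"

definition heat_transition ::
    "(int \<Rightarrow> 'a::ab_group_add set) \<Rightarrow> 'a measure \<Rightarrow> ('a \<Rightarrow> 'a \<Rightarrow> complex) \<Rightarrow> real \<Rightarrow>
     real \<Rightarrow> 'a \<Rightarrow> 'a set \<Rightarrow> complex" where
  "heat_transition H \<mu> ch \<alpha> t x B =
     (if t = 0 then indicator B x else (LINT y:B|\<mu>. heat_kernel H \<mu> ch \<alpha> (x - y) t))"

definition regular_path ::
    "(int \<Rightarrow> 'a set) \<Rightarrow> 'a::topological_ab_group_add measure \<Rightarrow> (real \<Rightarrow> 'a) \<Rightarrow> bool" where
  "regular_path H \<mu> p \<longleftrightarrow>
     (\<forall>t\<ge>0. (p \<longlongrightarrow> p t) (at_right t)) \<and>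
     (\<forall>t>0. \<exists>l. (p \<longlongrightarrow> l) (at_left t)) \<and>
     (\<forall>T\<ge>0. \<exists>C. \<forall>t\<in>{0..T}. gnorm H \<mu> (p t) \<le> C)"

end

theory Submission
  imports Defs "HOL-Real_Asymp.Real_Asymp"
begin

text \<open>
  Fubini's theorem for \<open>ch\<close> on \<open>H m \<times> H n\<close>, evaluated in both orders, gives
  \<open>\<mu> (H n) * \<mu> (H (- n)) = 1\<close> and shows that \<open>H (- n)\<close> is also the annihilator of \<open>H n\<close> in the
  second variable of \<open>ch\<close>. Hence the transform maps indicators of cosets to modulated indicators and
  is isometric on their span, which is dense; this yields Plancherel's theorem together with
  surjectivity. In particular only the algebra of the pairing and the continuity of the single
  characters enter, not Pontryagin duality.

  The symbol \<open>exp (- t * \<bar>\<xi>\<bar> powr \<alpha>)\<close> is a mixture of indicators of subgroups, because its superlevel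
  sets are balls of an ultrametric. The transform of each of these indicators is nonnegative, so the
  heat kernel is a probability density. Convolution with it is a contraction of \<open>L\<^sup>2\<close> that acts as
  multiplication by the symbol after transforming, and the Cauchy problem reduces to dominated
  convergence.

  For the Markov process, random walks with step distribution \<open>Z (_, 1 / 2 ^ k)\<close> are compatible under
  refinement, and Kolmogorov's theorem gives a process indexed by the dyadic numbers. Since \<open>H n\<close> is a
  subgroup, the number of increments outside \<open>H n\<close> over the dyadic grid of level \<open>k\<close> can only grow
  with \<open>k\<close>, and its mean stays bounded. Almost surely a path therefore changes its class modulo each
  \<open>H n\<close> only finitely often in bounded time, so that one-sided limits exist, and the right limits
  form the required process.
\<close>


section \<open>Cosets, Haar measure and characters\<close>

text \<open>The pairing \<open>ch\<close> is not assumed symmetric, so at the outset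
  \<open>H (- n)\<close> annihilates \<open>H n\<close> from one side only. Without the other side
  neither the inner products of transformed indicators nor the inversion formula could be evaluated;
  a comparison of measures supplies it, with \<open>lam 0 = 1\<close> fixing the scale.

  Cosets are both open and closed. When points converge, the events that they lie in a given coset
  therefore agree eventually with the event for the limit, and limits of laws are computed on cosets
  without boundary terms.

  The mean number of jumps stays bounded because the mass of the heat kernel outside
  \<open>H n\<close> at time \<open>t\<close> is at most \<open>t * lam (- n) powr \<alpha>\<close>,
  linear in \<open>t\<close>: a grid of mesh \<open>1 / 2 ^ k\<close> has \<open>T * 2 ^ k\<close>
  steps up to time \<open>T\<close>, and the powers of two cancel.

  The transform on \<open>L2\<close> is fixed by a choice, up to null sets, so statements about it
  are proved for a relation between representatives. Kolmogorov's theorem is applied to real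
  sequences, into which the group is encoded.\<close>

lemma nested_compact_nonempty:
  fixes K :: "nat \<Rightarrow> 'a::t2_space set"
  assumes "\<And>n. compact (K n)" and "\<And>n. K n \<noteq> {}" and "\<And>n. K (Suc n) \<subseteq> K n"
  shows "(\<Inter>n. K n) \<noteq> {}"
proof -
  have anti: "antimono K" using assms(3) by (simp add: decseq_Suc_iff)
  have "K 0 \<inter> (\<Inter>n\<in>UNIV. K n) \<noteq> {}"
  proof (rule compact_imp_fip_image[OF assms(1)])
    show "closed (K n)" for n using assms(1) compact_imp_closed by blast
    fix I :: "nat set" assume I: "finite I"
    obtain m where m: "\<And>i. i \<in> I \<Longrightarrow> i \<le> m"
      using I finite_nat_set_iff_bounded_le by auto
    have "K m \<subseteq> K 0 \<inter> (\<Inter>i\<in>I. K i)"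
      using m anti by (auto dest: antimonoD)
    then show "K 0 \<inter> (\<Inter>i\<in>I. K i) \<noteq> {}" using assms(2)[of m] by blast
  qed
  then show ?thesis by blast
qed

locale selfdual_filtration =
  fixes H :: "int \<Rightarrow> 'a::{topological_ab_group_add, t2_space, second_countable_topology} set"
    and \<mu> :: "'a measure" and ch :: "'a \<Rightarrow> 'a \<Rightarrow> complex"
  assumes ch_char: "ch \<xi> \<in> characters"
    and ch_add_left: "ch (\<xi> + \<eta>) x = ch \<xi> x * ch \<eta> x"
    and subgroup_H: "add_subgroup (H n)" and compact_H: "compact (H n)" and open_H: "open (H n)"
    and H_le_Suc: "H n \<subseteq> H (n + 1)"
    and annihilator_H: "annihilator ch (H n) = H (- n)"
    and Inter_H: "(\<Inter>n. H n) = {0}" and Union_H: "(\<Union>n. H n) = UNIV"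
    and haar: "haar_measure \<mu>" and emeasure_H0: "emeasure \<mu> (H 0) = 1"
begin

lemma H_0 [simp]: "0 \<in> H n"
  and H_add: "x \<in> H n \<Longrightarrow> y \<in> H n \<Longrightarrow> x + y \<in> H n"
  and H_minus: "x \<in> H n \<Longrightarrow> - x \<in> H n"
  using subgroup_H[of n] unfolding add_subgroup_def by auto

lemma H_minus_iff [simp]: "- x \<in> H n \<longleftrightarrow> x \<in> H n"
  using H_minus[of x n] H_minus[of "-x" n] by auto

lemma H_diff: "x \<in> H n \<Longrightarrow> y \<in> H n \<Longrightarrow> x - y \<in> H n"
  using H_add[of x n "-y"] by simp

lemma H_diff_commute: "x - y \<in> H n \<longleftrightarrow> y - x \<in> H n"
  using H_minus_iff[of "x - y" n] by simp

text \<open>Transitivity of congruence modulo \<open>H n\<close>, the form in which the subgroup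
  property enters the counting of jumps and most limit arguments.\<close>

lemma H_diff_trans: "x - y \<in> H n \<Longrightarrow> y - z \<in> H n \<Longrightarrow> x - z \<in> H n"
  using H_add[of "x - y" n "y - z"] by simp

lemma H_add_iff: "y \<in> H n \<Longrightarrow> x + y \<in> H n \<longleftrightarrow> x \<in> H n"
  using H_add[of x n y] H_diff[of "x + y" n y] by auto

lemma H_mono: "n \<le> m \<Longrightarrow> H n \<subseteq> H m"
  by (induction m rule: int_ge_induct) (use H_le_Suc in auto)

lemma ex_in_H: "\<exists>n. x \<in> H n"
  using Union_H by auto

section \<open>Cosets as a base of compact open sets\<close>

definition coset :: "'a \<Rightarrow> int \<Rightarrow> 'a set" where
  "coset a n = {x. x - a \<in> H n}"

lemma mem_coset [simp]: "x \<in> coset a n \<longleftrightarrow> x - a \<in> H n"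
  by (simp add: coset_def)

lemma coset_eq_image: "coset a n = (\<lambda>x. a + x) ` H n"
proof -
  have "x \<in> (\<lambda>x. a + x) ` H n" if "x - a \<in> H n" for x
    using that by (intro image_eqI[of _ _ "x - a"]) auto
  then show ?thesis by auto
qed

lemma coset_0 [simp]: "coset 0 n = H n"
  by (auto simp: coset_def)

lemma open_coset: "open (coset a n)"
proof -
  have "open ((\<lambda>x. x - a) -` H n)"
    by (rule open_vimage[OF open_H]) (intro continuous_intros)
  moreover have "(\<lambda>x. x - a) -` H n = coset a n" by auto
  ultimately show ?thesis by simp
qed

lemma compact_coset: "compact (coset a n)"
  unfolding coset_eq_image
  by (rule compact_continuous_image[OF _ compact_H]) (intro continuous_intros)

lemma closed_coset: "closed (coset a n)"
  by (rule compact_imp_closed[OF compact_coset])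

lemma coset_borel [measurable]: "coset a n \<in> sets borel"
  by (rule borel_open[OF open_coset])

lemma H_borel [measurable]: "H n \<in> sets borel"
  by (rule borel_open[OF open_H])

lemma coset_subset:
  assumes "n \<le> m" "a - b \<in> H m"
  shows "coset a n \<subseteq> coset b m"
proof
  fix x assume "x \<in> coset a n"
  then have "x - a \<in> H m" using H_mono[OF assms(1)] by auto
  then show "x \<in> coset b m" using assms(2) by (auto intro: H_diff_trans)
qed

text \<open>A common point \<open>x\<close> gives \<open>a - b = (a - x) + (x - b)\<close>, which
  lies in the larger subgroup. Cosets are the balls of an ultrametric, nested or disjoint, and this
  makes them an intersection-stable generator.\<close>

lemma coset_Int:
  assumes "n \<le> m"
  shows "coset a n \<inter> coset b m = (if a - b \<in> H m then coset a n else {})"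
proof (cases "a - b \<in> H m")
  case True
  then show ?thesis using coset_subset[OF assms True] by auto
next
  case False
  have "a - b \<in> H m" if "x - a \<in> H n" "x - b \<in> H m" for x
    using that H_mono[OF assms] H_diff_trans[of a x m b] H_diff_commute[of x a m] by auto
  then show ?thesis using False by auto
qed

text \<open>By compactness: the sets \<open>H (- k) - U\<close> are compact and decreasing, and a
  common point would belong to every \<open>H n\<close>, hence be zero, which lies in
  \<open>U\<close>. So the filtration is a base of neighbourhoods of zero.\<close>

lemma H_subset_open:
  assumes "open U" "0 \<in> U"
  shows "\<exists>n. H n \<subseteq> U"
proof (rule ccontr)
  assume "\<nexists>n. H n \<subseteq> U"
  then have ne: "H (- int k) - U \<noteq> {}" for k by blast
  have "(\<Inter>k. H (- int k) - U) \<noteq> {}"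
  proof (rule nested_compact_nonempty)
    show "compact (H (- int n) - U)" for n by (rule compact_diff[OF compact_H assms(1)])
    show "H (- int (Suc n)) - U \<subseteq> H (- int n) - U" for n
      using H_mono[of "- int (Suc n)" "- int n"] by auto
  qed (rule ne)
  then obtain x where x: "\<And>k. x \<in> H (- int k)" "x \<notin> U" by auto
  have "x \<in> H n" for n
  proof -
    have "- int (nat (- n)) \<le> n" by simp
    from H_mono[OF this] x(1)[of "nat (- n)"] show ?thesis by blast
  qed
  then have "x \<in> {0}" using Inter_H by blast
  then show False using x assms by auto
qed

lemma coset_subset_open:
  assumes "open U" "a \<in> U"
  shows "\<exists>n. coset a n \<subseteq> U"
proof -
  have "open ((\<lambda>x. a + x) -` U)"
    by (rule open_vimage[OF assms(1)]) (intro continuous_intros)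
  moreover have "0 \<in> (\<lambda>x. a + x) -` U" using assms(2) by simp
  ultimately obtain n where "H n \<subseteq> (\<lambda>x. a + x) -` U" using H_subset_open by blast
  then show ?thesis unfolding coset_eq_image by blast
qed

text \<open>The empty set is included so that the family is closed under intersection.\<close>

definition Cosets :: "'a set set" where
  "Cosets = insert {} (range (\<lambda>(a, n). coset a n))"

lemma coset_in_Cosets [simp]: "coset a n \<in> Cosets"
  unfolding Cosets_def by auto

lemma H_in_Cosets [simp]: "H n \<in> Cosets"
  using coset_in_Cosets[of 0 n] by simp

lemma empty_in_Cosets [simp]: "{} \<in> Cosets"
  unfolding Cosets_def by auto

lemma Cosets_cases:
  assumes "C \<in> Cosets"
  obtains "C = {}" | a n where "C = coset a n"
  using assms unfolding Cosets_def by auto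

lemma Cosets_open: "C \<in> Cosets \<Longrightarrow> open C"
  and Cosets_closed: "C \<in> Cosets \<Longrightarrow> closed C"
  by (auto elim!: Cosets_cases simp: open_coset closed_coset)

lemma Int_stable_Cosets: "Int_stable Cosets"
proof (rule Int_stableI)
  fix A B assume A: "A \<in> Cosets" and B: "B \<in> Cosets"
  show "A \<inter> B \<in> Cosets"
  proof (cases rule: Cosets_cases[OF A])
    case 1 then show ?thesis by simp
  next
    case (2 a n)
    note A2 = 2
    show ?thesis
    proof (cases rule: Cosets_cases[OF B])
      case 1 then show ?thesis by simp
    next
      case (2 b m)
      show ?thesis
      proof (cases "n \<le> m")
        case True
        then show ?thesis unfolding A2 2 by (subst coset_Int) auto
      next
        case False
        then show ?thesis unfolding A2 2 by (subst Int_commute, subst coset_Int) auto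
      qed
    qed
  qed
qed

text \<open>Second countability enters through the Lindelof property. It makes the cosets generate
  the Borel sets and not merely the topology.\<close>

lemma open_Union_countable_cosets:
  assumes "open U"
  shows "\<exists>F. countable F \<and> F \<subseteq> Cosets \<and> \<Union>F = U"
proof -
  let ?F = "{C \<in> Cosets. C \<subseteq> U}"
  have "\<Union>?F = U"
  proof
    show "U \<subseteq> \<Union>?F"
    proof
      fix x assume "x \<in> U"
      then obtain n where "coset x n \<subseteq> U" using coset_subset_open[OF assms] by blast
      moreover have "x \<in> coset x n" by simp
      ultimately show "x \<in> \<Union>?F" using coset_in_Cosets[of x n] by blast
    qed
  qed auto
  moreover obtain F' where "F' \<subseteq> ?F" "countable F'" "\<Union>F' = \<Union>?F"
    by (rule Lindelof[of ?F]) (auto intro: Cosets_open)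
  ultimately show ?thesis by (intro exI[of _ F']) auto
qed

lemma sets_borel_Cosets: "sets (borel :: 'a measure) = sigma_sets UNIV Cosets"
proof (rule antisym)
  have "sets (borel :: 'a measure) = sigma_sets UNIV {U. open U}"
    by (simp add: borel_def)
  also have "\<dots> \<subseteq> sigma_sets UNIV Cosets"
  proof (rule sigma_sets_mono, safe)
    fix U :: "'a set" assume "open U"
    then obtain F where F: "countable F" "F \<subseteq> Cosets" "\<Union>F = U"
      using open_Union_countable_cosets by blast
    show "U \<in> sigma_sets UNIV Cosets"
      unfolding F(3)[symmetric]
      by (rule sigma_sets_UNION[OF F(1)]) (use F(2) in \<open>auto intro: sigma_sets.Basic\<close>)
  qed
  finally show "sets (borel :: 'a measure) \<subseteq> sigma_sets UNIV Cosets" .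
  have "Cosets \<subseteq> sets (borel :: 'a measure)"
    using Cosets_open borel_open by blast
  then show "sigma_sets UNIV Cosets \<subseteq> sets (borel :: 'a measure)"
    using sets.sigma_sets_subset[of Cosets "borel :: 'a measure"] by simp
qed

lemma countable_cosets_cover: "\<exists>F. countable F \<and> F \<subseteq> range (\<lambda>a. coset a n) \<and> \<Union>F = UNIV"
proof -
  obtain F' where "F' \<subseteq> range (\<lambda>a. coset a n)" "countable F'" "\<Union>F' = \<Union>(range (\<lambda>a. coset a n))"
    by (rule Lindelof[of "range (\<lambda>a. coset a n)"]) (auto simp: open_coset)
  moreover have "x \<in> \<Union>(range (\<lambda>a. coset a n))" for x
  proof -
    have "x \<in> coset x n" by simp
    then show ?thesis by blast
  qed
  ultimately show ?thesis by (intro exI[of _ F']) auto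
qed

lemma borel_measurable_CosetsI:
  assumes "\<And>a n. f -` coset a n \<inter> space M \<in> sets M"
  shows "f \<in> M \<rightarrow>\<^sub>M borel"
proof (rule measurable_sigma_sets[OF sets_borel_Cosets])
  show "f -` C \<inter> space M \<in> sets M" if "C \<in> Cosets" for C
    using that
  proof (cases rule: Cosets_cases)
    case 1
    then show ?thesis by simp
  next
    case (2 a n)
    then show ?thesis using assms by blast
  qed
qed simp_all

text \<open>Finiteness on each \<open>H n\<close> supplies the exhaustion by sets of finite measure
  that uniqueness on an intersection-stable generator requires.\<close>

lemma measure_eqI_Cosets:
  assumes "sets M = sets borel" "sets N = sets borel"
    and "\<And>a n. emeasure M (coset a n) = emeasure N (coset a n)"
    and fin: "\<And>n. emeasure M (H n) \<noteq> \<infinity>"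
  shows "M = N"
proof (rule measure_eqI_generator_eq[OF Int_stable_Cosets, where \<Omega> = UNIV and A = "\<lambda>i. H (int i)"])
  show "emeasure M X = emeasure N X" if "X \<in> Cosets" for X
    using that
  proof (cases rule: Cosets_cases)
    case 1
    then show ?thesis by simp
  next
    case (2 a n)
    then show ?thesis using assms(3) by blast
  qed
  show "(\<Union>i. H (int i)) = UNIV"
  proof -
    have "x \<in> (\<Union>i. H (int i))" for x
    proof -
      obtain n where "x \<in> H n" using ex_in_H by blast
      then have "x \<in> H (int (nat n))" using H_mono[of n "int (nat n)"] by auto
      then show ?thesis by blast
    qed
    then show ?thesis by auto
  qed
qed (use assms sets_borel_Cosets in auto)

section \<open>The Haar measure and its translation invariance\<close>

lemma sets_mu [simp, measurable_cong]: "sets \<mu> = sets borel"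
  using haar by (simp add: haar_measure_def)

lemma space_mu [simp]: "space \<mu> = UNIV"
  using sets_eq_imp_space_eq[OF sets_mu] by simp

lemma emeasure_translate: "B \<in> sets borel \<Longrightarrow> emeasure \<mu> ((\<lambda>y. x + y) ` B) = emeasure \<mu> B"
  using haar by (simp add: haar_measure_def)

lemma emeasure_coset: "emeasure \<mu> (coset a n) = emeasure \<mu> (H n)"
  unfolding coset_eq_image by (rule emeasure_translate) simp

definition lam :: "int \<Rightarrow> real" where "lam n = measure \<mu> (H n)"

lemma lam_nonneg [simp]: "0 \<le> lam n"
  unfolding lam_def by (rule measure_nonneg)

lemma emeasure_H: "emeasure \<mu> (H n) = ennreal (lam n)"
  using haar compact_H unfolding lam_def haar_measure_def
  by (intro emeasure_eq_ennreal_measure) (auto simp: less_top)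

lemma emeasure_coset': "emeasure \<mu> (coset a n) = ennreal (lam n)"
  by (simp add: emeasure_coset emeasure_H)

lemma measure_H [simp]: "measure \<mu> (H n) = lam n"
  by (rule lam_def[symmetric])

lemma measure_coset [simp]: "measure \<mu> (coset a n) = lam n"
  by (simp add: emeasure_coset' measure_def)

lemma lam_0 [simp]: "lam 0 = 1"
  using emeasure_H0 unfolding lam_def measure_def by simp

lemma lam_mono: "n \<le> m \<Longrightarrow> lam n \<le> lam m"
  unfolding lam_def by (rule measure_mono_fmeasurable) (use H_mono in \<open>auto simp: fmeasurable_def emeasure_H\<close>)

text \<open>Countably many translates of \<open>H n\<close> cover the group. If one were null, all
  would be, and so would the whole group.\<close>

lemma lam_pos: "lam n > 0"
proof (rule ccontr)
  assume "\<not> lam n > 0"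
  then have "lam n = 0" using lam_nonneg[of n] by linarith
  then have null: "coset a n \<in> null_sets \<mu>" for a
    by (auto simp: null_sets_def emeasure_coset')
  obtain F where F: "countable F" "F \<subseteq> range (\<lambda>a. coset a n)" "\<Union>F = UNIV"
    using countable_cosets_cover[of n] by blast
  have "(\<Union>C\<in>F. C) \<in> null_sets \<mu>"
    by (rule null_sets_UN') (use F null in auto)
  then have "emeasure \<mu> UNIV = 0" using F by auto
  then show False using haar by (simp add: haar_measure_def)
qed

lemma lam_neq_0 [simp]: "lam n \<noteq> 0"
  using lam_pos[of n] by simp

sublocale sigma_finite_measure \<mu>
proof
  show "\<exists>A. countable A \<and> A \<subseteq> sets \<mu> \<and> \<Union>A = space \<mu> \<and> (\<forall>a\<in>A. emeasure \<mu> a \<noteq> \<infinity>)"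
    by (rule exI[of _ "range H"]) (auto simp: Union_H emeasure_H)
qed

lemma measurable_add_left: "(\<lambda>y. a + y) \<in> borel \<rightarrow>\<^sub>M (borel :: 'a measure)"
  by measurable

lemma measurable_minus [measurable]: "uminus \<in> borel \<rightarrow>\<^sub>M (borel :: 'a measure)"
  by (rule borel_measurable_continuous_onI) (intro continuous_intros)

lemma measurable_diff_pair [measurable]:
  "(\<lambda>p. fst p - snd p) \<in> borel \<Otimes>\<^sub>M borel \<rightarrow>\<^sub>M (borel :: 'a measure)"
  unfolding borel_prod by (rule borel_measurable_continuous_onI) (intro continuous_intros)

lemma borel_measurable_diff' [measurable (raw)]:
  assumes "f \<in> M \<rightarrow>\<^sub>M (borel :: 'a measure)" "g \<in> M \<rightarrow>\<^sub>M (borel :: 'a measure)"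
  shows "(\<lambda>x. f x - g x) \<in> M \<rightarrow>\<^sub>M borel"
  using measurable_compose[OF measurable_Pair[OF assms] measurable_diff_pair] by simp

lemma distr_translate: "distr \<mu> borel (\<lambda>y. y + a) = \<mu>"
proof (rule measure_eqI)
  fix B assume "B \<in> sets (distr \<mu> borel (\<lambda>y. y + a))"
  then have B: "B \<in> sets borel" by simp
  have "(\<lambda>y. y + a) -` B = (\<lambda>y. - a + y) ` B"
  proof -
    have "x \<in> (\<lambda>y. - a + y) ` B" if "x + a \<in> B" for x
      using that by (intro image_eqI[of _ _ "x + a"]) auto
    then show ?thesis by auto
  qed
  then show "emeasure (distr \<mu> borel (\<lambda>y. y + a)) B = emeasure \<mu> B"
    using B by (subst emeasure_distr) (use emeasure_translate[of B "- a"] in auto)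
qed simp

lemma integral_translate:
  fixes f :: "'a \<Rightarrow> 'b::{banach, second_countable_topology}"
  shows "f \<in> borel_measurable borel \<Longrightarrow> (LINT y|\<mu>. f (y + a)) = (LINT y|\<mu>. f y)"
  by (subst (2) distr_translate[of a, symmetric], subst integral_distr) auto

lemma integrable_translate:
  fixes f :: "'a \<Rightarrow> 'b::{banach, second_countable_topology}"
  assumes "f \<in> borel_measurable borel"
  shows "integrable \<mu> (\<lambda>y. f (y + a)) \<longleftrightarrow> integrable \<mu> f"
  by (subst (2) distr_translate[of a, symmetric], subst integrable_distr_eq) (use assms in auto)

section \<open>The pairing defined by the characters\<close>

lemma ch_cont: "continuous_on A (ch \<xi>)"
  using ch_char[of \<xi>] continuous_on_subset unfolding characters_def by blast

lemma ch_norm [simp]: "cmod (ch \<xi> x) = 1"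
  using ch_char[of \<xi>] unfolding characters_def by blast

lemma ch_add: "ch \<xi> (x + y) = ch \<xi> x * ch \<xi> y"
  using ch_char[of \<xi>] unfolding characters_def by blast

lemma ch_nonzero [simp]: "ch \<xi> x \<noteq> 0"
  using ch_norm[of \<xi> x] by force

lemma ch_zero [simp]: "ch \<xi> 0 = 1" "ch 0 x = 1"
  using ch_add[of \<xi> 0 0] ch_add_left[of 0 0 x] by auto

lemma cnj_ch: "cnj (ch \<xi> x) = inverse (ch \<xi> x)"
proof -
  have "ch \<xi> x * cnj (ch \<xi> x) = 1"
    by (metis ch_norm complex_norm_square of_real_1 one_power2)
  then show ?thesis by (simp add: field_simps)
qed

lemma ch_mult_cnj [simp]: "ch \<xi> x * cnj (ch \<xi> x) = 1" "cnj (ch \<xi> x) * ch \<xi> x = 1"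
  by (simp_all add: cnj_ch)

lemma ch_minus: "ch \<xi> (- x) = cnj (ch \<xi> x)" "ch (- \<xi>) x = cnj (ch \<xi> x)"
  using ch_add[of \<xi> x "-x"] ch_add_left[of \<xi> "-\<xi>" x] by (simp_all add: cnj_ch field_simps)

lemma ch_diff: "ch \<xi> (x - y) = ch \<xi> x * cnj (ch \<xi> y)" "ch (\<xi> - \<eta>) x = ch \<xi> x * cnj (ch \<eta> x)"
  using ch_add[of \<xi> x "-y"] ch_add_left[of \<xi> "-\<eta>" x] by (simp_all add: ch_minus)

lemma ch_H_eq_1: "\<xi> \<in> H (- n) \<Longrightarrow> x \<in> H n \<Longrightarrow> ch \<xi> x = 1"
  using annihilator_H[of n] unfolding annihilator_def by blast

lemma mem_H_annihilator: "\<xi> \<in> H (- n) \<longleftrightarrow> (\<forall>x\<in>H n. ch \<xi> x = 1)"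
  using annihilator_H[of n] unfolding annihilator_def by blast

lemma ch_eq_of_diff: "\<xi> - \<xi>' \<in> H (- n) \<Longrightarrow> x \<in> H n \<Longrightarrow> ch \<xi> x = ch \<xi>' x"
  using ch_H_eq_1[of "\<xi> - \<xi>'" n x] ch_add_left[of "\<xi> - \<xi>'" \<xi>' x] by simp

text \<open>For \<open>x\<close> in the open set \<open>H n\<close> the value
  \<open>ch \<xi> x\<close> depends only on the class of \<open>\<xi>\<close> modulo
  \<open>H (- n)\<close>. Hence near a given point the first variable can be frozen, and continuity
  of a single character remains. Joint measurability, and with it Fubini's theorem for
  \<open>ch\<close>, rests on this.\<close>

lemma ch_cont_pair: "continuous_on UNIV (\<lambda>p. ch (fst p) (snd p))"
proof (rule continuous_at_imp_continuous_on, rule ballI)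
  fix p :: "'a \<times> 'a"
  obtain n where n: "snd p \<in> H n" using ex_in_H by blast
  have "open (coset (fst p) (- n) \<times> H n)" "p \<in> coset (fst p) (- n) \<times> H n"
    using n by (auto intro!: open_Times open_coset open_H simp: mem_Times_iff)
  then have "eventually (\<lambda>q. q \<in> coset (fst p) (- n) \<times> H n) (nhds p)"
    by (rule eventually_nhds_in_open)
  then have ev: "eventually (\<lambda>q. ch (fst q) (snd q) = ch (fst p) (snd q)) (nhds p)"
    by eventually_elim (auto intro: ch_eq_of_diff)
  have "continuous_on UNIV (\<lambda>q. ch (fst p) (snd q))"
    by (rule continuous_on_compose2[OF ch_cont[of UNIV]]) (auto intro: continuous_intros)
  then have "isCont (\<lambda>q. ch (fst p) (snd q)) p"
    using continuous_on_eq_continuous_at[OF open_UNIV] by blast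
  then show "isCont (\<lambda>q. ch (fst q) (snd q)) p"
    using isCont_cong[OF ev] by simp
qed

lemma measurable_ch_pair: "(\<lambda>p. ch (fst p) (snd p)) \<in> borel_measurable (borel \<Otimes>\<^sub>M borel)"
  unfolding borel_prod by (rule borel_measurable_continuous_onI[OF ch_cont_pair])

lemma measurable_ch [measurable (raw)]:
  assumes "f \<in> M \<rightarrow>\<^sub>M borel" "g \<in> M \<rightarrow>\<^sub>M borel"
  shows "(\<lambda>x. ch (f x) (g x)) \<in> borel_measurable M"
  using measurable_compose[OF measurable_Pair[OF assms] measurable_ch_pair] by simp

section \<open>Orthogonality relations and the measures of dual subgroups\<close>

lemma integrable_bounded_support:
  fixes f :: "'a \<Rightarrow> 'b::{banach, second_countable_topology}"
  assumes "f \<in> borel_measurable borel" "emeasure \<mu> B < \<infinity>" "B \<in> sets borel"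
    and "\<And>x. x \<in> B \<Longrightarrow> norm (f x) \<le> c" "\<And>x. x \<notin> B \<Longrightarrow> f x = 0"
  shows "integrable \<mu> f"
proof (rule Bochner_Integration.integrable_bound)
  show "integrable \<mu> (\<lambda>x. indicator B x * c :: real)"
    using assms by simp
  show "AE x in \<mu>. norm (f x) \<le> norm (indicator B x * c)"
  proof (rule AE_I2)
    fix x
    show "norm (f x) \<le> norm (indicator B x * c)"
      using assms(4,5)[of x] by (cases "x \<in> B") auto
  qed
qed (use assms in simp)

text \<open>Orthogonality: translating by \<open>b \<in> B\<close> with
  \<open>\<psi> b \<noteq> 1\<close> multiplies the integral by \<open>\<psi> b\<close>, so it
  vanishes. Subgroup and homomorphism are general because the rule is applied to both variables of
  \<open>ch\<close> and to the superlevel sets of the heat symbol.\<close>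

lemma integral_char_subgroup:
  assumes B: "B \<in> sets borel" "add_subgroup B"
    and \<psi>: "\<psi> \<in> borel_measurable borel" "\<And>x y. \<psi> (x + y) = \<psi> x * (\<psi> y :: complex)"
  shows "(LINT x|\<mu>. indicator B x * \<psi> x) = (if \<forall>x\<in>B. \<psi> x = 1 then of_real (measure \<mu> B) else 0)"
proof (cases "\<forall>x\<in>B. \<psi> x = 1")
  case True
  then have "(LINT x|\<mu>. indicator B x * \<psi> x) = (LINT x|\<mu>. complex_of_real (indicator B x))"
    by (intro Bochner_Integration.integral_cong) (auto split: split_indicator)
  then show ?thesis using True B by simp
next
  case False
  then obtain b where b: "b \<in> B" "\<psi> b \<noteq> 1" by blast
  have iff: "x + b \<in> B \<longleftrightarrow> x \<in> B" for x
  proof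
    assume "x + b \<in> B"
    then have "(x + b) + (- b) \<in> B" using B(2) b(1) unfolding add_subgroup_def by blast
    then show "x \<in> B" by simp
  qed (use B(2) b(1) in \<open>auto simp: add_subgroup_def\<close>)
  have "(LINT x|\<mu>. indicator B x * \<psi> x) = (LINT x|\<mu>. indicator B (x + b) * \<psi> (x + b))"
    using B(1) \<psi>(1) by (intro integral_translate[of "\<lambda>x. indicator B x * \<psi> x", symmetric]) simp
  also have "\<dots> = (LINT x|\<mu>. \<psi> b * (indicator B x * \<psi> x))"
    by (intro Bochner_Integration.integral_cong) (auto simp: \<psi>(2) iff indicator_def)
  finally have "(LINT x|\<mu>. indicator B x * \<psi> x) = \<psi> b * (LINT x|\<mu>. indicator B x * \<psi> x)"
    by simp
  then have "(LINT x|\<mu>. indicator B x * \<psi> x) = 0" using b(2) by simp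
  then show ?thesis using False by (subst if_not_P) auto
qed

lemma integral_H_ch: "(LINT x|\<mu>. indicator (H n) x * ch \<xi> x) = indicator (H (- n)) \<xi> * of_real (lam n)"
  by (subst integral_char_subgroup) (auto simp: subgroup_H ch_add mem_H_annihilator[symmetric])

text \<open>The annihilator of \<open>H m\<close> in the second variable. As the pairing is not
  assumed symmetric, this is not a priori \<open>annihilator ch (H m)\<close>; the two are
  identified in \<open>right_ann_H\<close>.\<close>

definition right_ann :: "int \<Rightarrow> 'a set" where
  "right_ann m = {x. \<forall>\<xi>\<in>H m. ch \<xi> x = 1}"

lemma integral_H_ch_left: "(LINT \<xi>|\<mu>. indicator (H m) \<xi> * ch \<xi> x) = indicator (right_ann m) x * of_real (lam m)"
  by (subst integral_char_subgroup) (auto simp: subgroup_H ch_add_left right_ann_def)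

lemma closed_right_ann: "closed (right_ann m)"
proof -
  have "closed (\<Inter>\<xi>\<in>H m. {x. ch \<xi> x = 1})"
    by (intro closed_INT ballI closed_Collect_eq) (auto intro: ch_cont)
  moreover have "(\<Inter>\<xi>\<in>H m. {x. ch \<xi> x = 1}) = right_ann m"
    by (auto simp: right_ann_def)
  ultimately show ?thesis by simp
qed

lemma right_ann_borel [measurable]: "right_ann m \<in> sets borel"
  by (rule borel_closed[OF closed_right_ann])

lemma H_subset_right_ann: "H (- m) \<subseteq> right_ann m"
  using ch_H_eq_1[of _ "-m"] by (auto simp: right_ann_def)

text \<open>Integrating \<open>ch\<close> over \<open>H m \<times> H n\<close> in both orders.\<close>

lemma lam_Fubini:
  assumes "- n \<le> m"
  shows "lam n * lam (- n) = lam m * measure \<mu> (H n \<inter> right_ann m)"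
proof -
  interpret P: pair_sigma_finite \<mu> \<mu> ..
  let ?f = "\<lambda>\<xi> x. indicator (H m) \<xi> * (indicator (H n) x * ch \<xi> x)"
  have int: "integrable (\<mu> \<Otimes>\<^sub>M \<mu>) (\<lambda>(\<xi>, x). ?f \<xi> x)"
  proof (rule Bochner_Integration.integrable_bound)
    show "integrable (\<mu> \<Otimes>\<^sub>M \<mu>) (indicator (H m \<times> H n) :: _ \<Rightarrow> real)"
      by (intro integrable_real_indicator)
         (auto simp: emeasure_pair_measure_Times emeasure_H ennreal_mult_less_top)
    show "AE p in \<mu> \<Otimes>\<^sub>M \<mu>. norm (case p of (\<xi>, x) \<Rightarrow> ?f \<xi> x) \<le> norm (indicator (H m \<times> H n) p :: real)"
      by (intro AE_I2) (simp add: norm_mult indicator_def split: prod.splits)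
  qed measurable
  have "(LINT \<xi>|\<mu>. LINT x|\<mu>. ?f \<xi> x) = (LINT x|\<mu>. LINT \<xi>|\<mu>. ?f \<xi> x)"
    by (rule P.Fubini_integral[OF int, symmetric])
  \<comment> \<open>The assumption gives \<open>H (- n) \<subseteq> H m\<close>, so restricting to
    \<open>H m\<close> does not cut the support \<open>H (- n)\<close> of the inner
    integral.\<close>
  also have "(LINT \<xi>|\<mu>. LINT x|\<mu>. ?f \<xi> x) = (LINT \<xi>|\<mu>. of_real (indicator (H (- n)) \<xi> * lam n))"
    using H_mono[OF assms] by (intro Bochner_Integration.integral_cong) (auto simp: integral_H_ch split: split_indicator)
  also have "\<dots> = of_real (lam n * lam (- n))"
    by (subst integral_complex_of_real) simp
  also have "(LINT x|\<mu>. LINT \<xi>|\<mu>. ?f \<xi> x) = (LINT x|\<mu>. of_real (indicator (H n \<inter> right_ann m) x * lam m))"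
  proof (rule Bochner_Integration.integral_cong)
    fix x
    have "(LINT \<xi>|\<mu>. ?f \<xi> x) = (LINT \<xi>|\<mu>. indicator (H n) x * (indicator (H m) \<xi> * ch \<xi> x))"
      by (simp add: ac_simps)
    also have "\<dots> = indicator (H n) x * (indicator (right_ann m) x * of_real (lam m))"
      by (simp add: integral_H_ch_left)
    also have "\<dots> = of_real (indicator (H n \<inter> right_ann m) x * lam m)"
      by (auto split: split_indicator)
    finally show "(LINT \<xi>|\<mu>. ?f \<xi> x) = of_real (indicator (H n \<inter> right_ann m) x * lam m)" .
  qed simp
  also have "\<dots> = of_real (lam m * measure \<mu> (H n \<inter> right_ann m))"
    by (subst integral_complex_of_real) simp
  finally show ?thesis by (simp only: of_real_eq_iff)
qed

lemma H_Int_fmeasurable: "B \<in> sets borel \<Longrightarrow> H n \<inter> B \<in> fmeasurable \<mu>"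
  by (rule fmeasurableI2[of "H n"]) (auto simp: fmeasurable_def emeasure_H)

lemma measure_H_right_ann_ge:
  assumes "- n \<le> m"
  shows "lam (- m) \<le> measure \<mu> (H n \<inter> right_ann m)"
proof -
  have "measure \<mu> (H (- m)) \<le> measure \<mu> (H n \<inter> right_ann m)"
    using H_mono[of "- m" n] assms H_subset_right_ann[of m]
    by (intro measure_mono_fmeasurable H_Int_fmeasurable) auto
  then show ?thesis by simp
qed

text \<open>Since \<open>H (- m)\<close> is contained in \<open>H n \<inter> right_ann m\<close>,
  the Fubini identity yields \<open>lam m * lam (- m) \<le> lam n * lam (- n)\<close> whenever
  \<open>- n \<le> m\<close>. For \<open>n = \<bar>m\<bar>\<close> this may be used in both
  directions, also with 0 in place of \<open>m\<close>, and \<open>lam 0 = 1\<close> fixes the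
  common value.\<close>

lemma lam_duality: "lam m * lam (- m) = 1"
proof -
  have le: "lam m * lam (- m) \<le> lam n * lam (- n)" if "- n \<le> m" for m n
    unfolding lam_Fubini[OF that]
    by (intro mult_left_mono measure_H_right_ann_ge that) simp
  define n where "n = \<bar>m\<bar>"
  have "lam m * lam (- m) = lam n * lam (- n)"
    by (intro antisym le) (auto simp: n_def)
  moreover have "lam 0 * lam (- 0) = lam n * lam (- n)"
    by (intro antisym le) (auto simp: n_def)
  ultimately show ?thesis by simp
qed

text \<open>By duality of the measures, \<open>H n \<inter> right_ann m\<close> has the same measure
  as its subset \<open>H (- m)\<close> once \<open>n\<close> is large. A point outside
  \<open>H (- m)\<close> would bring in a whole coset of that subgroup, disjoint from it, and double
  the measure.\<close>

lemma right_ann_H: "right_ann m = H (- m)"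
proof (rule antisym[OF _ H_subset_right_ann], rule subsetI, rule ccontr)
  fix x assume x: "x \<in> right_ann m" "x \<notin> H (- m)"
  obtain k where k: "x \<in> H k" using ex_in_H by blast
  define n where "n = max k \<bar>m\<bar>"
  have n: "- n \<le> m" "- m \<le> n" "x \<in> H n" using H_mono[of k n] k by (auto simp: n_def)
  have "lam m * measure \<mu> (H n \<inter> right_ann m) = lam m * lam (- m)"
    using lam_Fubini[OF n(1)] by (simp add: lam_duality)
  then have eq: "measure \<mu> (H n \<inter> right_ann m) = lam (- m)" by simp
  have "coset x (- m) \<subseteq> H n"
    using coset_subset[of "- m" n x 0] n by simp
  moreover have "coset x (- m) \<subseteq> right_ann m"
  proof
    fix y assume "y \<in> coset x (- m)"
    then have "y - x \<in> right_ann m" using H_subset_right_ann[of m] by auto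
    then show "y \<in> right_ann m" using x(1) ch_add[of _ "y - x" x] by (auto simp: right_ann_def)
  qed
  moreover have "H (- m) \<subseteq> H n" using H_mono n(2) .
  ultimately have sub: "H (- m) \<union> coset x (- m) \<subseteq> H n \<inter> right_ann m"
    using H_subset_right_ann[of m] by blast
  have "H (- m) \<inter> coset x (- m) = {}"
    using coset_Int[of "- m" "- m" x 0] x(2) by auto
  then have "2 * lam (- m) = measure \<mu> (H (- m) \<union> coset x (- m))"
    by (subst measure_Un3) (auto simp: fmeasurable_def emeasure_H emeasure_coset')
  also have "\<dots> \<le> measure \<mu> (H n \<inter> right_ann m)"
    using sub by (intro measure_mono_fmeasurable H_Int_fmeasurable) auto
  finally show False using eq lam_pos[of "- m"] by simp
qed

lemma integral_coset_ch:
  "(LINT x|\<mu>. indicator (coset a n) x * ch \<xi> x) = ch \<xi> a * indicator (H (- n)) \<xi> * of_real (lam n)"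
proof -
  have "(LINT x|\<mu>. indicator (coset a n) x * ch \<xi> x)
      = (LINT x|\<mu>. indicator (coset a n) (x + a) * ch \<xi> (x + a))"
    by (intro integral_translate[of "\<lambda>x. indicator (coset a n) x * ch \<xi> x", symmetric]) measurable
  also have "\<dots> = (LINT x|\<mu>. ch \<xi> a * (indicator (H n) x * ch \<xi> x))"
    by (intro Bochner_Integration.integral_cong) (auto simp: indicator_def ch_add)
  finally show ?thesis by (simp add: integral_H_ch)
qed

end

section \<open>The space of square integrable functions\<close>

lemma L2I: "f \<in> borel_measurable M \<Longrightarrow> integrable M (\<lambda>x. (cmod (f x))\<^sup>2) \<Longrightarrow> f \<in> L2 M"
  by (simp add: L2_def)

lemma L2_measurable [measurable_dest]: "f \<in> L2 M \<Longrightarrow> f \<in> borel_measurable M"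
  and L2_integrable: "f \<in> L2 M \<Longrightarrow> integrable M (\<lambda>x. (cmod (f x))\<^sup>2)"
  by (simp_all add: L2_def)

lemma L2_bound:
  assumes "g \<in> borel_measurable M" "integrable M W" "AE x in M. (cmod (g x))\<^sup>2 \<le> W x"
  shows "g \<in> L2 M"
proof (rule L2I[OF assms(1)])
  show "integrable M (\<lambda>x. (cmod (g x))\<^sup>2)"
    by (rule Bochner_Integration.integrable_bound[OF assms(2)])
       (use assms(1,3) in \<open>auto elim!: eventually_mono\<close>)
qed

lemma L2_norm_nonneg [simp]: "0 \<le> L2_norm M f"
  by (simp add: L2_norm_def)

lemma L2_norm_power2: "(L2_norm M f)\<^sup>2 = (LINT x|M. (cmod (f x))\<^sup>2)"
  by (simp add: L2_norm_def)

lemma L2_norm_zero [simp]: "L2_norm M (\<lambda>x. 0) = 0"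
  by (simp add: L2_norm_def)

lemma L2_norm_mono:
  assumes "g \<in> L2 M" "f \<in> L2 M" "AE x in M. cmod (f x) \<le> cmod (g x)"
  shows "L2_norm M f \<le> L2_norm M g"
  unfolding L2_norm_def
  by (intro real_sqrt_le_mono integral_mono_AE L2_integrable assms)
     (use assms(3) in \<open>auto elim!: eventually_mono intro: power_mono\<close>)

lemma L2_norm_cong_AE:
  assumes "f \<in> borel_measurable M" "g \<in> borel_measurable M" "AE x in M. f x = g x"
  shows "L2_norm M f = L2_norm M g"
  unfolding L2_norm_def using assms
  by (intro arg_cong[where f = sqrt] integral_cong_AE) auto

lemma L2_cong_AE:
  assumes "f \<in> L2 M" "g \<in> borel_measurable M" "AE x in M. f x = g x"
  shows "g \<in> L2 M"
  by (rule L2_bound[OF assms(2) L2_integrable[OF assms(1)]])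
     (use assms(3) in \<open>auto elim!: eventually_mono\<close>)

text \<open>Expanding the square of \<open>sqrt c * cmod u - cmod v / sqrt c\<close> bounds the
  mixed term. The free weight \<open>c\<close> is what allows the sharp triangle inequality of the
  \<open>L2\<close> norm to be derived by integration.\<close>

lemma cmod_add_power2_le:
  assumes "c > 0"
  shows "(cmod (u + v))\<^sup>2 \<le> (1 + c) * (cmod u)\<^sup>2 + (1 + inverse c) * (cmod v)\<^sup>2"
proof -
  have "0 \<le> (sqrt c * cmod u - cmod v / sqrt c)\<^sup>2" by simp
  also have "\<dots> = c * (cmod u)\<^sup>2 + inverse c * (cmod v)\<^sup>2 - 2 * cmod u * cmod v"
    using assms by (simp add: power2_diff power_mult_distrib power_divide field_simps)
  finally have "2 * cmod u * cmod v \<le> c * (cmod u)\<^sup>2 + inverse c * (cmod v)\<^sup>2" by simp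
  moreover have "(cmod (u + v))\<^sup>2 \<le> (cmod u + cmod v)\<^sup>2"
    by (intro power_mono norm_triangle_ineq) simp
  ultimately show ?thesis by (simp add: power2_sum algebra_simps)
qed

lemma L2_add:
  assumes "f \<in> L2 M" "g \<in> L2 M"
  shows "(\<lambda>x. f x + g x) \<in> L2 M"
proof (rule L2_bound)
  show "integrable M (\<lambda>x. 2 * (cmod (f x))\<^sup>2 + 2 * (cmod (g x))\<^sup>2)"
    by (intro Bochner_Integration.integrable_add integrable_mult_right L2_integrable assms)
  show "AE x in M. (cmod (f x + g x))\<^sup>2 \<le> 2 * (cmod (f x))\<^sup>2 + 2 * (cmod (g x))\<^sup>2"
    using cmod_add_power2_le[of 1] by simp
qed (use assms in measurable)

lemma L2_mult_left:
  assumes "f \<in> L2 M"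
  shows "(\<lambda>x. c * f x) \<in> L2 M"
  using assms by (intro L2I) (auto simp: norm_mult power_mult_distrib intro: L2_integrable)

lemma L2_zero [simp]: "(\<lambda>x. 0) \<in> L2 M"
  by (rule L2I) auto

lemma L2_uminus: "f \<in> L2 M \<Longrightarrow> (\<lambda>x. - f x) \<in> L2 M"
  using L2_mult_left[of f M "-1"] by simp

lemma L2_diff: "f \<in> L2 M \<Longrightarrow> g \<in> L2 M \<Longrightarrow> (\<lambda>x. f x - g x) \<in> L2 M"
  using L2_add[of f M "\<lambda>x. - g x"] L2_uminus[of g M] by simp

lemma L2_norm_mult_left: "L2_norm M (\<lambda>x. c * f x) = cmod c * L2_norm M f"
  by (simp add: L2_norm_def norm_mult power_mult_distrib real_sqrt_mult)

lemma L2_norm_minus_commute: "L2_norm M (\<lambda>x. f x - g x) = L2_norm M (\<lambda>x. g x - f x)"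
  by (simp add: L2_norm_def norm_minus_commute)

lemma L2_norm_triangle:
  assumes "f \<in> L2 M" "g \<in> L2 M"
  shows "L2_norm M (\<lambda>x. f x + g x) \<le> L2_norm M f + L2_norm M g"
proof (rule field_le_epsilon)
  fix e :: real assume "e > 0"
  \<comment> \<open>The weight \<open>c = b / a\<close> turns the integrated bound into the square
    of \<open>a + b\<close>. The added \<open>e / 2\<close> keeps \<open>a\<close> and
    \<open>b\<close> positive when a norm vanishes.\<close>
  define a where "a = L2_norm M f + e / 2"
  define b where "b = L2_norm M g + e / 2"
  define c where "c = b / a"
  have pos: "a > 0" "b > 0" "c > 0"
    using \<open>e > 0\<close> by (auto simp: a_def b_def c_def add_nonneg_pos)
  have ints: "integrable M (\<lambda>x. (cmod (f x))\<^sup>2)" "integrable M (\<lambda>x. (cmod (g x))\<^sup>2)"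
    using assms by (auto intro: L2_integrable)
  have "(L2_norm M (\<lambda>x. f x + g x))\<^sup>2
      \<le> (LINT x|M. (1 + c) * (cmod (f x))\<^sup>2 + (1 + inverse c) * (cmod (g x))\<^sup>2)"
    unfolding L2_norm_power2
  proof (rule integral_mono)
    show "integrable M (\<lambda>x. (cmod (f x + g x))\<^sup>2)"
      by (rule L2_integrable[OF L2_add[OF assms]])
    show "integrable M (\<lambda>x. (1 + c) * (cmod (f x))\<^sup>2 + (1 + inverse c) * (cmod (g x))\<^sup>2)"
      using ints by simp
  qed (rule cmod_add_power2_le[OF pos(3)])
  also have "\<dots> = (1 + c) * (L2_norm M f)\<^sup>2 + (1 + inverse c) * (L2_norm M g)\<^sup>2"
    unfolding L2_norm_power2 using ints by simp
  also have "\<dots> \<le> (1 + c) * a\<^sup>2 + (1 + inverse c) * b\<^sup>2"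
    using pos \<open>e > 0\<close> by (intro add_mono mult_left_mono power_mono) (auto simp: a_def b_def)
  also have "\<dots> = (a + b)\<^sup>2"
  proof -
    have eqs: "c * a = b" "inverse c * b = a" using pos by (simp_all add: c_def)
    have "(1 + c) * a\<^sup>2 + (1 + inverse c) * b\<^sup>2 = a\<^sup>2 + (c * a) * a + b\<^sup>2 + (inverse c * b) * b"
      by (simp only: power2_eq_square distrib_right mult_1 mult.assoc add.assoc)
    then show ?thesis unfolding eqs by (simp add: power2_eq_square algebra_simps)
  qed
  finally have "L2_norm M (\<lambda>x. f x + g x) \<le> a + b"
    by (rule power2_le_imp_le) (use pos in simp)
  then show "L2_norm M (\<lambda>x. f x + g x) \<le> L2_norm M f + L2_norm M g + e"
    by (simp add: a_def b_def)
qed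

lemma L2_norm_triangle_diff:
  assumes "f \<in> L2 M" "g \<in> L2 M" "h \<in> L2 M"
  shows "L2_norm M (\<lambda>x. f x - h x) \<le> L2_norm M (\<lambda>x. f x - g x) + L2_norm M (\<lambda>x. g x - h x)"
  using L2_norm_triangle[OF L2_diff[OF assms(1,2)] L2_diff[OF assms(2,3)]] by simp

lemma L2_norm_diff_le:
  assumes "f \<in> L2 M" "g \<in> L2 M"
  shows "\<bar>L2_norm M f - L2_norm M g\<bar> \<le> L2_norm M (\<lambda>x. f x - g x)"
  using L2_norm_triangle_diff[OF assms L2_zero] L2_norm_triangle_diff[OF assms(2,1) L2_zero]
    L2_norm_minus_commute[of M f g] by simp

lemma L2_norm_eq_0_iff:
  assumes "f \<in> L2 M"
  shows "L2_norm M f = 0 \<longleftrightarrow> (AE x in M. f x = 0)"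
  using integral_nonneg_eq_0_iff_AE[OF L2_integrable[OF assms]] by (simp add: L2_norm_def)

lemma L2_tendsto_norm:
  assumes "f \<in> L2 M" "\<And>n. F n \<in> L2 M" "(\<lambda>n. L2_norm M (\<lambda>x. F n x - f x)) \<longlonglongrightarrow> 0"
  shows "(\<lambda>n. L2_norm M (F n)) \<longlonglongrightarrow> L2_norm M f"
proof (rule LIM_zero_cancel, rule tendsto_rabs_zero_cancel, rule tendsto_sandwich[OF _ _ tendsto_const assms(3)])
  show "\<forall>\<^sub>F n in sequentially. \<bar>L2_norm M (F n) - L2_norm M f\<bar> \<le> L2_norm M (\<lambda>x. F n x - f x)"
    by (intro always_eventually allI L2_norm_diff_le assms)
qed simp

lemma L2_tendsto_diff:
  assumes L2: "f \<in> L2 M" "g \<in> L2 M" "\<And>n. F n \<in> L2 M" "\<And>n. G n \<in> L2 M"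
    and "(\<lambda>n. L2_norm M (\<lambda>x. F n x - f x)) \<longlonglongrightarrow> 0" "(\<lambda>n. L2_norm M (\<lambda>x. G n x - g x)) \<longlonglongrightarrow> 0"
  shows "(\<lambda>n. L2_norm M (\<lambda>x. (F n x - G n x) - (f x - g x))) \<longlonglongrightarrow> 0"
proof (rule tendsto_sandwich[OF _ _ tendsto_const tendsto_add_zero[OF assms(5,6)]])
  have "L2_norm M (\<lambda>x. (F n x - G n x) - (f x - g x)) \<le> L2_norm M (\<lambda>x. F n x - f x) + L2_norm M (\<lambda>x. G n x - g x)" for n
  proof -
    have "L2_norm M (\<lambda>x. (F n x - f x) + (g x - G n x)) \<le> L2_norm M (\<lambda>x. F n x - f x) + L2_norm M (\<lambda>x. g x - G n x)"
      by (intro L2_norm_triangle L2_diff L2)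
    moreover have "(\<lambda>x. (F n x - f x) + (g x - G n x)) = (\<lambda>x. (F n x - G n x) - (f x - g x))"
      by (auto simp: algebra_simps)
    ultimately show ?thesis by (simp only: L2_norm_minus_commute[of M g])
  qed
  then show "\<forall>\<^sub>F n in sequentially. L2_norm M (\<lambda>x. (F n x - G n x) - (f x - g x))
      \<le> L2_norm M (\<lambda>x. F n x - f x) + L2_norm M (\<lambda>x. G n x - g x)" by simp
qed simp

text \<open>Obtained from the triangle inequality for the moduli: the square of the norm of
  \<open>cmod f + cmod g\<close> contains the wanted integral as its mixed term.\<close>

lemma L2_Cauchy_Schwarz:
  assumes "f \<in> L2 M" "g \<in> L2 M"
  shows "integrable M (\<lambda>x. f x * g x)"
    and "(LINT x|M. cmod (f x * g x)) \<le> L2_norm M f * L2_norm M g"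
proof -
  have ints: "integrable M (\<lambda>x. (cmod (f x))\<^sup>2)" "integrable M (\<lambda>x. (cmod (g x))\<^sup>2)"
    using assms by (auto intro: L2_integrable)
  show int: "integrable M (\<lambda>x. f x * g x)"
  proof (rule Bochner_Integration.integrable_bound)
    show "integrable M (\<lambda>x. (cmod (f x))\<^sup>2 + (cmod (g x))\<^sup>2)" using ints by simp
    show "AE x in M. cmod (f x * g x) \<le> norm ((cmod (f x))\<^sup>2 + (cmod (g x))\<^sup>2)"
    proof (rule AE_I2)
      fix x
      have "0 \<le> (cmod (f x) - cmod (g x))\<^sup>2" by simp
      then have "2 * (cmod (f x) * cmod (g x)) \<le> (cmod (f x))\<^sup>2 + (cmod (g x))\<^sup>2"
        by (simp add: power2_diff)
      moreover have "0 \<le> cmod (f x) * cmod (g x)" by simp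
      ultimately have "cmod (f x) * cmod (g x) \<le> (cmod (f x))\<^sup>2 + (cmod (g x))\<^sup>2" by linarith
      then show "cmod (f x * g x) \<le> norm ((cmod (f x))\<^sup>2 + (cmod (g x))\<^sup>2)"
        by (simp add: norm_mult)
    qed
  qed (use assms in measurable)
  define u v where "u x = complex_of_real (cmod (f x))" and "v x = complex_of_real (cmod (g x))" for x
  have uv: "u \<in> L2 M" "v \<in> L2 M"
    using assms ints unfolding u_def v_def by (auto intro!: L2I)
  have n: "L2_norm M u = L2_norm M f" "L2_norm M v = L2_norm M g"
    by (simp_all add: L2_norm_def u_def v_def)
  have "(L2_norm M (\<lambda>x. u x + v x))\<^sup>2 = (LINT x|M. ((cmod (f x))\<^sup>2 + (cmod (g x))\<^sup>2) + 2 * cmod (f x * g x))"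
    unfolding L2_norm_power2
    by (intro Bochner_Integration.integral_cong)
       (simp_all add: u_def v_def norm_mult power2_sum flip: of_real_add)
  also have "\<dots> = (L2_norm M f)\<^sup>2 + (L2_norm M g)\<^sup>2 + 2 * (LINT x|M. cmod (f x * g x))"
    unfolding L2_norm_power2 using ints integrable_norm[OF int] by simp
  finally have eq: "(L2_norm M (\<lambda>x. u x + v x))\<^sup>2
      = (L2_norm M f)\<^sup>2 + (L2_norm M g)\<^sup>2 + 2 * (LINT x|M. cmod (f x * g x))" .
  have "(L2_norm M (\<lambda>x. u x + v x))\<^sup>2 \<le> (L2_norm M f + L2_norm M g)\<^sup>2"
    using L2_norm_triangle[OF uv] by (intro power_mono) (simp_all add: n)
  then show "(LINT x|M. cmod (f x * g x)) \<le> L2_norm M f * L2_norm M g"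
    unfolding eq by (simp add: power2_sum)
qed

text \<open>Gives membership of the limit in \<open>L2\<close> together with the bound. Of
  \<open>g\<close> only measurability is assumed, which is what completeness and the transform of a
  limit require.\<close>

lemma L2_Fatou:
  assumes "\<And>n. F n \<in> L2 M" "g \<in> borel_measurable M" "AE x in M. (\<lambda>n. F n x) \<longlonglongrightarrow> g x"
    and "\<And>n. L2_norm M (F n) \<le> C"
  shows "g \<in> L2 M" "L2_norm M g \<le> C"
proof -
  note [measurable] = assms(2) L2_measurable[OF assms(1)]
  have C: "0 \<le> C" using assms(4)[of 0] L2_norm_nonneg[of M "F 0"] by linarith
  have "(\<integral>\<^sup>+x. ennreal ((cmod (g x))\<^sup>2) \<partial>M) \<le> (\<integral>\<^sup>+x. liminf (\<lambda>n. ennreal ((cmod (F n x))\<^sup>2)) \<partial>M)"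
  proof (rule nn_integral_mono_AE, use assms(3) in eventually_elim)
    fix x assume "(\<lambda>n. F n x) \<longlonglongrightarrow> g x"
    then have "(\<lambda>n. ennreal ((cmod (F n x))\<^sup>2)) \<longlonglongrightarrow> ennreal ((cmod (g x))\<^sup>2)"
      by (intro tendsto_ennrealI tendsto_power tendsto_norm)
    from lim_imp_Liminf[OF sequentially_bot this]
    show "ennreal ((cmod (g x))\<^sup>2) \<le> liminf (\<lambda>n. ennreal ((cmod (F n x))\<^sup>2))" by simp
  qed
  also have "\<dots> \<le> liminf (\<lambda>n. \<integral>\<^sup>+x. ennreal ((cmod (F n x))\<^sup>2) \<partial>M)"
    by (rule nn_integral_liminf) measurable
  also have "\<dots> \<le> ennreal (C\<^sup>2)"
  proof -
    have "(\<integral>\<^sup>+x. ennreal ((cmod (F n x))\<^sup>2) \<partial>M) \<le> ennreal (C\<^sup>2)" for n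
      using L2_integrable[OF assms(1)] assms(4)
      by (subst nn_integral_eq_integral) (auto simp flip: L2_norm_power2 intro!: ennreal_leI power_mono)
    then show ?thesis by (intro Liminf_le[OF sequentially_bot] always_eventually allI)
  qed
  finally have le: "(\<integral>\<^sup>+x. ennreal ((cmod (g x))\<^sup>2) \<partial>M) \<le> ennreal (C\<^sup>2)" .
  then have int: "integrable M (\<lambda>x. (cmod (g x))\<^sup>2)"
    by (intro integrableI_bounded) (auto simp: less_top[symmetric] top_unique)
  then show "g \<in> L2 M" by (intro L2I assms(2))
  have "(L2_norm M g)\<^sup>2 \<le> C\<^sup>2"
    unfolding L2_norm_power2 using le nn_integral_eq_integral[OF int] by simp
  then show "L2_norm M g \<le> C" using C by (rule power2_le_imp_le)
qed

lemma L2_dominated_convergence: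
  assumes "\<And>n. F n \<in> borel_measurable M" "W \<in> L2 M"
    and "\<And>n. AE x in M. cmod (F n x) \<le> cmod (W x)" "AE x in M. (\<lambda>n. F n x) \<longlonglongrightarrow> 0"
  shows "(\<lambda>n. L2_norm M (F n)) \<longlonglongrightarrow> 0"
proof -
  have "(\<lambda>n. LINT x|M. (cmod (F n x))\<^sup>2) \<longlonglongrightarrow> (LINT x|M. 0)"
  proof (rule integral_dominated_convergence[OF _ _ L2_integrable[OF assms(2)]])
    show "AE x in M. (\<lambda>n. (cmod (F n x))\<^sup>2) \<longlonglongrightarrow> 0"
      using assms(4)
    proof eventually_elim
      fix x assume "(\<lambda>n. F n x) \<longlonglongrightarrow> 0"
      then have "(\<lambda>n. (cmod (F n x))\<^sup>2) \<longlonglongrightarrow> (cmod 0)\<^sup>2"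
        by (intro tendsto_power tendsto_norm)
      then show "(\<lambda>n. (cmod (F n x))\<^sup>2) \<longlonglongrightarrow> 0" by simp
    qed
    show "AE x in M. norm ((cmod (F n x))\<^sup>2) \<le> (cmod (W x))\<^sup>2" for n
      using assms(3)[of n] by eventually_elim (auto intro: power_mono)
  qed (use assms(1) in measurable)
  then have "(\<lambda>n. sqrt (LINT x|M. (cmod (F n x))\<^sup>2)) \<longlonglongrightarrow> sqrt 0"
    by (intro tendsto_real_sqrt) simp
  then show ?thesis by (simp add: L2_norm_def)
qed

text \<open>Multiplication by a strictly positive \<open>L\<^sup>2\<close> weight turns a Cauchy sequence in \<open>L\<^sup>2\<close> into one in
  \<open>L\<^sup>1\<close>, for which an almost everywhere convergent subsequence is available.\<close>

lemma (in sigma_finite_measure) L2_complete: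
  assumes F: "\<And>n. F n \<in> L2 M"
    and Cauchy: "\<And>e. e > 0 \<Longrightarrow> \<exists>N. \<forall>i\<ge>N. \<forall>j\<ge>N. L2_norm M (\<lambda>x. F i x - F j x) < e"
  shows "\<exists>g. g \<in> L2 M \<and> (\<lambda>n. L2_norm M (\<lambda>x. F n x - g x)) \<longlonglongrightarrow> 0"
proof -
  note [measurable] = L2_measurable[OF F]
  obtain w :: "'a \<Rightarrow> real" where w [measurable]: "w \<in> borel_measurable M" "integrable M w"
    and w_pos: "\<And>x. w x > 0"
    by (rule obtain_positive_integrable_function) auto
  define v where "v x = complex_of_real (sqrt (w x))" for x
  have v [measurable]: "v \<in> borel_measurable M" unfolding v_def by measurable
  have v_pos: "v x \<noteq> 0" for x using w_pos[of x] by (simp add: v_def)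
  have v2: "v \<in> L2 M"
    using w w_pos by (intro L2I v) (simp add: v_def less_imp_le)
  define s where "s n x = F n x * v x" for n x
  obtain r where r: "strict_mono r" "AE x in M. Cauchy (\<lambda>i. s (r i) x)"
  proof (rule cauchy_L1_AE_cauchy_subseq[of M s])
    show "integrable M (s n)" for n
      unfolding s_def by (rule L2_Cauchy_Schwarz(1)[OF F v2])
    fix e :: real assume "e > 0"
    define B where "B = L2_norm M v + 1"
    have B: "B > 0" by (simp add: B_def add_nonneg_pos)
    obtain N where N: "\<And>i j. i \<ge> N \<Longrightarrow> j \<ge> N \<Longrightarrow> L2_norm M (\<lambda>x. F i x - F j x) < e / B"
      using Cauchy[of "e / B"] \<open>e > 0\<close> B by auto
    have "(LINT x|M. norm (s i x - s j x)) < e" if "i \<ge> N" "j \<ge> N" for i j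
    proof -
      have "(LINT x|M. norm (s i x - s j x)) = (LINT x|M. cmod ((F i x - F j x) * v x))"
        by (simp add: s_def algebra_simps)
      also have "\<dots> \<le> L2_norm M (\<lambda>x. F i x - F j x) * L2_norm M v"
        by (rule L2_Cauchy_Schwarz(2)[OF L2_diff[OF F F] v2])
      also have "\<dots> \<le> L2_norm M (\<lambda>x. F i x - F j x) * B"
        by (intro mult_left_mono) (auto simp: B_def)
      also have "\<dots> < e" using N[OF that] B by (simp add: field_simps)
      finally show ?thesis .
    qed
    then show "\<exists>N. \<forall>i\<ge>N. \<forall>j\<ge>N. (LINT x|M. norm (s i x - s j x)) < e" by blast
  qed (rule that)
  define g where "g x = lim (\<lambda>i. F (r i) x)" for x
  have g [measurable]: "g \<in> borel_measurable M" unfolding g_def by measurable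
  have lim: "AE x in M. (\<lambda>i. F (r i) x) \<longlonglongrightarrow> g x"
    using r(2)
  proof eventually_elim
    fix x assume "Cauchy (\<lambda>i. s (r i) x)"
    then have "convergent (\<lambda>i. s (r i) x)" by (simp add: Cauchy_convergent_iff)
    then obtain l where "(\<lambda>i. s (r i) x) \<longlonglongrightarrow> l" by (auto simp: convergent_def)
    then have "(\<lambda>i. s (r i) x / v x) \<longlonglongrightarrow> l / v x"
      by (intro tendsto_divide tendsto_const v_pos)
    then have "convergent (\<lambda>i. F (r i) x)"
      using v_pos by (auto simp: s_def convergent_def)
    then show "(\<lambda>i. F (r i) x) \<longlonglongrightarrow> g x"
      by (simp add: g_def convergent_LIMSEQ_iff)
  qed
  have est: "\<exists>N. \<forall>m\<ge>N. (\<lambda>x. F m x - g x) \<in> L2 M \<and> L2_norm M (\<lambda>x. F m x - g x) \<le> e" if e: "e > 0" for e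
  proof -
    obtain N where N: "\<And>i j. i \<ge> N \<Longrightarrow> j \<ge> N \<Longrightarrow> L2_norm M (\<lambda>x. F i x - F j x) < e"
      using Cauchy[OF e] by auto
    have "(\<lambda>x. F m x - g x) \<in> L2 M \<and> L2_norm M (\<lambda>x. F m x - g x) \<le> e" if m: "m \<ge> N" for m
    proof -
      \<comment> \<open>A strictly increasing \<open>r\<close> satisfies \<open>r i \<ge> i\<close>,
        so shifting the index by \<open>N\<close> keeps the Cauchy estimate valid along the whole
        sequence, as Fatou's lemma demands.\<close>
      let ?G = "\<lambda>i x. F m x - F (r (i + N)) x"
      have G: "?G i \<in> L2 M" for i by (intro L2_diff F)
      have le: "L2_norm M (?G i) \<le> e" for i
        using N[OF m, of "r (i + N)"] seq_suble[OF r(1), of "i + N"] by simp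
      have "AE x in M. (\<lambda>i. ?G i x) \<longlonglongrightarrow> F m x - g x"
        using lim by eventually_elim (intro tendsto_diff tendsto_const LIMSEQ_ignore_initial_segment)
      note fatou = L2_Fatou[of ?G M "\<lambda>x. F m x - g x", OF G _ this le]
      show ?thesis by (intro conjI fatou) measurable
    qed
    then show ?thesis by blast
  qed
  obtain N where "(\<lambda>x. F N x - g x) \<in> L2 M" using est[of 1] by auto
  from L2_diff[OF F[of N] this] have "g \<in> L2 M" by simp
  moreover have "(\<lambda>n. L2_norm M (\<lambda>x. F n x - g x)) \<longlonglongrightarrow> 0"
  proof (rule LIMSEQ_I)
    fix e :: real assume "e > 0"
    then obtain N where "\<forall>m\<ge>N. L2_norm M (\<lambda>x. F m x - g x) \<le> e / 2" using est[of "e / 2"] by auto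
    then show "\<exists>N. \<forall>n\<ge>N. norm (L2_norm M (\<lambda>x. F n x - g x) - 0) < e"
      using \<open>e > 0\<close> by (intro exI[of _ N]) force
  qed
  ultimately show ?thesis by blast
qed

section \<open>Density of step functions and the Plancherel identity\<close>

context selfdual_filtration
begin

definition L12 :: "('a \<Rightarrow> complex) set" where "L12 = L1 \<mu> \<inter> L2 \<mu>"

lemma L12I: "integrable \<mu> f \<Longrightarrow> f \<in> L2 \<mu> \<Longrightarrow> f \<in> L12"
  by (simp add: L12_def L1_def)

lemma L12_integrable: "f \<in> L12 \<Longrightarrow> integrable \<mu> f"
  and L12_L2: "f \<in> L12 \<Longrightarrow> f \<in> L2 \<mu>"
  by (simp_all add: L12_def L1_def)

lemma L12_measurable: "f \<in> L12 \<Longrightarrow> f \<in> borel_measurable borel"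
  using L2_measurable[OF L12_L2] by (simp cong: measurable_cong_sets)

lemma L12_lincomb: "f \<in> L12 \<Longrightarrow> g \<in> L12 \<Longrightarrow> (\<lambda>x. c * f x + g x) \<in> L12"
  by (intro L12I L2_add L2_mult_left Bochner_Integration.integrable_add integrable_mult_right)
     (simp_all add: L12_integrable L12_L2)

lemma L12_zero: "(\<lambda>x. 0) \<in> L12"
  by (intro L12I) simp_all

lemma L12_diff: "f \<in> L12 \<Longrightarrow> g \<in> L12 \<Longrightarrow> (\<lambda>x. f x - g x) \<in> L12"
  using L12_lincomb[of g f "-1"] by (simp add: algebra_simps)

lemma L12_bounded_support:
  assumes "f \<in> borel_measurable borel" "emeasure \<mu> B < \<infinity>" "B \<in> sets borel"
    and "\<And>x. x \<in> B \<Longrightarrow> cmod (f x) \<le> c" "\<And>x. x \<notin> B \<Longrightarrow> f x = 0"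
  shows "f \<in> L12"
proof (rule L12I)
  show "integrable \<mu> f" by (rule integrable_bounded_support[OF assms])
  have "integrable \<mu> (\<lambda>x. (cmod (f x))\<^sup>2)"
  proof (rule integrable_bounded_support[OF _ assms(2,3)])
    show "norm ((cmod (f x))\<^sup>2) \<le> c\<^sup>2" if "x \<in> B" for x
      using assms(4)[OF that] by (simp add: power_mono)
  qed (use assms(1,5) in simp_all)
  then show "f \<in> L2 \<mu>" using assms(1) by (intro L2I) simp_all
qed

lemma L12_indicator: "B \<in> sets borel \<Longrightarrow> emeasure \<mu> B < \<infinity> \<Longrightarrow> indicator B \<in> L12"
  by (rule L12_bounded_support[of _ B 1]) auto

lemma L12_coset: "indicator (coset a n) \<in> L12"
  by (rule L12_indicator) (auto simp: emeasure_coset')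

text \<open>The span of the indicators of cosets, built one term at a time, so that linear
  identities are proved by induction with a single coset in each step.\<close>

inductive_set step :: "('a \<Rightarrow> complex) set" where
  zero: "(\<lambda>x. 0) \<in> step"
| add: "s \<in> step \<Longrightarrow> (\<lambda>x. c * indicator (coset a n) x + s x) \<in> step"

lemma step_L12: "s \<in> step \<Longrightarrow> s \<in> L12"
  by (induction rule: step.induct) (intro L12_zero L12_lincomb L12_coset; assumption)+

lemma step_lincomb:
  assumes "s \<in> step" "t \<in> step"
  shows "(\<lambda>x. d * s x + t x) \<in> step"
  using assms(1)
proof induction
  case zero
  then show ?case using assms(2) by simp
next
  case (add s c a n)
  have "(\<lambda>x. (d * c) * indicator (coset a n) x + (d * s x + t x)) \<in> step"
    by (rule step.add[OF add.IH])
  moreover have "(\<lambda>x. (d * c) * indicator (coset a n) x + (d * s x + t x))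
      = (\<lambda>x. d * (c * indicator (coset a n) x + s x) + t x)"
    by (simp add: algebra_simps)
  ultimately show ?case by simp
qed

lemma step_coset: "indicator (coset a n) \<in> step"
  using step.add[OF step.zero, of 1 a n] by simp

text \<open>One step function is close in both norms: closeness in \<open>L1\<close> makes the
  transforms converge at every point, closeness in \<open>L2\<close> carries over the
  isometry.\<close>

definition step_approx :: "('a \<Rightarrow> complex) \<Rightarrow> bool" where
  "step_approx f \<longleftrightarrow> f \<in> L12 \<and>
     (\<forall>e>0. \<exists>s\<in>step. (LINT x|\<mu>. cmod (f x - s x)) < e \<and> L2_norm \<mu> (\<lambda>x. f x - s x) < e)"

lemma step_approxD:
  assumes "step_approx f" "e > 0"
  obtains s where "s \<in> step" "(LINT x|\<mu>. cmod (f x - s x)) < e" "L2_norm \<mu> (\<lambda>x. f x - s x) < e"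
  using assms unfolding step_approx_def by blast

lemma step_approx_L12: "step_approx f \<Longrightarrow> f \<in> L12"
  by (simp add: step_approx_def)

lemma step_approx_step: "s \<in> step \<Longrightarrow> step_approx s"
  unfolding step_approx_def using step_L12 by (intro conjI allI impI bexI[of _ s]) auto

lemma L1_norm_add_le:
  assumes "integrable \<mu> f" "integrable \<mu> (g :: 'a \<Rightarrow> complex)"
  shows "(LINT x|\<mu>. cmod (f x + g x)) \<le> (LINT x|\<mu>. cmod (f x)) + (LINT x|\<mu>. cmod (g x))"
proof -
  have "(LINT x|\<mu>. cmod (f x + g x)) \<le> (LINT x|\<mu>. cmod (f x) + cmod (g x))"
    using assms by (intro integral_mono) (auto intro: norm_triangle_ineq)
  then show ?thesis using assms by simp
qed

lemma step_approx_lincomb: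
  assumes f: "step_approx f" and g: "step_approx g"
  shows "step_approx (\<lambda>x. c * f x + g x)"
  unfolding step_approx_def
proof (intro conjI allI impI)
  note L = step_approx_L12[OF f] step_approx_L12[OF g]
  show "(\<lambda>x. c * f x + g x) \<in> L12" using L by (rule L12_lincomb)
  fix e :: real assume "e > 0"
  \<comment> \<open>With this choice \<open>cmod c * d + d = e / 2\<close>; the summand 1 keeps the
    denominator positive for \<open>c = 0\<close>.\<close>
  define d where "d = e / (2 * (cmod c + 1))"
  have d: "d > 0" using \<open>e > 0\<close> by (simp add: d_def add_nonneg_pos)
  have "d * (2 * (cmod c + 1)) = e"
  proof -
    have "cmod c + 1 \<noteq> 0" using norm_ge_zero[of c] by linarith
    then show ?thesis by (simp add: d_def)
  qed
  moreover define q where "q = cmod c * d + d"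
  ultimately have "2 * q = e" by (simp add: algebra_simps)
  then have "q < e" using \<open>e > 0\<close> by linarith
  then have de: "cmod c * d + d < e" by (simp add: q_def)
  obtain s where s: "s \<in> step" "(LINT x|\<mu>. cmod (f x - s x)) < d" "L2_norm \<mu> (\<lambda>x. f x - s x) < d"
    by (rule step_approxD[OF f d])
  obtain t where t: "t \<in> step" "(LINT x|\<mu>. cmod (g x - t x)) < d" "L2_norm \<mu> (\<lambda>x. g x - t x) < d"
    by (rule step_approxD[OF g d])
  note D = L12_diff[OF L(1) step_L12[OF s(1)]] L12_diff[OF L(2) step_L12[OF t(1)]]
  have eq: "c * f x + g x - (c * s x + t x) = c * (f x - s x) + (g x - t x)" for x
    by (simp add: algebra_simps)
  have le: "cmod c * u + v < e" if "u < d" "v < d" for u v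
  proof -
    have "cmod c * u + v \<le> cmod c * d + d" using that by (intro add_mono mult_left_mono) auto
    then show ?thesis using de by simp
  qed
  have "(LINT x|\<mu>. cmod (c * (f x - s x) + (g x - t x)))
      \<le> (LINT x|\<mu>. cmod (c * (f x - s x))) + (LINT x|\<mu>. cmod (g x - t x))"
    by (rule L1_norm_add_le) (use D L12_integrable in auto)
  also have "(LINT x|\<mu>. cmod (c * (f x - s x))) = cmod c * (LINT x|\<mu>. cmod (f x - s x))"
    by (simp add: norm_mult)
  also have "cmod c * (LINT x|\<mu>. cmod (f x - s x)) + (LINT x|\<mu>. cmod (g x - t x)) < e"
    using s(2) t(2) by (rule le)
  finally have 1: "(LINT x|\<mu>. cmod (c * (f x - s x) + (g x - t x))) < e" .
  have "L2_norm \<mu> (\<lambda>x. c * (f x - s x) + (g x - t x))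
      \<le> L2_norm \<mu> (\<lambda>x. c * (f x - s x)) + L2_norm \<mu> (\<lambda>x. g x - t x)"
    by (intro L2_norm_triangle L2_mult_left L12_L2 D)
  also have "L2_norm \<mu> (\<lambda>x. c * (f x - s x)) = cmod c * L2_norm \<mu> (\<lambda>x. f x - s x)"
    by (rule L2_norm_mult_left)
  also have "cmod c * L2_norm \<mu> (\<lambda>x. f x - s x) + L2_norm \<mu> (\<lambda>x. g x - t x) < e"
    using s(3) t(3) by (rule le)
  finally have 2: "L2_norm \<mu> (\<lambda>x. c * (f x - s x) + (g x - t x)) < e" .
  show "\<exists>r\<in>step. (LINT x|\<mu>. cmod (c * f x + g x - r x)) < e \<and> L2_norm \<mu> (\<lambda>x. c * f x + g x - r x) < e"
    by (rule bexI[OF _ step_lincomb[OF s(1) t(1), of c]]) (unfold eq, intro conjI 1 2)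
qed

lemma step_approx_limit:
  assumes F: "\<And>n. step_approx (F n)" and f: "f \<in> L12"
    and 1: "(\<lambda>n. LINT x|\<mu>. cmod (f x - F n x)) \<longlonglongrightarrow> 0"
    and 2: "(\<lambda>n. L2_norm \<mu> (\<lambda>x. f x - F n x)) \<longlonglongrightarrow> 0"
  shows "step_approx f"
  unfolding step_approx_def
proof (intro conjI allI impI f)
  fix e :: real assume "e > 0"
  then have e: "e / 2 > 0" by simp
  obtain n where n: "(LINT x|\<mu>. cmod (f x - F n x)) < e / 2" "L2_norm \<mu> (\<lambda>x. f x - F n x) < e / 2"
    using eventually_conj[OF order_tendstoD(2)[OF 1 e] order_tendstoD(2)[OF 2 e]]
    by (auto simp: eventually_sequentially)
  obtain s where s: "s \<in> step" "(LINT x|\<mu>. cmod (F n x - s x)) < e / 2" "L2_norm \<mu> (\<lambda>x. F n x - s x) < e / 2"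
    by (rule step_approxD[OF F e])
  note L = f step_approx_L12[OF F[of n]] step_L12[OF s(1)]
  have "(LINT x|\<mu>. cmod ((f x - F n x) + (F n x - s x))) \<le> (LINT x|\<mu>. cmod (f x - F n x)) + (LINT x|\<mu>. cmod (F n x - s x))"
    by (intro L1_norm_add_le L12_integrable L12_diff L)
  moreover have "L2_norm \<mu> (\<lambda>x. f x - s x) \<le> L2_norm \<mu> (\<lambda>x. f x - F n x) + L2_norm \<mu> (\<lambda>x. F n x - s x)"
    by (intro L2_norm_triangle_diff L12_L2 L)
  ultimately show "\<exists>s\<in>step. (LINT x|\<mu>. cmod (f x - s x)) < e \<and> L2_norm \<mu> (\<lambda>x. f x - s x) < e"
    using n s by (intro bexI[OF _ s(1)]) simp
qed

text \<open>The limit inherits the majorant, so one dominated convergence argument serves each norm.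
  This closes the approximable functions under the limits met on the way from cosets to Borel sets
  and on to integrable functions.\<close>

lemma step_approx_dominated:
  assumes F: "\<And>n. step_approx (F n)" and f: "f \<in> borel_measurable borel" and W: "W \<in> L12"
    and lim: "\<And>x. (\<lambda>n. F n x) \<longlonglongrightarrow> f x" and dom: "\<And>n x. cmod (F n x) \<le> cmod (W x)"
  shows "step_approx f"
proof -
  note [measurable] = f L12_measurable[OF W] L12_measurable[OF step_approx_L12[OF F]]
  have fW: "cmod (f x) \<le> cmod (W x)" for x
    by (rule LIMSEQ_le_const2[OF tendsto_norm[OF lim]]) (use dom in auto)
  have dW: "cmod (f x - F n x) \<le> cmod (2 * W x)" for n x
    using norm_triangle_ineq4[of "f x" "F n x"] fW[of x] dom[of n x] by (simp add: norm_mult)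
  have lim0: "(\<lambda>n. f x - F n x) \<longlonglongrightarrow> 0" for x
    using tendsto_diff[OF tendsto_const[of "f x"] lim[of x]] by simp
  have f12: "f \<in> L12"
  proof (rule L12I)
    show "integrable \<mu> f"
      by (rule Bochner_Integration.integrable_bound[OF L12_integrable[OF W]]) (use fW in simp_all)
    show "f \<in> L2 \<mu>"
      by (rule L2_bound[OF _ L2_integrable[OF L12_L2[OF W]]]) (use fW in \<open>simp_all add: power_mono\<close>)
  qed
  show ?thesis
  proof (rule step_approx_limit[OF F f12])
    have "(\<lambda>n. LINT x|\<mu>. cmod (f x - F n x)) \<longlonglongrightarrow> (LINT x|\<mu>. 0)"
    proof (rule integral_dominated_convergence[where w = "\<lambda>x. cmod (2 * W x)"])
      show "integrable \<mu> (\<lambda>x. cmod (2 * W x))"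
        by (intro integrable_norm integrable_mult_right) (rule L12_integrable[OF W])
      show "AE x in \<mu>. (\<lambda>n. cmod (f x - F n x)) \<longlonglongrightarrow> 0"
        using tendsto_norm_zero[OF lim0] by simp
      show "AE x in \<mu>. norm (cmod (f x - F n x)) \<le> cmod (2 * W x)" for n
        using dW[of _ n] by simp
    qed measurable
    then show "(\<lambda>n. LINT x|\<mu>. cmod (f x - F n x)) \<longlonglongrightarrow> 0" by simp
    show "(\<lambda>n. L2_norm \<mu> (\<lambda>x. f x - F n x)) \<longlonglongrightarrow> 0"
    proof (rule L2_dominated_convergence)
      show "(\<lambda>x. 2 * W x) \<in> L2 \<mu>" by (intro L2_mult_left L12_L2 W)
    qed (use dW lim0 in simp_all)
  qed
qed

text \<open>Dynkin's argument on the cosets. Intersecting with \<open>H m\<close> keeps all measures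
  finite: complements are taken inside \<open>H m\<close>, and its indicator dominates the partial
  unions.\<close>

lemma step_approx_indicator:
  assumes "B \<in> sets borel"
  shows "step_approx (indicator (B \<inter> H m))"
proof -
  have B: "B \<in> sigma_sets UNIV Cosets" using assms sets_borel_Cosets by simp
  have "Cosets \<subseteq> Pow UNIV" by simp
  from Int_stable_Cosets this B show ?thesis
  proof (induction rule: sigma_sets_induct_disjoint)
    case (basic A)
    then have "A \<inter> H m \<in> Cosets"
      using Int_stable_Cosets H_in_Cosets unfolding Int_stable_def by blast
    then show ?case
    proof (cases rule: Cosets_cases)
      case 1
      then show ?thesis using step_approx_step[OF step.zero] by simp
    next
      case (2 a n)
      then show ?thesis using step_approx_step[OF step_coset, of a n] by simp
    qed
  next
    case empty
    then show ?case using step_approx_step[OF step.zero] by simp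
  next
    case (compl A)
    have "step_approx (\<lambda>x. - 1 * indicator (A \<inter> H m) x + indicator (H m) x)"
      using step_approx_step[OF step_coset, of 0 m] by (intro step_approx_lincomb compl.IH) simp
    moreover have "(\<lambda>x. - 1 * indicator (A \<inter> H m) x + indicator (H m) x :: complex) = indicator ((UNIV - A) \<inter> H m)"
      by (auto simp: indicator_def)
    ultimately show ?case by simp
  next
    case (union A)
    have A: "A i \<in> sets borel" for i using union.hyps sets_borel_Cosets by auto
    define S where "S n = (\<Union>i<n. A i) \<inter> H m" for n :: nat
    have "step_approx (indicator (S n))" for n
    proof (induction n)
      case 0
      then show ?case using step_approx_step[OF step.zero] by (simp add: S_def)
    next
      case (Suc n)
      have "step_approx (\<lambda>x. 1 * indicator (A n \<inter> H m) x + indicator (S n) x)"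
        by (intro step_approx_lincomb union.IH Suc)
      moreover have "(\<lambda>x. 1 * indicator (A n \<inter> H m) x + indicator (S n) x :: complex) = indicator (S (Suc n))"
      proof
        fix x
        have "A i \<inter> A n = {}" if "i < n" for i
          using union.hyps(1) that by (simp add: disjoint_family_on_def)
        then have "\<not> (x \<in> A n \<and> x \<in> S n)"
          unfolding S_def by blast
        then show "1 * indicator (A n \<inter> H m) x + indicator (S n) x = (indicator (S (Suc n)) x :: complex)"
          by (auto simp: S_def indicator_def less_Suc_eq)
      qed
      ultimately show ?case by simp
    qed
    then show ?case
    proof (rule step_approx_dominated[where W = "indicator (H m)"])
      show "indicator ((\<Union>i. A i) \<inter> H m) \<in> borel_measurable borel"
        using A by (intro borel_measurable_indicator) auto
      show "indicator (H m) \<in> L12" using L12_coset[of 0 m] by simp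
      show "cmod (indicator (S n) x) \<le> cmod (indicator (H m) x)" for n x
        by (auto simp: S_def indicator_def)
      show "(\<lambda>n. indicator (S n) x) \<longlonglongrightarrow> (indicator ((\<Union>i. A i) \<inter> H m) x :: complex)" for x
      proof (cases "x \<in> (\<Union>i. A i) \<inter> H m")
        case True
        then obtain i where "x \<in> A i" "x \<in> H m" by blast
        then have "x \<in> S n" if "n \<ge> Suc i" for n
          using that unfolding S_def by auto
        then have "\<forall>n\<ge>Suc i. indicator (S n) x = (1 :: complex)" by simp
        moreover have "indicator ((\<Union>i. A i) \<inter> H m) x = (1 :: complex)"
          using True by simp
        ultimately show ?thesis
          unfolding eventually_sequentially[symmetric] by (intro tendsto_eventually) (auto simp: eventually_sequentially)
      next
        case False
        then have "indicator (S n) x = (0 :: complex)" for n by (auto simp: S_def)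
        then show ?thesis using False by simp
      qed
    qed
  qed
qed

lemma step_approx_sum:
  assumes "finite I" "\<And>i. i \<in> I \<Longrightarrow> step_approx (F i)"
  shows "step_approx (\<lambda>x. \<Sum>i\<in>I. c i * F i x)"
  using assms
proof (induction I rule: finite_induct)
  case empty
  then show ?case using step_approx_step[OF step.zero] by simp
next
  case (insert i I)
  then show ?case using step_approx_lincomb[of "F i" "\<lambda>x. \<Sum>i\<in>I. c i * F i x" "c i"] by simp
qed

lemma eventually_mem_H: "\<forall>\<^sub>F n in sequentially. x \<in> H (int n)"
proof -
  obtain k where k: "x \<in> H k" using ex_in_H by blast
  have "x \<in> H (int n)" if "n \<ge> nat k" for n
  proof -
    have "k \<le> int n" using that by (simp add: nat_le_iff)
    then show ?thesis using k H_mono by blast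
  qed
  then show ?thesis by (auto simp: eventually_sequentially)
qed

lemma L12_step_approx:
  assumes "f \<in> L12"
  shows "step_approx f"
proof -
  note [measurable] = L12_measurable[OF assms]
  obtain S where S: "\<And>i. simple_function borel (S i)" "\<And>x. (\<lambda>i. S i x) \<longlonglongrightarrow> f x"
    "\<And>i x. dist (S i x) 0 \<le> 2 * dist (f x) 0"
    using borel_measurable_implies_sequence_metric[OF L12_measurable[OF assms], of 0] by auto
  note [measurable] = borel_measurable_simple_function[OF S(1)]
  \<comment> \<open>The cut-off reduces each level set of a simple function to a Borel subset of
    \<open>H (int n)\<close>, the form to which the approximation of indicators applies.\<close>
  define F where "F n x = S n x * indicator (H (int n)) x" for n x
  show ?thesis
  proof (rule step_approx_dominated[where F = F and W = "\<lambda>x. 2 * f x"])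
    show "step_approx (F n)" for n
    proof -
      have fin: "finite (range (S n))" using simple_functionD(1)[OF S(1)[of n]] by simp
      have "step_approx (\<lambda>x. \<Sum>y\<in>range (S n). y * indicator ((S n -` {y}) \<inter> H (int n)) x)"
      proof (rule step_approx_sum[OF fin], rule step_approx_indicator)
        show "S n -` {y} \<in> sets borel" for y
          using simple_functionD(2)[OF S(1)[of n], of "{y}"] by simp
      qed
      moreover have "(\<lambda>x. \<Sum>y\<in>range (S n). y * indicator ((S n -` {y}) \<inter> H (int n)) x) = F n"
      proof
        fix x
        have "(\<Sum>y\<in>range (S n). y * indicator ((S n -` {y}) \<inter> H (int n)) x)
            = (\<Sum>y\<in>range (S n). if y = S n x then F n x else 0)"
          by (intro sum.cong) (auto simp: F_def indicator_def)
        then show "(\<Sum>y\<in>range (S n). y * indicator ((S n -` {y}) \<inter> H (int n)) x) = F n x"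
          using fin by (simp add: sum.delta')
      qed
      ultimately show ?thesis by simp
    qed
    show "(\<lambda>n. F n x) \<longlonglongrightarrow> f x" for x
    proof (rule Lim_transform_eventually[OF S(2)])
      show "\<forall>\<^sub>F n in sequentially. S n x = F n x"
        using eventually_mem_H[of x] by eventually_elim (simp add: F_def)
    qed
    show "cmod (F n x) \<le> cmod (2 * f x)" for n x
      using S(3)[of n x] by (simp add: F_def norm_mult indicator_def)
    show "(\<lambda>x. 2 * f x) \<in> L12"
      using L12_lincomb[OF assms L12_zero, of 2] by simp
  qed measurable
qed

section \<open>The transform of step functions and Plancherel's identity\<close>

definition FT :: "('a \<Rightarrow> complex) \<Rightarrow> 'a \<Rightarrow> complex" where "FT = fourier_L1 \<mu> ch"

lemma FT_def': "FT f \<xi> = (LINT x|\<mu>. f x * ch \<xi> x)"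
  by (simp add: FT_def fourier_L1_def)

lemma integrable_mult_ch: "integrable \<mu> f \<Longrightarrow> integrable \<mu> (\<lambda>x. f x * ch \<xi> x)"
  by (rule Bochner_Integration.integrable_bound[of \<mu> f]) (auto simp: norm_mult)

lemma FT_lincomb: "f \<in> L12 \<Longrightarrow> g \<in> L12 \<Longrightarrow> FT (\<lambda>x. c * f x + g x) \<xi> = c * FT f \<xi> + FT g \<xi>"
  using integrable_mult_ch[OF L12_integrable] by (simp add: FT_def' distrib_right mult.assoc)

lemma FT_diff: "f \<in> L12 \<Longrightarrow> g \<in> L12 \<Longrightarrow> FT (\<lambda>x. f x - g x) \<xi> = FT f \<xi> - FT g \<xi>"
  using FT_lincomb[of g f "-1" \<xi>] by (simp add: algebra_simps)

lemma FT_zero [simp]: "FT (\<lambda>x. 0) = (\<lambda>\<xi>. 0)"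
  by (simp add: FT_def' fun_eq_iff)

lemma FT_measurable [measurable]:
  assumes [measurable]: "f \<in> borel_measurable borel"
  shows "FT f \<in> borel_measurable borel"
  unfolding FT_def'[abs_def] by measurable

lemma FT_bound: "f \<in> L12 \<Longrightarrow> cmod (FT f \<xi>) \<le> (LINT x|\<mu>. cmod (f x))"
  unfolding FT_def' using integral_norm_bound[of \<mu> "\<lambda>x. f x * ch \<xi> x"] by (simp add: norm_mult)

lemma FT_coset: "FT (indicator (coset a n)) \<xi> = ch \<xi> a * indicator (H (- n)) \<xi> * of_real (lam n)"
  unfolding FT_def' by (rule integral_coset_ch)

lemma FT_coset_L12: "FT (indicator (coset a n)) \<in> L12"
  unfolding FT_coset[abs_def]
  by (rule L12_bounded_support[of _ "H (- n)" "lam n"]) (auto simp: emeasure_H norm_mult)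

lemma FT_step_L12: "s \<in> step \<Longrightarrow> FT s \<in> L12"
proof (induction rule: step.induct)
  case zero
  then show ?case by (simp add: L12_zero)
next
  case (add s c a n)
  have "FT (\<lambda>x. c * indicator (coset a n) x + s x) = (\<lambda>\<xi>. c * FT (indicator (coset a n)) \<xi> + FT s \<xi>)"
    using FT_lincomb[OF L12_coset step_L12[OF add.hyps]] by (intro ext) simp
  then show ?case using L12_lincomb[OF FT_coset_L12 add.IH] by simp
qed

definition ip :: "('a \<Rightarrow> complex) \<Rightarrow> ('a \<Rightarrow> complex) \<Rightarrow> complex" where
  "ip f g = (LINT x|\<mu>. f x * cnj (g x))"

lemma L2_cnj: "f \<in> L2 \<mu> \<Longrightarrow> (\<lambda>x. cnj (f x)) \<in> L2 \<mu>"
  using L2_integrable[of f \<mu>] L2_measurable[of f \<mu>]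
  by (intro L2I borel_measurable_continuous_on[where f = cnj] continuous_intros) simp_all

lemma ip_lincomb:
  assumes "f \<in> L2 \<mu>" "g \<in> L2 \<mu>" "h \<in> L2 \<mu>"
  shows "ip (\<lambda>x. c * f x + g x) h = c * ip f h + ip g h"
  using L2_Cauchy_Schwarz(1)[OF assms(1) L2_cnj[OF assms(3)]]
    L2_Cauchy_Schwarz(1)[OF assms(2) L2_cnj[OF assms(3)]]
  by (simp add: ip_def distrib_right mult.assoc)

lemma ip_cnj: "ip f g = cnj (ip g f)"
  unfolding ip_def by (subst Bochner_Integration.integral_cnj[symmetric]) (simp add: mult.commute)

lemma ip_self: "f \<in> L2 \<mu> \<Longrightarrow> ip f f = of_real ((L2_norm \<mu> f)\<^sup>2)"
  unfolding ip_def L2_norm_power2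
  by (subst integral_complex_of_real[symmetric]) (simp only: complex_norm_square)

text \<open>The two transforms overlap on the smaller support \<open>H (- m)\<close>, where the
  integral of \<open>ch \<xi> (a - b)\<close> is decided by the annihilator in the second variable.
  The factor \<open>lam m * lam (- m) = 1\<close> then leaves \<open>lam n\<close>, the measure of
  the smaller coset, if that coset lies in the larger one.\<close>

lemma ip_FT_coset_le:
  assumes "n \<le> m"
  shows "ip (FT (indicator (coset a n))) (FT (indicator (coset b m))) = ip (indicator (coset a n)) (indicator (coset b m))"
proof -
  have sub: "H (- m) \<subseteq> H (- n)" using H_mono assms by simp
  have "ip (FT (indicator (coset a n))) (FT (indicator (coset b m)))
      = (LINT \<xi>|\<mu>. of_real (lam n * lam m) * (indicator (H (- m)) \<xi> * ch \<xi> (a - b)))"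
    unfolding ip_def FT_coset
    using sub by (intro Bochner_Integration.integral_cong) (auto simp: indicator_def ch_diff)
  also have "\<dots> = of_real (lam n * lam m) * (indicator (H m) (a - b) * of_real (lam (- m)))"
    using integral_H_ch_left[of "- m" "a - b"] by (simp add: right_ann_H)
  also have "\<dots> = of_real (lam n) * indicator (H m) (a - b) * of_real (lam m * lam (- m))"
    by simp
  finally have 1: "ip (FT (indicator (coset a n))) (FT (indicator (coset b m))) = of_real (lam n) * indicator (H m) (a - b)"
    by (simp add: lam_duality)
  have "ip (indicator (coset a n)) (indicator (coset b m)) = (LINT x|\<mu>. of_real (indicator (coset a n \<inter> coset b m) x))"
    unfolding ip_def by (intro Bochner_Integration.integral_cong) (auto simp: indicator_def)
  also have "\<dots> = of_real (measure \<mu> (coset a n \<inter> coset b m))"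
    by (subst integral_complex_of_real) simp
  also have "\<dots> = of_real (lam n) * indicator (H m) (a - b)"
    unfolding coset_Int[OF assms] by (simp add: indicator_def)
  finally show ?thesis using 1 by simp
qed

lemma ip_FT_coset:
  "ip (FT (indicator (coset a n))) (FT (indicator (coset b m))) = ip (indicator (coset a n)) (indicator (coset b m))"
proof (cases "n \<le> m")
  case False
  then have "cnj (ip (FT (indicator (coset b m))) (FT (indicator (coset a n)))) = cnj (ip (indicator (coset b m)) (indicator (coset a n)))"
    using ip_FT_coset_le[of m n b a] by simp
  then show ?thesis by (simp only: ip_cnj[symmetric])
qed (rule ip_FT_coset_le)

text \<open>Linear extension in one argument. It is used twice, with the arguments exchanged by
  conjugate symmetry, to pass from pairs of cosets to pairs of step functions.\<close>

lemma ip_FT_linear: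
  assumes "s \<in> step" "t \<in> L12" "FT t \<in> L12" "\<And>a n. ip (FT (indicator (coset a n))) (FT t) = ip (indicator (coset a n)) t"
  shows "ip (FT s) (FT t) = ip s t"
  using assms(1)
proof induction
  case zero
  then show ?case by (simp add: ip_def)
next
  case (add s c a n)
  have "FT (\<lambda>x. c * indicator (coset a n) x + s x) = (\<lambda>\<xi>. c * FT (indicator (coset a n)) \<xi> + FT s \<xi>)"
    using FT_lincomb[OF L12_coset step_L12[OF add.hyps]] by (intro ext) simp
  then have "ip (FT (\<lambda>x. c * indicator (coset a n) x + s x)) (FT t)
      = c * ip (FT (indicator (coset a n))) (FT t) + ip (FT s) (FT t)"
    using ip_lincomb[OF L12_L2[OF FT_coset_L12] L12_L2[OF FT_step_L12[OF add.hyps]] L12_L2[OF assms(3)]] by simp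
  also have "\<dots> = ip (\<lambda>x. c * indicator (coset a n) x + s x) t"
    using ip_lincomb[OF L12_L2[OF L12_coset] L12_L2[OF step_L12[OF add.hyps]] L12_L2[OF assms(2)]] assms(4) add.IH
    by simp
  finally show ?case .
qed

lemma ip_FT_step:
  assumes "s \<in> step" "t \<in> step"
  shows "ip (FT s) (FT t) = ip s t"
proof (rule ip_FT_linear[OF assms(1) step_L12[OF assms(2)] FT_step_L12[OF assms(2)]])
  fix a n
  have "ip (FT t) (FT (indicator (coset a n))) = ip t (indicator (coset a n))"
    by (rule ip_FT_linear[OF assms(2) L12_coset FT_coset_L12 ip_FT_coset])
  then show "ip (FT (indicator (coset a n))) (FT t) = ip (indicator (coset a n)) t"
    by (subst (1 2) ip_cnj) simp
qed

lemma FT_step_norm: "s \<in> step \<Longrightarrow> L2_norm \<mu> (FT s) = L2_norm \<mu> s"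
proof -
  assume s: "s \<in> step"
  have "complex_of_real ((L2_norm \<mu> (FT s))\<^sup>2) = of_real ((L2_norm \<mu> s)\<^sup>2)"
    using ip_FT_step[OF s s] ip_self[OF L12_L2[OF step_L12[OF s]]] ip_self[OF L12_L2[OF FT_step_L12[OF s]]]
    by simp
  then have "(L2_norm \<mu> (FT s))\<^sup>2 = (L2_norm \<mu> s)\<^sup>2" by (simp only: of_real_eq_iff)
  then show ?thesis by (rule power2_eq_imp_eq) simp_all
qed

lemma step_dense_L12:
  assumes "f \<in> L12"
  obtains s where "\<And>n. s n \<in> step" "(\<lambda>n. LINT x|\<mu>. cmod (f x - s n x)) \<longlonglongrightarrow> 0"
    "(\<lambda>n. L2_norm \<mu> (\<lambda>x. f x - s n x)) \<longlonglongrightarrow> 0"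
proof -
  have "\<exists>s\<in>step. (LINT x|\<mu>. cmod (f x - s x)) < inverse (real (Suc n))
      \<and> L2_norm \<mu> (\<lambda>x. f x - s x) < inverse (real (Suc n))" for n
    using L12_step_approx[OF assms] unfolding step_approx_def by simp
  then obtain s where s: "\<And>n. s n \<in> step" "\<And>n. (LINT x|\<mu>. cmod (f x - s n x)) < inverse (real (Suc n))"
      "\<And>n. L2_norm \<mu> (\<lambda>x. f x - s n x) < inverse (real (Suc n))"
    by metis
  show ?thesis
  proof (rule that[OF s(1)])
    show "(\<lambda>n. LINT x|\<mu>. cmod (f x - s n x)) \<longlonglongrightarrow> 0"
      by (rule tendsto_sandwich[OF _ _ tendsto_const LIMSEQ_inverse_real_of_nat])
         (use s(2) in \<open>auto intro!: always_eventually less_imp_le\<close>)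
    show "(\<lambda>n. L2_norm \<mu> (\<lambda>x. f x - s n x)) \<longlonglongrightarrow> 0"
      by (rule tendsto_sandwich[OF _ _ tendsto_const LIMSEQ_inverse_real_of_nat])
         (use s(3) in \<open>auto intro!: always_eventually less_imp_le\<close>)
  qed
qed

text \<open>Only an inequality at first. Convergence of the approximants in \<open>L1\<close> gives
  convergence of their transforms at every point, and Fatou's lemma turns this into membership in
  \<open>L2\<close> and the bound.\<close>

lemma FT_L12_le:
  assumes f: "f \<in> L12"
  shows "FT f \<in> L2 \<mu> \<and> L2_norm \<mu> (FT f) \<le> L2_norm \<mu> f"
proof -
  note [measurable] = L12_measurable[OF f]
  obtain s where s: "\<And>n. s n \<in> step" "(\<lambda>n. LINT x|\<mu>. cmod (f x - s n x)) \<longlonglongrightarrow> 0"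
    "(\<lambda>n. L2_norm \<mu> (\<lambda>x. f x - s n x)) \<longlonglongrightarrow> 0"
    by (rule step_dense_L12[OF f]) (rule that)
  have pw: "(\<lambda>n. FT (s n) \<xi>) \<longlonglongrightarrow> FT f \<xi>" for \<xi>
  proof (rule LIM_zero_cancel, rule Lim_null_comparison[OF _ s(2)])
    show "\<forall>\<^sub>F n in sequentially. norm (FT (s n) \<xi> - FT f \<xi>) \<le> (LINT x|\<mu>. cmod (f x - s n x))"
    proof (intro always_eventually allI)
      fix n
      have "norm (FT (s n) \<xi> - FT f \<xi>) = cmod (FT (\<lambda>x. f x - s n x) \<xi>)"
        using FT_diff[OF f step_L12[OF s(1)]] by (simp add: norm_minus_commute)
      then show "norm (FT (s n) \<xi> - FT f \<xi>) \<le> (LINT x|\<mu>. cmod (f x - s n x))"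
        using FT_bound[OF L12_diff[OF f step_L12[OF s(1)]]] by simp
    qed
  qed
  have lim: "(\<lambda>n. L2_norm \<mu> (s n)) \<longlonglongrightarrow> L2_norm \<mu> f"
    using L2_tendsto_norm[OF L12_L2[OF f] L12_L2[OF step_L12[OF s(1)]]] s(3)
    by (simp add: L2_norm_minus_commute)
  \<comment> \<open>Fatou's lemma wants one bound for all terms, whereas the norms of the
    \<open>s n\<close> only converge; hence the slack \<open>e\<close> and the passage to a
    tail.\<close>
  have *: "FT f \<in> L2 \<mu> \<and> L2_norm \<mu> (FT f) \<le> L2_norm \<mu> f + e" if e: "e > 0" for e
  proof -
    have "L2_norm \<mu> f < L2_norm \<mu> f + e" using e by simp
    from order_tendstoD(2)[OF lim this] obtain N where N: "\<And>n. n \<ge> N \<Longrightarrow> L2_norm \<mu> (s n) < L2_norm \<mu> f + e"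
      by (auto simp: eventually_sequentially)
    have 1: "FT (s (n + N)) \<in> L2 \<mu>" for n by (intro L12_L2 FT_step_L12 s(1))
    have 2: "AE \<xi> in \<mu>. (\<lambda>n. FT (s (n + N)) \<xi>) \<longlonglongrightarrow> FT f \<xi>"
      using LIMSEQ_ignore_initial_segment[OF pw] by simp
    have 3: "L2_norm \<mu> (FT (s (n + N))) \<le> L2_norm \<mu> f + e" for n
      using N[of "n + N"] FT_step_norm[OF s(1)] by simp
    show ?thesis
      using L2_Fatou[of "\<lambda>n. FT (s (n + N))" \<mu> "FT f", OF 1 _ 2 3] by simp
  qed
  show ?thesis
  proof
    show "FT f \<in> L2 \<mu>" using *[OF zero_less_one] by (rule conjunct1)
    show "L2_norm \<mu> (FT f) \<le> L2_norm \<mu> f"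
      by (rule field_le_epsilon) (rule conjunct2[OF *])
  qed
qed

lemma FT_L2: "f \<in> L12 \<Longrightarrow> FT f \<in> L2 \<mu>"
  using FT_L12_le by blast

text \<open>The inequality of \<open>FT_L12_le\<close>, applied to \<open>f - s n\<close>, shows
  that the transforms converge in \<open>L2\<close>. Hence the norms converge on both sides, and for
  step functions they agree.\<close>

theorem Plancherel_L12:
  assumes f: "f \<in> L12"
  shows "L2_norm \<mu> (FT f) = L2_norm \<mu> f"
proof -
  obtain s where s: "\<And>n. s n \<in> step" "(\<lambda>n. LINT x|\<mu>. cmod (f x - s n x)) \<longlonglongrightarrow> 0"
    "(\<lambda>n. L2_norm \<mu> (\<lambda>x. f x - s n x)) \<longlonglongrightarrow> 0"
    by (rule step_dense_L12[OF f]) (rule that)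
  note sL = step_L12[OF s(1)]
  have lim: "(\<lambda>n. L2_norm \<mu> (s n)) \<longlonglongrightarrow> L2_norm \<mu> f"
    using L2_tendsto_norm[OF L12_L2[OF f] L12_L2[OF sL]] s(3)
    by (simp add: L2_norm_minus_commute)
  have "(\<lambda>n. L2_norm \<mu> (\<lambda>\<xi>. FT (s n) \<xi> - FT f \<xi>)) \<longlonglongrightarrow> 0"
  proof (rule tendsto_sandwich[OF _ _ tendsto_const s(3)])
    show "\<forall>\<^sub>F n in sequentially. L2_norm \<mu> (\<lambda>\<xi>. FT (s n) \<xi> - FT f \<xi>) \<le> L2_norm \<mu> (\<lambda>x. f x - s n x)"
    proof (intro always_eventually allI)
      fix n
      have "L2_norm \<mu> (FT (\<lambda>x. f x - s n x)) \<le> L2_norm \<mu> (\<lambda>x. f x - s n x)"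
        using FT_L12_le[OF L12_diff[OF f sL]] by blast
      moreover have "FT (\<lambda>x. f x - s n x) = (\<lambda>\<xi>. FT f \<xi> - FT (s n) \<xi>)"
        using FT_diff[OF f sL] by (intro ext)
      ultimately show "L2_norm \<mu> (\<lambda>\<xi>. FT (s n) \<xi> - FT f \<xi>) \<le> L2_norm \<mu> (\<lambda>x. f x - s n x)"
        by (simp add: L2_norm_minus_commute[of _ "FT (s n)"])
    qed
  qed simp
  from L2_tendsto_norm[OF FT_L2[OF f] FT_L2[OF sL] this]
  have "(\<lambda>n. L2_norm \<mu> (s n)) \<longlonglongrightarrow> L2_norm \<mu> (FT f)"
    by (simp add: FT_step_norm[OF s(1)])
  then show ?thesis using lim LIMSEQ_unique by blast
qed

lemma Plancherel_L12_diff: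
  assumes "f \<in> L12" "g \<in> L12"
  shows "L2_norm \<mu> (\<lambda>\<xi>. FT f \<xi> - FT g \<xi>) = L2_norm \<mu> (\<lambda>x. f x - g x)"
proof -
  have "FT (\<lambda>x. f x - g x) = (\<lambda>\<xi>. FT f \<xi> - FT g \<xi>)"
    using FT_diff[OF assms] by (intro ext)
  then show ?thesis using Plancherel_L12[OF L12_diff[OF assms]] by simp
qed

end

section \<open>The Fourier transform on square integrable functions\<close>

lemma borel_measurable_cnj [measurable (raw)]:
  "f \<in> borel_measurable M \<Longrightarrow> (\<lambda>x. cnj (f x)) \<in> borel_measurable M"
  by (rule borel_measurable_continuous_on[where f = cnj]) (intro continuous_intros)

context selfdual_filtration
begin

text \<open>The condition by which \<open>fourier\<close> selects its value, isolated as a relation.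
  What holds for all related functions holds for the selected one, without control over the
  selection.\<close>

definition fourier_rel :: "('a \<Rightarrow> complex) \<Rightarrow> ('a \<Rightarrow> complex) \<Rightarrow> bool" where
  "fourier_rel f g \<longleftrightarrow> g \<in> L2 \<mu> \<and>
     (\<exists>F. (\<forall>n::nat. F n \<in> L12) \<and>
          (\<lambda>n. L2_norm \<mu> (\<lambda>x. F n x - f x)) \<longlonglongrightarrow> 0 \<and>
          (\<lambda>n. L2_norm \<mu> (\<lambda>\<xi>. FT (F n) \<xi> - g \<xi>)) \<longlonglongrightarrow> 0)"

lemma fourier_eq: "fourier \<mu> ch f = (SOME g. fourier_rel f g)"
  unfolding fourier_def fourier_rel_def L12_def FT_def ..

lemma fourier_relI:
  assumes "g \<in> L2 \<mu>" "\<And>n. F n \<in> L12" "(\<lambda>n. L2_norm \<mu> (\<lambda>x. F n x - f x)) \<longlonglongrightarrow> 0"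
    and "(\<lambda>n. L2_norm \<mu> (\<lambda>\<xi>. FT (F n) \<xi> - g \<xi>)) \<longlonglongrightarrow> 0"
  shows "fourier_rel f g"
  unfolding fourier_rel_def using assms by blast

lemma fourier_relE:
  assumes "fourier_rel f g"
  obtains F where "\<And>n::nat. F n \<in> L12" "(\<lambda>n. L2_norm \<mu> (\<lambda>x. F n x - f x)) \<longlonglongrightarrow> 0"
    "(\<lambda>n. L2_norm \<mu> (\<lambda>\<xi>. FT (F n) \<xi> - g \<xi>)) \<longlonglongrightarrow> 0"
  using assms unfolding fourier_rel_def by blast

lemma L2_convergent_imp_Cauchy:
  assumes F: "\<And>n. F n \<in> L2 \<mu>" and f: "f \<in> L2 \<mu>"
    and lim: "(\<lambda>n. L2_norm \<mu> (\<lambda>x. F n x - f x)) \<longlonglongrightarrow> 0" and e: "e > 0"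
  shows "\<exists>N. \<forall>i\<ge>N. \<forall>j\<ge>N. L2_norm \<mu> (\<lambda>x. F i x - F j x) < e"
proof -
  have "0 < e / 2" using e by simp
  from order_tendstoD(2)[OF lim this] obtain N
    where N: "\<And>n. n \<ge> N \<Longrightarrow> L2_norm \<mu> (\<lambda>x. F n x - f x) < e / 2"
    unfolding eventually_sequentially by blast
  have "L2_norm \<mu> (\<lambda>x. F i x - F j x) < e" if "i \<ge> N" "j \<ge> N" for i j
    using L2_norm_triangle_diff[OF F[of i] f F[of j]] N[OF that(1)] N[OF that(2)]
      L2_norm_minus_commute[of \<mu> f "F j"] by linarith
  then show ?thesis by blast
qed

lemma L12_truncate:
  assumes "f \<in> L2 \<mu>"
  shows "(\<lambda>x. f x * indicator (H m) x) \<in> L12"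
proof (rule L12I)
  show "integrable \<mu> (\<lambda>x. f x * indicator (H m) x)"
    using L12_coset[of 0 m] by (intro L2_Cauchy_Schwarz(1)[OF assms] L12_L2) simp
  show "(\<lambda>x. f x * indicator (H m) x) \<in> L2 \<mu>"
    by (rule L2_bound[OF _ L2_integrable[OF assms]])
       (use assms in \<open>auto simp: indicator_def\<close>)
qed

lemma L12_dense:
  assumes f: "f \<in> L2 \<mu>"
  shows "(\<lambda>n. L2_norm \<mu> (\<lambda>x. f x * indicator (H (int n)) x - f x)) \<longlonglongrightarrow> 0"
proof (rule L2_dominated_convergence[OF _ f])
  show "(\<lambda>x. f x * indicator (H (int n)) x - f x) \<in> borel_measurable \<mu>" for n
    using L2_measurable[OF f] by measurable
  show "AE x in \<mu>. cmod (f x * indicator (H (int n)) x - f x) \<le> cmod (f x)" for n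
    by (intro AE_I2) (auto simp: indicator_def)
  show "AE x in \<mu>. (\<lambda>n. f x * indicator (H (int n)) x - f x) \<longlonglongrightarrow> 0"
  proof (intro AE_I2 tendsto_eventually)
    show "\<forall>\<^sub>F n in sequentially. f x * indicator (H (int n)) x - f x = 0" for x
      using eventually_mem_H[of x] by eventually_elim simp
  qed
qed

lemma fourier_rel_ex:
  assumes f: "f \<in> L2 \<mu>"
  shows "\<exists>g. fourier_rel f g"
proof -
  define F where "F n x = f x * indicator (H (int n)) x" for n :: nat and x
  have F: "F n \<in> L12" for n unfolding F_def by (rule L12_truncate[OF f])
  have lim: "(\<lambda>n. L2_norm \<mu> (\<lambda>x. F n x - f x)) \<longlonglongrightarrow> 0"
    unfolding F_def by (rule L12_dense[OF f])
  have "\<exists>N. \<forall>i\<ge>N. \<forall>j\<ge>N. L2_norm \<mu> (\<lambda>\<xi>. FT (F i) \<xi> - FT (F j) \<xi>) < e" if "e > 0" for e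
    using L2_convergent_imp_Cauchy[OF L12_L2[OF F] f lim that]
    by (simp only: Plancherel_L12_diff[OF F F])
  from L2_complete[OF FT_L2[OF F] this] obtain g
    where "g \<in> L2 \<mu>" "(\<lambda>n. L2_norm \<mu> (\<lambda>\<xi>. FT (F n) \<xi> - g \<xi>)) \<longlonglongrightarrow> 0" by blast
  then show ?thesis using fourier_relI[OF _ F lim] by blast
qed

lemma fourier_rel_L2: "fourier_rel f g \<Longrightarrow> g \<in> L2 \<mu>"
  by (simp add: fourier_rel_def)

text \<open>Isometry for arbitrary representatives, by passing to the limit in
  \<open>Plancherel_L12_diff\<close>. When \<open>f\<close> and \<open>f'\<close> agree almost
  everywhere it gives the uniqueness of the transform up to null sets.\<close>

lemma fourier_rel_norm_diff:
  assumes "f \<in> L2 \<mu>" "f' \<in> L2 \<mu>" "fourier_rel f g" "fourier_rel f' g'"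
  shows "L2_norm \<mu> (\<lambda>\<xi>. g \<xi> - g' \<xi>) = L2_norm \<mu> (\<lambda>x. f x - f' x)"
proof -
  obtain F where F: "\<And>n::nat. F n \<in> L12" "(\<lambda>n. L2_norm \<mu> (\<lambda>x. F n x - f x)) \<longlonglongrightarrow> 0"
    "(\<lambda>n. L2_norm \<mu> (\<lambda>\<xi>. FT (F n) \<xi> - g \<xi>)) \<longlonglongrightarrow> 0"
    by (rule fourier_relE[OF assms(3)]) (rule that)
  obtain F' where F': "\<And>n::nat. F' n \<in> L12" "(\<lambda>n. L2_norm \<mu> (\<lambda>x. F' n x - f' x)) \<longlonglongrightarrow> 0"
    "(\<lambda>n. L2_norm \<mu> (\<lambda>\<xi>. FT (F' n) \<xi> - g' \<xi>)) \<longlonglongrightarrow> 0"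
    by (rule fourier_relE[OF assms(4)]) (rule that)
  note g = fourier_rel_L2[OF assms(3)] fourier_rel_L2[OF assms(4)]
  have "(\<lambda>n. L2_norm \<mu> (\<lambda>x. F n x - F' n x)) \<longlonglongrightarrow> L2_norm \<mu> (\<lambda>x. f x - f' x)"
    by (rule L2_tendsto_norm[OF L2_diff[OF assms(1,2)] L2_diff[OF L12_L2[OF F(1)] L12_L2[OF F'(1)]]
        L2_tendsto_diff[OF assms(1,2) L12_L2[OF F(1)] L12_L2[OF F'(1)] F(2) F'(2)]])
  moreover have "(\<lambda>n. L2_norm \<mu> (\<lambda>\<xi>. FT (F n) \<xi> - FT (F' n) \<xi>)) \<longlonglongrightarrow> L2_norm \<mu> (\<lambda>\<xi>. g \<xi> - g' \<xi>)"
    by (rule L2_tendsto_norm[OF L2_diff[OF g] L2_diff[OF FT_L2[OF F(1)] FT_L2[OF F'(1)]]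
        L2_tendsto_diff[OF g FT_L2[OF F(1)] FT_L2[OF F'(1)] F(3) F'(3)]])
  ultimately show ?thesis
    unfolding Plancherel_L12_diff[OF F(1) F'(1)] using LIMSEQ_unique by blast
qed

lemma fourier_rel_cong:
  assumes "f \<in> L2 \<mu>" "f' \<in> L2 \<mu>" "fourier_rel f g" "fourier_rel f' g'" "AE x in \<mu>. f x = f' x"
  shows "AE \<xi> in \<mu>. g \<xi> = g' \<xi>"
proof -
  have "L2_norm \<mu> (\<lambda>x. f x - f' x) = 0"
    using assms(5) by (subst L2_norm_eq_0_iff[OF L2_diff[OF assms(1,2)]]) simp
  then have "L2_norm \<mu> (\<lambda>\<xi>. g \<xi> - g' \<xi>) = 0"
    using fourier_rel_norm_diff[OF assms(1-4)] by simp
  then show ?thesis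
    using L2_norm_eq_0_iff[OF L2_diff[OF fourier_rel_L2[OF assms(3)] fourier_rel_L2[OF assms(4)]]] by simp
qed

lemma L2_tendsto_lincomb:
  assumes L2: "f \<in> L2 \<mu>" "g \<in> L2 \<mu>" "\<And>n. F n \<in> L2 \<mu>" "\<And>n. G n \<in> L2 \<mu>"
    and F: "(\<lambda>n. L2_norm \<mu> (\<lambda>x. F n x - f x)) \<longlonglongrightarrow> 0"
    and G: "(\<lambda>n. L2_norm \<mu> (\<lambda>x. G n x - g x)) \<longlonglongrightarrow> 0"
  shows "(\<lambda>n. L2_norm \<mu> (\<lambda>x. (c * F n x + G n x) - (c * f x + g x))) \<longlonglongrightarrow> 0"
proof (rule tendsto_sandwich[OF _ _ tendsto_const])
  show "(\<lambda>n. cmod c * L2_norm \<mu> (\<lambda>x. F n x - f x) + L2_norm \<mu> (\<lambda>x. G n x - g x)) \<longlonglongrightarrow> 0"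
    by (intro tendsto_add_zero tendsto_mult_right_zero F G)
  have "L2_norm \<mu> (\<lambda>x. (c * F n x + G n x) - (c * f x + g x))
      \<le> cmod c * L2_norm \<mu> (\<lambda>x. F n x - f x) + L2_norm \<mu> (\<lambda>x. G n x - g x)" for n
  proof -
    have "L2_norm \<mu> (\<lambda>x. c * (F n x - f x) + (G n x - g x))
        \<le> L2_norm \<mu> (\<lambda>x. c * (F n x - f x)) + L2_norm \<mu> (\<lambda>x. G n x - g x)"
      by (intro L2_norm_triangle L2_mult_left L2_diff L2)
    moreover have "(\<lambda>x. c * (F n x - f x) + (G n x - g x)) = (\<lambda>x. (c * F n x + G n x) - (c * f x + g x))"
      by (intro ext) (simp add: algebra_simps)
    ultimately show ?thesis by (simp only: L2_norm_mult_left)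
  qed
  then show "\<forall>\<^sub>F n in sequentially. L2_norm \<mu> (\<lambda>x. (c * F n x + G n x) - (c * f x + g x))
      \<le> cmod c * L2_norm \<mu> (\<lambda>x. F n x - f x) + L2_norm \<mu> (\<lambda>x. G n x - g x)" by simp
qed simp

lemma fourier_rel_lincomb:
  assumes "f \<in> L2 \<mu>" "f' \<in> L2 \<mu>" "fourier_rel f g" "fourier_rel f' g'"
  shows "fourier_rel (\<lambda>x. c * f x + f' x) (\<lambda>\<xi>. c * g \<xi> + g' \<xi>)"
proof -
  obtain F where F: "\<And>n::nat. F n \<in> L12" "(\<lambda>n. L2_norm \<mu> (\<lambda>x. F n x - f x)) \<longlonglongrightarrow> 0"
    "(\<lambda>n. L2_norm \<mu> (\<lambda>\<xi>. FT (F n) \<xi> - g \<xi>)) \<longlonglongrightarrow> 0"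
    by (rule fourier_relE[OF assms(3)]) (rule that)
  obtain F' where F': "\<And>n::nat. F' n \<in> L12" "(\<lambda>n. L2_norm \<mu> (\<lambda>x. F' n x - f' x)) \<longlonglongrightarrow> 0"
    "(\<lambda>n. L2_norm \<mu> (\<lambda>\<xi>. FT (F' n) \<xi> - g' \<xi>)) \<longlonglongrightarrow> 0"
    by (rule fourier_relE[OF assms(4)]) (rule that)
  note g = fourier_rel_L2[OF assms(3)] fourier_rel_L2[OF assms(4)]
  show ?thesis
  proof (rule fourier_relI[where F = "\<lambda>n x. c * F n x + F' n x"])
    show "(\<lambda>\<xi>. c * g \<xi> + g' \<xi>) \<in> L2 \<mu>" by (intro L2_add L2_mult_left g)
    show "(\<lambda>x. c * F n x + F' n x) \<in> L12" for n by (rule L12_lincomb[OF F(1) F'(1)])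
    show "(\<lambda>n. L2_norm \<mu> (\<lambda>x. c * F n x + F' n x - (c * f x + f' x))) \<longlonglongrightarrow> 0"
      by (rule L2_tendsto_lincomb[OF assms(1,2) L12_L2[OF F(1)] L12_L2[OF F'(1)] F(2) F'(2)])
    show "(\<lambda>n. L2_norm \<mu> (\<lambda>\<xi>. FT (\<lambda>x. c * F n x + F' n x) \<xi> - (c * g \<xi> + g' \<xi>))) \<longlonglongrightarrow> 0"
      unfolding FT_lincomb[OF F(1) F'(1)]
      by (rule L2_tendsto_lincomb[OF g FT_L2[OF F(1)] FT_L2[OF F'(1)] F(3) F'(3)])
  qed
qed

lemma fourier_rel_fourier: "f \<in> L2 \<mu> \<Longrightarrow> fourier_rel f (fourier \<mu> ch f)"
  unfolding fourier_eq by (rule someI_ex[OF fourier_rel_ex])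

lemma fourier_L2: "f \<in> L2 \<mu> \<Longrightarrow> fourier \<mu> ch f \<in> L2 \<mu>"
  by (rule fourier_rel_L2[OF fourier_rel_fourier])

lemma fourier_unique:
  assumes "f \<in> L2 \<mu>" "fourier_rel f g"
  shows "AE \<xi> in \<mu>. fourier \<mu> ch f \<xi> = g \<xi>"
  by (rule fourier_rel_cong[OF assms(1,1) fourier_rel_fourier[OF assms(1)] assms(2)]) simp

lemma Plancherel_diff:
  "f \<in> L2 \<mu> \<Longrightarrow> g \<in> L2 \<mu> \<Longrightarrow> L2_norm \<mu> (\<lambda>\<xi>. fourier \<mu> ch f \<xi> - fourier \<mu> ch g \<xi>) = L2_norm \<mu> (\<lambda>x. f x - g x)"
  by (rule fourier_rel_norm_diff) (auto intro: fourier_rel_fourier)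

lemma fourier_lincomb:
  assumes "f \<in> L2 \<mu>" "g \<in> L2 \<mu>"
  shows "AE \<xi> in \<mu>. fourier \<mu> ch (\<lambda>x. c * f x + g x) \<xi> = c * fourier \<mu> ch f \<xi> + fourier \<mu> ch g \<xi>"
  by (rule fourier_unique[OF L2_add[OF L2_mult_left[OF assms(1)] assms(2)]
      fourier_rel_lincomb[OF assms fourier_rel_fourier[OF assms(1)] fourier_rel_fourier[OF assms(2)]]])

lemma fourier_rel_FT: "f \<in> L12 \<Longrightarrow> fourier_rel f (FT f)"
  by (rule fourier_relI[where F = "\<lambda>n. f"]) (auto intro: FT_L2)

lemma fourier_L12: "f \<in> L12 \<Longrightarrow> AE \<xi> in \<mu>. fourier \<mu> ch f \<xi> = FT f \<xi>"
  by (rule fourier_unique[OF L12_L2 fourier_rel_FT])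

text \<open>Explicit preimages of coset indicators; the factor \<open>lam m\<close> compensates the
  measure \<open>lam (- m)\<close> of the domain of integration. They give the transform a dense
  range without a prior inversion theorem.\<close>

lemma FT_modulated_coset:
  "FT (\<lambda>x. of_real (lam m) * (cnj (ch b x) * indicator (H (- m)) x)) \<xi> = indicator (coset b m) \<xi>"
proof -
  have "FT (\<lambda>x. of_real (lam m) * (cnj (ch b x) * indicator (H (- m)) x)) \<xi>
      = (LINT x|\<mu>. of_real (lam m) * (indicator (H (- m)) x * ch (\<xi> - b) x))"
    unfolding FT_def' by (intro Bochner_Integration.integral_cong) (auto simp: ch_diff)
  also have "\<dots> = of_real (lam m * lam (- m)) * indicator (H m) (\<xi> - b)"
    using integral_H_ch[of "- m" "\<xi> - b"] by simp
  also have "\<dots> = indicator (coset b m) \<xi>" by (simp add: lam_duality indicator_def)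
  finally show ?thesis .
qed

lemma step_FT_preimage: "s \<in> step \<Longrightarrow> \<exists>p\<in>L12. FT p = s"
proof (induction rule: step.induct)
  case zero
  show ?case by (rule bexI[OF _ L12_zero]) simp
next
  case (add s c a n)
  then obtain p where p: "p \<in> L12" "FT p = s" by blast
  define q where "q x = of_real (lam n) * (cnj (ch a x) * indicator (H (- n)) x)" for x
  have q: "q \<in> L12"
    by (rule L12_bounded_support[of _ "H (- n)" "lam n"])
       (auto simp: q_def[abs_def] emeasure_H norm_mult)
  have "FT (\<lambda>x. c * q x + p x) = (\<lambda>x. c * indicator (coset a n) x + s x)"
    using FT_lincomb[OF q p(1), of c] FT_modulated_coset[of n a]
    by (intro ext) (simp add: q_def[abs_def] p(2))
  then show ?case using L12_lincomb[OF q p(1), of c] by blast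
qed

lemma step_dense_L2:
  assumes f: "f \<in> L2 \<mu>"
  shows "\<exists>s. (\<forall>n. s n \<in> step) \<and> (\<lambda>n. L2_norm \<mu> (\<lambda>x. s n x - f x)) \<longlonglongrightarrow> 0"
proof -
  define F where "F n x = f x * indicator (H (int n)) x" for n :: nat and x
  have F: "F n \<in> L12" for n unfolding F_def by (rule L12_truncate[OF f])
  have "\<exists>s\<in>step. L2_norm \<mu> (\<lambda>x. F n x - s x) < inverse (real (Suc n))" for n
    using L12_step_approx[OF F[of n]] unfolding step_approx_def by (meson inverse_positive_iff_positive of_nat_0_less_iff zero_less_Suc)
  then obtain s where s: "\<And>n. s n \<in> step" "\<And>n. L2_norm \<mu> (\<lambda>x. F n x - s n x) < inverse (real (Suc n))"
    by metis
  have "(\<lambda>n. L2_norm \<mu> (\<lambda>x. s n x - f x)) \<longlonglongrightarrow> 0"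
  proof (rule tendsto_sandwich[OF _ _ tendsto_const])
    show "(\<lambda>n. inverse (real (Suc n)) + L2_norm \<mu> (\<lambda>x. F n x - f x)) \<longlonglongrightarrow> 0"
      unfolding F_def by (intro tendsto_add_zero LIMSEQ_inverse_real_of_nat L12_dense[OF f])
    have "L2_norm \<mu> (\<lambda>x. s n x - f x) \<le> inverse (real (Suc n)) + L2_norm \<mu> (\<lambda>x. F n x - f x)" for n
      using L2_norm_triangle_diff[OF L12_L2[OF step_L12[OF s(1)]] L12_L2[OF F] f, of n n]
        L2_norm_minus_commute[of \<mu> "s n" "F n"] s(2)[of n] by linarith
    then show "\<forall>\<^sub>F n in sequentially. L2_norm \<mu> (\<lambda>x. s n x - f x) \<le> inverse (real (Suc n)) + L2_norm \<mu> (\<lambda>x. F n x - f x)"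
      by simp
  qed simp
  then show ?thesis using s(1) by blast
qed

text \<open>Preimages of step functions that approximate \<open>g\<close> form a Cauchy sequence by
  isometry, and completeness of \<open>L2\<close> supplies the function that is mapped to
  \<open>g\<close>.\<close>

lemma fourier_surj:
  assumes g: "g \<in> L2 \<mu>"
  shows "\<exists>f. f \<in> L2 \<mu> \<and> (AE \<xi> in \<mu>. fourier \<mu> ch f \<xi> = g \<xi>)"
proof -
  obtain s where s: "\<And>n. s n \<in> step" "(\<lambda>n. L2_norm \<mu> (\<lambda>x. s n x - g x)) \<longlonglongrightarrow> 0"
    using step_dense_L2[OF g] by blast
  have "\<forall>n. \<exists>p. p \<in> L12 \<and> FT p = s n"
    using step_FT_preimage[OF s(1)] by blast
  from choice[OF this] obtain p where p: "\<And>n. p n \<in> L12" "\<And>n. FT (p n) = s n" by blast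
  have "\<exists>N. \<forall>i\<ge>N. \<forall>j\<ge>N. L2_norm \<mu> (\<lambda>\<xi>. p i \<xi> - p j \<xi>) < e" if "e > 0" for e
    using L2_convergent_imp_Cauchy[OF L12_L2[OF step_L12[OF s(1)]] g s(2) that]
    by (simp only: Plancherel_L12_diff[OF p(1) p(1), symmetric] p(2))
  from L2_complete[OF L12_L2[OF p(1)] this] obtain f
    where f: "f \<in> L2 \<mu>" "(\<lambda>n. L2_norm \<mu> (\<lambda>x. p n x - f x)) \<longlonglongrightarrow> 0" by blast
  have "fourier_rel f g"
    by (rule fourier_relI[OF g p(1) f(2)]) (simp add: p(2) s(2))
  then show ?thesis using fourier_unique[OF f(1)] f(1) by blast
qed

lemma inv_fourier:
  assumes "g \<in> L2 \<mu>"
  shows inv_fourier_L2: "inv_fourier \<mu> ch g \<in> L2 \<mu>"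
    and fourier_inv_fourier: "AE \<xi> in \<mu>. fourier \<mu> ch (inv_fourier \<mu> ch g) \<xi> = g \<xi>"
  using someI_ex[OF fourier_surj[OF assms]] unfolding inv_fourier_def by blast+

end

section \<open>The norm and the symbol of the heat semigroup\<close>

lemma (in pair_sigma_finite) integrable_pair_bound:
  fixes h :: "'a \<times> 'b \<Rightarrow> complex" and f :: "'a \<Rightarrow> real" and g :: "'b \<Rightarrow> real"
  assumes h: "h \<in> borel_measurable (M1 \<Otimes>\<^sub>M M2)" and f: "integrable M1 f" and g: "integrable M2 g"
    and le: "\<And>x y. cmod (h (x, y)) \<le> f x * g y"
  shows "integrable (M1 \<Otimes>\<^sub>M M2) h"
proof (rule Fubini_integrable[OF h])
  have [measurable]: "(\<lambda>y. h (x, y)) \<in> borel_measurable M2" if "x \<in> space M1" for x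
    using h that by measurable
  have int: "integrable M2 (\<lambda>y. cmod (h (x, y)))" if "x \<in> space M1" for x
    by (rule Bochner_Integration.integrable_bound[of _ "\<lambda>y. f x * g y"])
       (use g that le[of x] in \<open>auto intro: order_trans[OF _ abs_ge_self]\<close>)
  show "integrable M1 (\<lambda>x. LINT y|M2. norm (h (x, y)))"
  proof (rule Bochner_Integration.integrable_bound)
    show "integrable M1 (\<lambda>x. f x * (LINT y|M2. g y))" using f by simp
    show "(\<lambda>x. LINT y|M2. norm (h (x, y))) \<in> borel_measurable M1" using h by measurable
    show "AE x in M1. norm (LINT y|M2. norm (h (x, y))) \<le> norm (f x * (LINT y|M2. g y))"
    proof (rule AE_I2)
      fix x assume x: "x \<in> space M1"
      have "(LINT y|M2. norm (h (x, y))) \<le> (LINT y|M2. f x * g y)"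
        using int[OF x] g le by (intro integral_mono) auto
      moreover have "0 \<le> (LINT y|M2. norm (h (x, y)))" by simp
      ultimately show "norm (LINT y|M2. norm (h (x, y))) \<le> norm (f x * (LINT y|M2. g y))" by simp
    qed
  qed
  show "AE x in M1. integrable M2 (\<lambda>y. h (x, y))"
    using int by (intro AE_I2) (auto simp: integrable_norm_iff)
qed

context selfdual_filtration
begin

abbreviation gn :: "'a \<Rightarrow> real" where "gn \<equiv> gnorm H \<mu>"

lemma ex_level:
  assumes "x \<noteq> 0"
  shows "\<exists>n. x \<in> H n - H (n - 1)"
proof -
  obtain k where k: "x \<in> H k" using ex_in_H by blast
  obtain m where m: "x \<notin> H m" using Inter_H assms by blast
  have "m < k" using m k H_mono[of k m] by (cases "m < k") auto
  \<comment> \<open>A least index among the integers needs a lower bound; it is given by some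
    \<open>m\<close> with \<open>x \<notin> H m\<close>.\<close>
  define j where "j = (LEAST j. x \<in> H (m + int j))"
  have "x \<in> H (m + int (nat (k - m)))" using k \<open>m < k\<close> by simp
  then have j: "x \<in> H (m + int j)" unfolding j_def by (rule LeastI)
  have "j \<noteq> 0" using j m by (intro notI) simp
  then obtain i where i: "j = Suc i" by (cases j) auto
  have "x \<notin> H (m + int i)" using not_less_Least[of i "\<lambda>j. x \<in> H (m + int j)"] i j_def by simp
  moreover have eq: "m + int j - 1 = m + int i" using i by simp
  ultimately have "x \<in> H (m + int j) - H (m + int j - 1)" unfolding eq using j by blast
  then show ?thesis by blast
qed

lemma level_unique:
  assumes "x \<in> H n - H (n - 1)" "x \<in> H m - H (m - 1)"
  shows "n = m"
proof (rule ccontr)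
  assume "n \<noteq> m"
  then have "n \<le> m - 1 \<or> m \<le> n - 1" by linarith
  then show False using assms H_mono[of n "m - 1"] H_mono[of m "n - 1"] by blast
qed

lemma gn_0 [simp]: "gn 0 = 0"
  by (simp add: gnorm_def)

lemma gn_level:
  assumes "x \<in> H n - H (n - 1)"
  shows "gn x = lam n"
proof -
  have "(THE n. x \<in> H n - H (n - 1)) = n"
    by (rule the_equality, rule assms, rule level_unique[OF _ assms])
  moreover have "x \<noteq> 0" using assms by auto
  ultimately show ?thesis by (simp add: gnorm_def)
qed

lemma gn_cases:
  obtains "x = 0" | n where "x \<in> H n" "x \<notin> H (n - 1)" "gn x = lam n" "x \<noteq> 0"
  using ex_level[of x] gn_level[of x] that by blast

lemma gn_nonneg [simp]: "0 \<le> gn x"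
  by (cases x rule: gn_cases) auto

lemma gn_le: "x \<in> H n \<Longrightarrow> gn x \<le> lam n"
proof (cases x rule: gn_cases)
  case (2 m)
  assume "x \<in> H n"
  then have "m \<le> n" using 2 H_mono[of n "m - 1"] by (cases "m \<le> n") auto
  then show ?thesis using 2 lam_mono by simp
qed simp

lemma gn_minus: "gn (- x) = gn x"
proof (cases x rule: gn_cases)
  case (2 n)
  then have "- x \<in> H n - H (n - 1)" by simp
  then show ?thesis using 2 gn_level by simp
qed simp

lemma gn_add_le: "gn (x + y) \<le> max (gn x) (gn y)"
proof (cases x rule: gn_cases)
  case (2 n)
  note x = 2
  show ?thesis
  proof (cases y rule: gn_cases)
    case (2 m)
    have "x \<in> H (max n m)" "y \<in> H (max n m)"
      using x 2 H_mono[of n "max n m"] H_mono[of m "max n m"] by auto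
    then have "gn (x + y) \<le> lam (max n m)" by (intro gn_le H_add)
    then show ?thesis using x 2 by (auto simp: max_def split: if_splits)
  qed simp
qed simp

text \<open>If \<open>x\<close> has level \<open>n\<close>, then \<open>m \<le> n - 1\<close>, so
  \<open>h\<close> lies in \<open>H n\<close> and in \<open>H (n - 1)\<close>, and adding it changes
  neither membership. The norm is thus locally constant away from zero.\<close>

lemma gn_add_eq:
  assumes "x \<notin> H m" "h \<in> H m"
  shows "gn (x + h) = gn x"
proof (cases x rule: gn_cases)
  case 1
  then show ?thesis using assms(1) by simp
next
  case (2 n)
  have "m \<le> n - 1"
  proof (rule ccontr)
    assume "\<not> m \<le> n - 1"
    then have "H n \<subseteq> H m" by (intro H_mono) simp
    then show False using 2 assms by blast
  qed
  then have h: "h \<in> H (n - 1)" "h \<in> H n"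
    using assms(2) H_mono[of m "n - 1"] H_mono[of m n] by auto
  have "x + h \<in> H n - H (n - 1)"
    using 2 H_add_iff[OF h(1)] H_add_iff[OF h(2)] by simp
  then show ?thesis using gn_level 2 by simp
qed

text \<open>Two cases. If zero is a null set, \<open>lam (- i)\<close> tends to 0. Otherwise all
  points have the same positive mass, as in a finite group, and a subgroup of measure below twice
  that mass consists of zero alone.\<close>

lemma gn_small:
  assumes "e > 0"
  shows "\<exists>m. \<forall>x\<in>H m. gn x < e"
proof -
  have Int: "(\<Inter>i. H (- int i)) = {0}"
  proof -
    have "x \<in> H n" if "\<And>i. x \<in> H (- int i)" for x n
    proof -
      have "- int (nat (- n)) \<le> n" by simp
      from H_mono[OF this] that[of "nat (- n)"] show ?thesis by blast
    qed
    then have "(\<Inter>i. H (- int i)) \<subseteq> (\<Inter>n. H n)" by blast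
    then show ?thesis using Inter_H by auto
  qed
  have dec: "decseq (\<lambda>i. H (- int i))"
    unfolding decseq_def using H_mono by simp
  have lim: "(\<lambda>i. lam (- int i)) \<longlonglongrightarrow> measure \<mu> {0}"
    using Lim_measure_decseq[of "\<lambda>i. H (- int i)" \<mu>, OF _ dec] Int by (simp add: image_subset_iff emeasure_H)
  show ?thesis
  proof (cases "measure \<mu> {0} = 0")
    case True
    then have "(\<lambda>i. lam (- int i)) \<longlonglongrightarrow> 0" using lim by simp
    from order_tendstoD(2)[OF this assms] obtain i where "lam (- int i) < e"
      by (auto simp: eventually_sequentially)
    then show ?thesis using gn_le by (intro exI[of _ "- int i"]) fastforce
  next
    case False
    then have pos: "measure \<mu> {0} > 0" by (simp add: less_le)
    then have "measure \<mu> {0} < 2 * measure \<mu> {0}" by simp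
    from order_tendstoD(2)[OF lim this] obtain i where i: "lam (- int i) < 2 * measure \<mu> {0}"
      by (auto simp: eventually_sequentially)
    have "x = 0" if x: "x \<in> H (- int i)" for x
    proof (rule ccontr)
      assume "x \<noteq> 0"
      have fin: "emeasure \<mu> {y} = emeasure \<mu> {0}" for y
        using emeasure_translate[of "{0}" y] by simp
      have meas: "measure \<mu> {x} = measure \<mu> {0}" by (simp add: measure_def fin[of x])
      have fm: "{0} \<in> fmeasurable \<mu>" "{x} \<in> fmeasurable \<mu>"
        using H_Int_fmeasurable[of "{0}" "- int i"] H_Int_fmeasurable[of "{x}" "- int i"] x by auto
      have "2 * measure \<mu> {0} = measure \<mu> ({0} \<union> {x})"
        using fm \<open>x \<noteq> 0\<close> meas by (subst measure_Un3) auto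
      also have "\<dots> \<le> measure \<mu> (H (- int i))"
        using fm x by (intro measure_mono_fmeasurable) (auto simp: fmeasurable_def emeasure_H)
      finally show False using i by simp
    qed
    then have "gn x < e" if "x \<in> H (- int i)" for x using assms that by fastforce
    then show ?thesis by blast
  qed
qed

lemma gn_ball_eq: "{x. gn x \<le> r} = (if 0 \<le> r then {0} else {}) \<union> (\<Union>n\<in>{n. lam n \<le> r}. H n - H (n - 1))"
proof -
  let ?U = "\<Union>n\<in>{n. lam n \<le> r}. H n - H (n - 1)"
  have U: "x \<in> ?U \<longleftrightarrow> gn x \<le> r" if "x \<noteq> 0" for x
  proof
    assume "gn x \<le> r"
    then show "x \<in> ?U" using that by (cases x rule: gn_cases) auto
  next
    assume "x \<in> ?U"
    then show "gn x \<le> r" using gn_level[of x] by auto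
  qed
  show ?thesis
  proof (rule set_eqI)
    fix x
    show "x \<in> {x. gn x \<le> r} \<longleftrightarrow> x \<in> (if 0 \<le> r then {0} else {}) \<union> ?U"
      using U[of x] by (cases "x = 0") auto
  qed
qed

lemma gn_measurable [measurable]: "gn \<in> borel_measurable borel"
proof (rule borel_measurableI_le)
  fix r
  have "{x. gn x \<le> r} \<in> sets borel"
    unfolding gn_ball_eq by (intro sets.Un sets.countable_UN') auto
  then show "{x \<in> space borel. gn x \<le> r} \<in> sets borel" by simp
qed

text \<open>Nonzero elements of the ball have a level \<open>n\<close> with
  \<open>lam n \<le> r\<close>. There need be no largest such \<open>n\<close>, since
  \<open>lam\<close> may be bounded, so the ball is first cut with \<open>H m\<close>; the estimate
  is uniform in \<open>m\<close> and extends by continuity from below.\<close>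

lemma emeasure_gn_ball_le:
  assumes "r \<ge> 0"
  shows "emeasure \<mu> {x. gn x \<le> r} \<le> ennreal (r + 1)"
proof -
  let ?A = "{x. gn x \<le> r}"
  have le: "emeasure \<mu> (?A \<inter> H m) \<le> ennreal (r + 1)" for m
  proof (cases "\<exists>n\<le>m. lam n \<le> r")
    case True
    then obtain n0 where n0: "n0 \<le> m" "lam n0 \<le> r" by blast
    \<comment> \<open>Bounded below by one admissible index and above by \<open>m\<close>, this set
      is finite. Its maximum \<open>N\<close> yields a subgroup \<open>H N\<close> that contains the
      part of the ball in \<open>H m\<close>.\<close>
    define S where "S = {n \<in> {n0..m}. lam n \<le> r}"
    have "finite S" by (rule finite_subset[of _ "{n0..m}"]) (auto simp: S_def)
    then have S: "finite S" "n0 \<in> S" using n0 by (auto simp: S_def)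
    define N where "N = Max S"
    have N: "lam N \<le> r" using Max_in[OF S(1)] S(2) by (auto simp: N_def S_def)
    have "?A \<inter> H m \<subseteq> H N"
    proof
      fix x assume x: "x \<in> ?A \<inter> H m"
      show "x \<in> H N"
      proof (cases x rule: gn_cases)
        case (2 n)
        have "n \<le> m"
        proof (rule ccontr)
          assume "\<not> n \<le> m"
          then have "H m \<subseteq> H (n - 1)" by (intro H_mono) simp
          then show False using 2 x by blast
        qed
        have "n \<le> N"
        proof (cases "n0 \<le> n")
          case True
          then have "n \<in> S" using 2 x \<open>n \<le> m\<close> by (simp add: S_def)
          then show ?thesis using S(1) by (simp add: N_def)
        next
          case False
          then show ?thesis using Max_ge[OF S] by (simp add: N_def)
        qed
        then show ?thesis using 2 H_mono by blast
      qed simp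
    qed
    then have "emeasure \<mu> (?A \<inter> H m) \<le> ennreal (lam N)"
      unfolding emeasure_H[symmetric] by (intro emeasure_mono) auto
    also have "\<dots> \<le> ennreal (r + 1)" using N by (intro ennreal_leI) simp
    finally show ?thesis .
  next
    case False
    \<comment> \<open>No level up to \<open>m\<close> is admissible, so only zero is left. Its
      measure is at most that of \<open>H 0\<close>, the origin of the summand 1 in the
      bound.\<close>
    have "?A \<inter> H m \<subseteq> H 0"
    proof
      fix x assume x: "x \<in> ?A \<inter> H m"
      show "x \<in> H 0"
      proof (cases x rule: gn_cases)
        case (2 n)
        then have "\<not> n \<le> m" using x False by auto
        then have "H m \<subseteq> H (n - 1)" by (intro H_mono) simp
        then show ?thesis using 2 x by blast
      qed simp
    qed
    then have "emeasure \<mu> (?A \<inter> H m) \<le> emeasure \<mu> (H 0)" by (intro emeasure_mono) auto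
    also have "\<dots> \<le> ennreal (r + 1)" using assms by (simp add: emeasure_H0)
    finally show ?thesis .
  qed
  have inc: "incseq (\<lambda>i. ?A \<inter> H (int i))"
    unfolding incseq_def using H_mono by (meson Int_mono of_nat_mono order_refl)
  have un: "(\<Union>i. ?A \<inter> H (int i)) = ?A"
    using eventually_mem_H by (fastforce simp: eventually_sequentially)
  have "?A \<in> sets borel" by measurable
  then have "range (\<lambda>i. ?A \<inter> H (int i)) \<subseteq> sets \<mu>" by auto
  from SUP_emeasure_incseq[OF this inc]
  have "emeasure \<mu> ?A = (SUP i. emeasure \<mu> (?A \<inter> H (int i)))" unfolding un ..
  also have "\<dots> \<le> ennreal (r + 1)" using le by (intro SUP_least)
  finally show ?thesis .
qed

end

section \<open>The symbol of the heat semigroup\<close>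

locale heat_semigroup = selfdual_filtration H \<mu> ch
  for H :: "int \<Rightarrow> 'a::{topological_ab_group_add, t2_space, second_countable_topology} set" and \<mu> ch +
  fixes \<alpha> :: real
  assumes alpha_pos: "\<alpha> > 0"
begin

definition phi :: "real \<Rightarrow> 'a \<Rightarrow> real" where
  "phi t \<xi> = exp (- t * gn \<xi> powr \<alpha>)"

lemma phi_pos [simp]: "0 < phi t \<xi>" "0 \<le> phi t \<xi>"
  by (simp_all add: phi_def)

lemma phi_le_1: "0 \<le> t \<Longrightarrow> phi t \<xi> \<le> 1"
  by (simp add: phi_def)

lemma phi_0 [simp]: "phi t 0 = 1" "phi 0 \<xi> = 1"
  using alpha_pos by (simp_all add: phi_def)

lemma phi_add: "phi (s + t) \<xi> = phi s \<xi> * phi t \<xi>"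
  by (simp add: phi_def exp_add[symmetric] algebra_simps)

lemma phi_minus: "phi t (- \<xi>) = phi t \<xi>"
  by (simp add: phi_def gn_minus)

lemma phi_measurable [measurable]: "phi t \<in> borel_measurable borel"
  unfolding phi_def by measurable

text \<open>The symbol decreases with an ultrametric norm, so its superlevel sets are closed under
  addition. This is the source of the positivity of the heat kernel.\<close>

lemma phi_add_ge: "0 \<le> t \<Longrightarrow> min (phi t \<xi>) (phi t \<eta>) \<le> phi t (\<xi> + \<eta>)"
proof -
  assume t: "0 \<le> t"
  have mono: "phi t b \<le> phi t a" if "gn a \<le> gn b" for a b
    using that t alpha_pos unfolding phi_def by (auto intro!: mult_left_mono powr_mono2)
  show ?thesis
    using gn_add_le[of \<xi> \<eta>] mono[of "\<xi> + \<eta>" \<xi>] mono[of "\<xi> + \<eta>" \<eta>] by linarith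
qed

lemma summable_radial: "t > 0 \<Longrightarrow> summable (\<lambda>j. (real j + 2) * exp (- t * real j powr \<alpha>))"
proof -
  assume t: "t > 0"
  have "(\<lambda>j. (real j + 2) * exp (- t * real j powr \<alpha>)) \<in> O(\<lambda>j. inverse (real j ^ 2))"
    using t alpha_pos by real_asymp
  then show ?thesis
    by (rule summable_comparison_test_bigo[rotated]) (simp add: inverse_power_summable)
qed

text \<open>Decomposition by the integer part \<open>j\<close> of the norm: the ball of radius
  \<open>j + 1\<close> has measure at most \<open>j + 2\<close>, which the factor
  \<open>exp (- t * real j powr \<alpha>)\<close> outweighs for every positive
  \<open>\<alpha>\<close>.\<close>

lemma phi_integrable:
  assumes t: "t > 0"
  shows "integrable \<mu> (phi t)"
proof (rule integrableI_bounded)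
  show "phi t \<in> borel_measurable \<mu>" by measurable
  let ?c = "\<lambda>j. exp (- t * real j powr \<alpha>)"
  let ?f = "\<lambda>j \<xi>. ennreal (?c j) * indicator {\<xi>. gn \<xi> \<le> real (Suc j)} \<xi>"
  have "ennreal (norm (phi t \<xi>)) \<le> (\<Sum>j. ?f j \<xi>)" for \<xi>
  proof -
    define j where "j = nat \<lfloor>gn \<xi>\<rfloor>"
    have j: "real j \<le> gn \<xi>" "gn \<xi> \<le> real (Suc j)"
      unfolding j_def by (simp_all add: of_nat_nat, linarith)
    have "phi t \<xi> \<le> ?c j"
      unfolding phi_def using j(1) t alpha_pos by (auto intro!: mult_left_mono powr_mono2)
    then have "ennreal (norm (phi t \<xi>)) \<le> ?f j \<xi>"
      using j(2) by (simp add: ennreal_leI)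
    also have "\<dots> \<le> (\<Sum>j. ?f j \<xi>)"
    proof -
      define g where "g j = ?f j \<xi>" for j
      show ?thesis unfolding g_def[symmetric] using sum_le_suminf[of g "{j}"] by simp
    qed
    finally show ?thesis .
  qed
  then have "(\<integral>\<^sup>+\<xi>. ennreal (norm (phi t \<xi>)) \<partial>\<mu>) \<le> (\<integral>\<^sup>+\<xi>. (\<Sum>j. ?f j \<xi>) \<partial>\<mu>)"
    by (intro nn_integral_mono)
  also have "\<dots> = (\<Sum>j. \<integral>\<^sup>+\<xi>. ?f j \<xi> \<partial>\<mu>)"
    by (rule nn_integral_suminf) measurable
  also have "\<dots> \<le> (\<Sum>j. ennreal ((real j + 2) * ?c j))"
  proof (rule suminf_le)
    fix j
    have "(\<integral>\<^sup>+\<xi>. ?f j \<xi> \<partial>\<mu>) = ennreal (?c j) * emeasure \<mu> {\<xi>. gn \<xi> \<le> real (Suc j)}"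
      by (rule nn_integral_cmult_indicator) measurable
    also have "\<dots> \<le> ennreal (?c j) * ennreal (real (Suc j) + 1)"
      by (intro mult_left_mono emeasure_gn_ball_le) auto
    also have "\<dots> = ennreal ((real j + 2) * ?c j)"
      by (subst ennreal_mult[symmetric]) (auto simp: algebra_simps)
    finally show "(\<integral>\<^sup>+\<xi>. ?f j \<xi> \<partial>\<mu>) \<le> ennreal ((real j + 2) * ?c j)" .
  qed auto
  also have "\<dots> = ennreal (\<Sum>j. (real j + 2) * ?c j)"
    by (rule suminf_ennreal2[OF _ summable_radial[OF t]]) simp
  also have "\<dots> < \<infinity>" by simp
  finally show "(\<integral>\<^sup>+\<xi>. ennreal (norm (phi t \<xi>)) \<partial>\<mu>) < \<infinity>" .
qed

text \<open>Away from zero the norm, and so \<open>phi t\<close>, is constant on small cosets. At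
  zero the bound \<open>1 - exp (- y) \<le> y\<close> is combined with the smallness of the norm on
  small subgroups.\<close>

lemma phi_cont:
  assumes t: "t \<ge> 0" and e: "e > 0"
  shows "\<exists>M. \<forall>m\<ge>M. \<forall>\<xi>\<in>coset \<eta> (- m). \<bar>phi t \<xi> - phi t \<eta>\<bar> \<le> e"
proof (cases "\<eta> = 0")
  case False
  then obtain k where k: "\<eta> \<notin> H k" using Inter_H by blast
  have eq: "phi t \<xi> = phi t \<eta>" if "m \<ge> - k" "\<xi> \<in> coset \<eta> (- m)" for m \<xi>
  proof -
    have "\<xi> - \<eta> \<in> H k" using that H_mono[of "- m" k] by auto
    from gn_add_eq[OF k this] show ?thesis by (simp add: phi_def)
  qed
  have "\<bar>phi t \<xi> - phi t \<eta>\<bar> \<le> e" if "m \<ge> - k" "\<xi> \<in> coset \<eta> (- m)" for m \<xi>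
    using eq[OF that] e by simp
  then show ?thesis by blast
next
  case True
  \<comment> \<open>Chosen so that \<open>d powr \<alpha> = e / (t + 1)\<close>. The denominator
    \<open>t + 1\<close> avoids a division by zero at \<open>t = 0\<close> and still gives
    \<open>t * d powr \<alpha> \<le> e\<close>.\<close>
  define d where "d = (e / (t + 1)) powr (1 / \<alpha>)"
  have d: "d > 0" using t e by (simp add: d_def)
  obtain k where k: "\<forall>x\<in>H k. gn x < d" using gn_small[OF d] by blast
  have "\<bar>phi t \<xi> - 1\<bar> \<le> e" if "m \<ge> - k" "\<xi> \<in> H (- m)" for m \<xi>
  proof -
    have "- m \<le> k" using that(1) by simp
    then have "gn \<xi> \<le> d" using that(2) H_mono[of "- m" k] k by (meson less_imp_le subsetD)
    then have "gn \<xi> powr \<alpha> \<le> d powr \<alpha>" using alpha_pos by (intro powr_mono2) auto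
    also have "\<dots> = e / (t + 1)" using alpha_pos t e by (simp add: d_def powr_powr)
    finally have "t * gn \<xi> powr \<alpha> \<le> t * (e / (t + 1))" using t by (rule mult_left_mono)
    also have "\<dots> \<le> e" using t e by (simp add: field_simps)
    finally have "t * gn \<xi> powr \<alpha> \<le> e" .
    then show ?thesis
      using exp_ge_add_one_self[of "- t * gn \<xi> powr \<alpha>"] phi_le_1[OF t, of \<xi>]
      by (simp add: phi_def)
  qed
  then have "\<forall>m\<ge>- k. \<forall>\<xi>\<in>coset \<eta> (- m). \<bar>phi t \<xi> - phi t \<eta>\<bar> \<le> e"
    using True by simp
  then show ?thesis by (rule exI)
qed

end

section \<open>The heat kernel\<close>

context heat_semigroup
begin

definition Zc :: "real \<Rightarrow> 'a \<Rightarrow> complex" where "Zc t x = heat_kernel H \<mu> ch \<alpha> x t"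

definition Z :: "real \<Rightarrow> 'a \<Rightarrow> real" where "Z t x = Re (Zc t x)"

lemma Zc_def': "Zc t x = (LINT \<xi>|\<mu>. cnj (ch \<xi> x) * of_real (phi t \<xi>))"
  by (simp add: Zc_def heat_kernel_def phi_def)

lemma Zc_measurable [measurable]: "Zc t \<in> borel_measurable borel"
  unfolding Zc_def'[abs_def] by measurable

lemma Z_measurable [measurable]: "Z t \<in> borel_measurable borel"
  unfolding Z_def[abs_def] by measurable

text \<open>Layer cake: \<open>phi t \<xi>\<close> is the integral over \<open>u > 0\<close> of the indicators of the superlevel sets
  \<open>{\<xi>. u < phi t \<xi>}\<close>. These are subgroups, so each of them contributes a nonnegative
  character integral.\<close>

lemma Zc_nonneg_real:
  assumes t: "t > 0"
  shows "\<exists>r\<ge>0. Zc t x = of_real r"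
proof -
  define h where "h p = cnj (ch (fst p) x) * of_real (if 0 < snd p \<and> snd p < phi t (fst p) then 1 else 0)"
    for p :: "'a \<times> real"
  interpret P: pair_sigma_finite \<mu> lborel ..
  have h [measurable]: "h \<in> borel_measurable (\<mu> \<Otimes>\<^sub>M lborel)"
    unfolding h_def by measurable
  have layer: "(LINT u|lborel. (if 0 < u \<and> u < phi t \<xi> then 1 else 0)) = phi t \<xi>" for \<xi>
  proof -
    have "(LINT u|lborel. (if 0 < u \<and> u < phi t \<xi> then 1 else 0 :: real)) = (LINT u|lborel. indicator {0<..<phi t \<xi>} u)"
      by (intro Bochner_Integration.integral_cong) (auto simp: indicator_def)
    then show ?thesis by simp
  qed
  have int_layer: "integrable lborel (\<lambda>u. (if 0 < u \<and> u < phi t \<xi> then 1 else 0 :: real))" for \<xi>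
  proof -
    have "integrable lborel (indicator {0<..<phi t \<xi>} :: real \<Rightarrow> real)" by simp
    moreover have "indicator {0<..<phi t \<xi>} = (\<lambda>u. (if 0 < u \<and> u < phi t \<xi> then 1 else 0 :: real))"
      by (auto simp: indicator_def)
    ultimately show ?thesis by simp
  qed
  have norm_h: "norm (h (\<xi>, u)) = (if 0 < u \<and> u < phi t \<xi> then 1 else 0)" for \<xi> u
    by (simp add: h_def norm_mult)
  have int: "integrable (\<mu> \<Otimes>\<^sub>M lborel) h"
  proof (rule P.Fubini_integrable[OF h])
    show "integrable \<mu> (\<lambda>\<xi>. LINT u|lborel. norm (h (\<xi>, u)))"
      unfolding norm_h layer by (rule phi_integrable[OF t])
    show "AE \<xi> in \<mu>. integrable lborel (\<lambda>u. h (\<xi>, u))"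
      unfolding h_def fst_conv snd_conv
      by (intro AE_I2 integrable_mult_right integrable_of_real int_layer)
  qed
  have "Zc t x = (LINT \<xi>|\<mu>. LINT u|lborel. h (\<xi>, u))"
  proof -
    have "(LINT u|lborel. h (\<xi>, u)) = cnj (ch \<xi> x) * of_real (phi t \<xi>)" for \<xi>
      unfolding h_def fst_conv snd_conv
      by (simp only: integral_mult_right_zero integral_complex_of_real layer)
    then show ?thesis by (simp add: Zc_def')
  qed
  also have "\<dots> = (LINT u|lborel. LINT \<xi>|\<mu>. h (\<xi>, u))"
    by (rule P.Fubini_integral[symmetric]) (use int in simp)
  finally have Z: "Zc t x = (LINT u|lborel. LINT \<xi>|\<mu>. h (\<xi>, u))" .
  have "\<exists>r\<ge>0. (LINT \<xi>|\<mu>. h (\<xi>, u)) = of_real r" for u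
  \<comment> \<open>The condition \<open>u < 1\<close> puts zero, where \<open>phi t\<close> equals
    1, into the superlevel set, which is then a subgroup. For all other \<open>u\<close> the
    integrand vanishes.\<close>
  proof (cases "0 < u \<and> u < 1")
    case True
    define B where "B = {\<xi>. u < phi t \<xi>}"
    have B: "B \<in> sets borel" unfolding B_def by measurable
    have sub: "add_subgroup B"
      unfolding add_subgroup_def B_def using True phi_add_ge[of t] t
      by (auto simp: phi_minus) (smt (verit))
    have "(LINT \<xi>|\<mu>. h (\<xi>, u)) = (LINT \<xi>|\<mu>. indicator B \<xi> * cnj (ch \<xi> x))"
      using True by (intro Bochner_Integration.integral_cong) (auto simp: h_def B_def indicator_def)
    also have "\<dots> = (if \<forall>\<xi>\<in>B. cnj (ch \<xi> x) = 1 then of_real (measure \<mu> B) else 0)"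
      by (rule integral_char_subgroup[OF B sub]) (simp_all add: ch_add_left)
    finally show ?thesis
      by (intro exI[of _ "if \<forall>\<xi>\<in>B. cnj (ch \<xi> x) = 1 then measure \<mu> B else 0"]) simp
  next
    case False
    have "h (\<xi>, u) = 0" for \<xi>
      using False phi_le_1[of t \<xi>] t by (auto simp: h_def)
    then show ?thesis by (intro exI[of _ 0]) simp
  qed
  then have "\<forall>u. \<exists>r. r \<ge> 0 \<and> (LINT \<xi>|\<mu>. h (\<xi>, u)) = of_real r" by blast
  from choice[OF this] obtain r where r: "\<And>u. 0 \<le> r u" "\<And>u. (LINT \<xi>|\<mu>. h (\<xi>, u)) = of_real (r u)"
    by blast
  have "Zc t x = of_real (LINT u|lborel. r u)"
    unfolding Z r(2) by (rule integral_complex_of_real)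
  then show ?thesis using r(1) by (intro exI[of _ "LINT u|lborel. r u"]) simp
qed

lemma Z_nonneg: "t > 0 \<Longrightarrow> 0 \<le> Z t x"
  using Zc_nonneg_real[of t x] by (auto simp: Z_def)

lemma Zc_eq: "t > 0 \<Longrightarrow> Zc t x = of_real (Z t x)"
  using Zc_nonneg_real[of t x] by (auto simp: Z_def)

lemma Z_minus:
  assumes t: "t > 0"
  shows "Z t (- x) = Z t x"
proof -
  have "Zc t (- x) = cnj (Zc t x)"
    unfolding Zc_def' by (subst Bochner_Integration.integral_cnj[symmetric]) (simp add: ch_minus)
  then show ?thesis by (simp add: Z_def)
qed

lemma Zc_bound: "t > 0 \<Longrightarrow> cmod (Zc t x) \<le> (LINT \<xi>|\<mu>. phi t \<xi>)"
  unfolding Zc_def' using integral_norm_bound[of \<mu> "\<lambda>\<xi>. cnj (ch \<xi> x) * of_real (phi t \<xi>)"]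
  by (simp add: norm_mult)

text \<open>Inversion before the kernel is known to be integrable: the cut-off to \<open>H m\<close>
  makes Fubini applicable, and since \<open>lam m = 1 / lam (- m)\<close> the right-hand side is the
  mean of \<open>phi t\<close> over the coset of \<open>\<eta>\<close> modulo
  \<open>H (- m)\<close>, which tends to \<open>phi t \<eta>\<close> as \<open>m\<close>
  grows.\<close>

lemma Zc_truncated:
  assumes t: "t > 0"
  shows "(LINT x|\<mu>. indicator (H m) x * ch \<eta> x * Zc t x)
    = of_real (lam m * (LINT \<xi>|\<mu>. indicator (coset \<eta> (- m)) \<xi> * phi t \<xi>))"
proof -
  interpret P: pair_sigma_finite \<mu> \<mu> ..
  define h where "h x \<xi> = of_real (phi t \<xi>) * (indicator (H m) x * ch (\<eta> - \<xi>) x)" for x \<xi>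
  have int: "integrable (\<mu> \<Otimes>\<^sub>M \<mu>) (\<lambda>(x, \<xi>). h x \<xi>)"
  proof (rule P.integrable_pair_bound[OF _ _ phi_integrable[OF t]])
    show "(\<lambda>(x, \<xi>). h x \<xi>) \<in> borel_measurable (\<mu> \<Otimes>\<^sub>M \<mu>)" unfolding h_def by measurable
    show "integrable \<mu> (indicator (H m) :: 'a \<Rightarrow> real)"
      by (rule integrable_real_indicator) (auto simp: emeasure_H)
    show "cmod (case (x, \<xi>) of (x, \<xi>) \<Rightarrow> h x \<xi>) \<le> indicator (H m) x * phi t \<xi>" for x \<xi>
      by (simp add: h_def norm_mult indicator_def)
  qed
  have "(LINT x|\<mu>. indicator (H m) x * ch \<eta> x * Zc t x) = (LINT x|\<mu>. LINT \<xi>|\<mu>. h x \<xi>)"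
  proof (rule Bochner_Integration.integral_cong)
    fix x
    have "indicator (H m) x * ch \<eta> x * Zc t x
        = (LINT \<xi>|\<mu>. indicator (H m) x * ch \<eta> x * (cnj (ch \<xi> x) * of_real (phi t \<xi>)))"
      unfolding Zc_def' by simp
    also have "\<dots> = (LINT \<xi>|\<mu>. h x \<xi>)"
      by (intro Bochner_Integration.integral_cong) (simp_all add: h_def ch_diff ac_simps)
    finally show "indicator (H m) x * ch \<eta> x * Zc t x = (LINT \<xi>|\<mu>. h x \<xi>)" .
  qed simp
  also have "\<dots> = (LINT \<xi>|\<mu>. LINT x|\<mu>. h x \<xi>)"
    by (rule P.Fubini_integral[OF int, symmetric])
  also have "\<dots> = (LINT \<xi>|\<mu>. of_real (lam m * (indicator (coset \<eta> (- m)) \<xi> * phi t \<xi>)))"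
  proof (rule Bochner_Integration.integral_cong)
    fix \<xi>
    have "(LINT x|\<mu>. h x \<xi>) = of_real (phi t \<xi>) * (indicator (H (- m)) (\<eta> - \<xi>) * of_real (lam m))"
      unfolding h_def using integral_H_ch[of m "\<eta> - \<xi>"] by simp
    also have "\<dots> = of_real (lam m * (indicator (coset \<eta> (- m)) \<xi> * phi t \<xi>))"
      using H_diff_commute[of \<eta> \<xi> "- m"] by (simp add: indicator_def)
    finally show "(LINT x|\<mu>. h x \<xi>) = of_real (lam m * (indicator (coset \<eta> (- m)) \<xi> * phi t \<xi>))" .
  qed simp
  also have "\<dots> = of_real (lam m * (LINT \<xi>|\<mu>. indicator (coset \<eta> (- m)) \<xi> * phi t \<xi>))"
    by (subst integral_complex_of_real) simp
  finally show ?thesis .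
qed

lemma integrable_indicator_phi:
  "t \<ge> 0 \<Longrightarrow> integrable \<mu> (\<lambda>\<xi>. indicator (coset \<eta> m) \<xi> * phi t \<xi>)"
  by (rule integrable_bounded_support[of _ "coset \<eta> m" 1]) (auto simp: emeasure_coset' phi_le_1)

lemma phi_average_tendsto:
  assumes t: "t \<ge> 0"
  shows "(\<lambda>n. lam (int n) * (LINT \<xi>|\<mu>. indicator (coset \<eta> (- int n)) \<xi> * phi t \<xi>)) \<longlonglongrightarrow> phi t \<eta>"
proof (rule LIMSEQ_I)
  fix e :: real assume "e > 0"
  then have "e / 2 > 0" by simp
  from phi_cont[OF t this] obtain M where M: "\<forall>m\<ge>M. \<forall>\<xi>\<in>coset \<eta> (- m). \<bar>phi t \<xi> - phi t \<eta>\<bar> \<le> e / 2" by blast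
  have "norm (lam (int n) * (LINT \<xi>|\<mu>. indicator (coset \<eta> (- int n)) \<xi> * phi t \<xi>) - phi t \<eta>) < e"
    if n: "n \<ge> nat M" for n
  proof -
    let ?C = "coset \<eta> (- int n)"
    have "M \<le> int n" using n by (simp add: nat_le_iff)
    with M have close: "\<bar>phi t \<xi> - phi t \<eta>\<bar> \<le> e / 2" if "\<xi> \<in> ?C" for \<xi> using that by blast
    have int: "integrable \<mu> (\<lambda>\<xi>. indicator ?C \<xi> * phi t \<xi>)" by (rule integrable_indicator_phi[OF t])
    have intc: "integrable \<mu> (\<lambda>\<xi>. indicator ?C \<xi> * c :: real)" for c
      by (intro integrable_mult_left integrable_real_indicator) (auto simp: emeasure_coset')
    have d: "lam (int n) * lam (- int n) = 1" by (rule lam_duality)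
    have ave: "lam (int n) * (LINT \<xi>|\<mu>. indicator ?C \<xi> * c) = c" for c
      using d by (simp add: mult.assoc[symmetric])
    have "\<bar>(LINT \<xi>|\<mu>. indicator ?C \<xi> * phi t \<xi>) - (LINT \<xi>|\<mu>. indicator ?C \<xi> * phi t \<eta>)\<bar>
        = \<bar>LINT \<xi>|\<mu>. indicator ?C \<xi> * phi t \<xi> - indicator ?C \<xi> * phi t \<eta>\<bar>"
      using int intc by simp
    also have "\<dots> \<le> (LINT \<xi>|\<mu>. \<bar>indicator ?C \<xi> * phi t \<xi> - indicator ?C \<xi> * phi t \<eta>\<bar>)"
      by (rule integral_abs_bound)
    also have "\<dots> \<le> (LINT \<xi>|\<mu>. indicator ?C \<xi> * (e / 2))"
    proof (rule integral_mono)
      show "integrable \<mu> (\<lambda>\<xi>. \<bar>indicator ?C \<xi> * phi t \<xi> - indicator ?C \<xi> * phi t \<eta>\<bar>)"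
        using int intc by (intro integrable_abs Bochner_Integration.integrable_diff)
      show "\<bar>indicator ?C \<xi> * phi t \<xi> - indicator ?C \<xi> * phi t \<eta>\<bar> \<le> indicator ?C \<xi> * (e / 2)" for \<xi>
        using close[of \<xi>] by (cases "\<xi> \<in> ?C") auto
    qed (rule intc)
    finally have "lam (int n) * \<bar>(LINT \<xi>|\<mu>. indicator ?C \<xi> * phi t \<xi>) - (LINT \<xi>|\<mu>. indicator ?C \<xi> * phi t \<eta>)\<bar>
        \<le> lam (int n) * (LINT \<xi>|\<mu>. indicator ?C \<xi> * (e / 2))"
      by (rule mult_left_mono) simp
    then have "\<bar>lam (int n) * ((LINT \<xi>|\<mu>. indicator ?C \<xi> * phi t \<xi>) - (LINT \<xi>|\<mu>. indicator ?C \<xi> * phi t \<eta>))\<bar> \<le> e / 2"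
      unfolding ave by (simp only: abs_mult abs_of_nonneg[OF lam_nonneg])
    then show ?thesis unfolding right_diff_distrib ave using \<open>e > 0\<close> by simp
  qed
  then show "\<exists>N. \<forall>n\<ge>N. norm (lam (int n) * (LINT \<xi>|\<mu>. indicator (coset \<eta> (- int n)) \<xi> * phi t \<xi>) - phi t \<eta>) < e"
    by blast
qed

lemma Zc_truncated_tendsto:
  assumes t: "t > 0"
  shows "(\<lambda>n. LINT x|\<mu>. indicator (H (int n)) x * ch \<eta> x * Zc t x) \<longlonglongrightarrow> of_real (phi t \<eta>)"
  unfolding Zc_truncated[OF t] using t by (intro tendsto_of_real phi_average_tendsto) simp

text \<open>The truncated integrals increase because the kernel is nonnegative, and for
  \<open>\<eta> = 0\<close> they tend to \<open>phi t 0 = 1\<close>. Monotone convergence therefore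
  yields integrability and total mass together.\<close>

lemma Z_integrable: "t > 0 \<Longrightarrow> integrable \<mu> (Z t)"
  and Z_integral: "t > 0 \<Longrightarrow> (LINT x|\<mu>. Z t x) = 1"
proof -
  assume t: "t > 0"
  let ?f = "\<lambda>n x. indicator (H (int n)) x * Z t x"
  have int: "integrable \<mu> (?f n)" for n
  proof (rule integrable_bounded_support[of _ "H (int n)" "LINT \<xi>|\<mu>. phi t \<xi>"])
    show "norm (?f n x) \<le> (LINT \<xi>|\<mu>. phi t \<xi>)" if "x \<in> H (int n)" for x
      using Zc_bound[OF t, of x] Zc_eq[OF t, of x] that by simp
  qed (auto simp: emeasure_H)
  have mono: "AE x in \<mu>. mono (\<lambda>n. ?f n x)"
  proof (intro AE_I2 monoI)
    fix x and n m :: nat assume "n \<le> m"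
    then have "H (int n) \<subseteq> H (int m)" by (intro H_mono) simp
    then show "?f n x \<le> ?f m x" using Z_nonneg[OF t] by (auto simp: indicator_def)
  qed
  have lim: "AE x in \<mu>. (\<lambda>n. ?f n x) \<longlonglongrightarrow> Z t x"
  proof (intro AE_I2 tendsto_eventually)
    show "\<forall>\<^sub>F n in sequentially. ?f n x = Z t x" for x
      using eventually_mem_H[of x] by eventually_elim simp
  qed
  have eq: "complex_of_real (LINT x|\<mu>. ?f n x) = (LINT x|\<mu>. indicator (H (int n)) x * ch 0 x * Zc t x)" for n
    by (subst integral_complex_of_real[symmetric], rule Bochner_Integration.integral_cong)
       (auto simp: Zc_eq[OF t] indicator_def)
  have "(\<lambda>n. complex_of_real (LINT x|\<mu>. ?f n x)) \<longlonglongrightarrow> of_real 1"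
    using Zc_truncated_tendsto[OF t, of 0] unfolding eq by simp
  then have ilim: "(\<lambda>n. LINT x|\<mu>. ?f n x) \<longlonglongrightarrow> 1"
    by (simp only: tendsto_of_real_iff)
  note * = integral_monotone_convergence_nonneg[OF int mono _ lim ilim]
  show "integrable \<mu> (Z t)" by (rule *(1)) (use Z_nonneg[OF t] in auto)
  show "(LINT x|\<mu>. Z t x) = 1" by (rule *(2)) (use Z_nonneg[OF t] in auto)
qed

lemma Zc_L12:
  assumes t: "t > 0"
  shows "Zc t \<in> L12"
proof (rule L12I)
  show int: "integrable \<mu> (Zc t)"
    unfolding Zc_eq[OF t, abs_def] by (rule integrable_of_real[OF Z_integrable[OF t]])
  let ?b = "LINT \<xi>|\<mu>. phi t \<xi>"
  show "Zc t \<in> L2 \<mu>"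
  proof (rule L2_bound)
    show "integrable \<mu> (\<lambda>x. ?b * cmod (Zc t x))" using int by simp
    show "AE x in \<mu>. (cmod (Zc t x))\<^sup>2 \<le> ?b * cmod (Zc t x)"
      using Zc_bound[OF t] by (intro AE_I2) (auto simp: power2_eq_square intro: mult_right_mono)
  qed measurable
qed

text \<open>Integrability of the kernel now provides a majorant for the truncated integrals, whose
  limit is already known.\<close>

lemma FT_Zc:
  assumes t: "t > 0"
  shows "FT (Zc t) \<eta> = of_real (phi t \<eta>)"
proof -
  have "(\<lambda>n. LINT x|\<mu>. indicator (H (int n)) x * ch \<eta> x * Zc t x) \<longlonglongrightarrow> (LINT x|\<mu>. Zc t x * ch \<eta> x)"
  proof (rule integral_dominated_convergence[where w = "\<lambda>x. cmod (Zc t x)"])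
    show "integrable \<mu> (\<lambda>x. cmod (Zc t x))"
      by (rule integrable_norm[OF L12_integrable[OF Zc_L12[OF t]]])
    show "AE x in \<mu>. (\<lambda>n. indicator (H (int n)) x * ch \<eta> x * Zc t x) \<longlonglongrightarrow> Zc t x * ch \<eta> x"
    proof (intro AE_I2 tendsto_eventually)
      show "\<forall>\<^sub>F n in sequentially. indicator (H (int n)) x * ch \<eta> x * Zc t x = Zc t x * ch \<eta> x" for x
        using eventually_mem_H[of x] by eventually_elim simp
    qed
    show "AE x in \<mu>. norm (indicator (H (int n)) x * ch \<eta> x * Zc t x) \<le> cmod (Zc t x)" for n
      by (intro AE_I2) (auto simp: norm_mult indicator_def)
  qed measurable
  then show ?thesis
    using Zc_truncated_tendsto[OF t] LIMSEQ_unique unfolding FT_def' by blast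
qed

end

section \<open>The Cauchy problem\<close>

lemma exp_uminus_diff_le:
  fixes a b :: real
  assumes "0 \<le> a" "0 \<le> b"
  shows "\<bar>exp (- a) - exp (- b)\<bar> \<le> \<bar>a - b\<bar>"
proof -
  have le: "exp (- x) - exp (- y) \<le> y - x" if "0 \<le> x" "x \<le> y" for x y :: real
  proof -
    have "exp (- x) - exp (- y) = exp (- x) * (1 - exp (- (y - x)))"
      by (simp add: right_diff_distrib exp_add[symmetric])
    also have "\<dots> \<le> 1 * (1 - exp (- (y - x)))"
      using that by (intro mult_right_mono) auto
    also have "\<dots> \<le> y - x" 
    proof -
      define E where "E = exp (- (y - x))"
      have "1 + - (y - x) \<le> E" unfolding E_def by (rule exp_ge_add_one_self)
      then show ?thesis unfolding E_def[symmetric] by (simp add: algebra_simps)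
    qed
    finally show ?thesis .
  qed
  show ?thesis
  proof (cases "a \<le> b")
    case True
    then have "exp (- b) \<le> exp (- a)" by simp
    then show ?thesis using le[OF assms(1) True] True by simp
  next
    case False
    then have "exp (- a) \<le> exp (- b)" "b \<le> a" by simp_all
    then show ?thesis using le[OF assms(2), of a] by simp
  qed
qed

context heat_semigroup
begin

lemma integrable_Z_shift: "t > 0 \<Longrightarrow> integrable \<mu> (\<lambda>y. Z t (y - a))"
  using integrable_translate[of "Z t" "- a"] Z_integrable[of t] by simp

lemma integral_Z_shift: "t > 0 \<Longrightarrow> (LINT y|\<mu>. Z t (y - a)) = 1"
  using integral_translate[of "Z t" "- a"] Z_integral[of t] by simp

lemma Z_diff_commute: "t > 0 \<Longrightarrow> Z t (x - y) = Z t (y - x)"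
  using Z_minus[of t "y - x"] by simp

lemma Z_bound: "t > 0 \<Longrightarrow> Z t x \<le> (LINT \<xi>|\<mu>. phi t \<xi>)"
  using Zc_bound[of t x] Zc_eq[of t x] by simp

definition conv :: "real \<Rightarrow> ('a \<Rightarrow> complex) \<Rightarrow> 'a \<Rightarrow> complex" where
  "conv t = fun_convolution \<mu> (\<lambda>x. heat_kernel H \<mu> ch \<alpha> x t)"

lemma conv_eq: "conv t f x = (LINT y|\<mu>. Zc t (x - y) * f y)"
  by (simp add: conv_def fun_convolution_def Zc_def)

lemma conv_measurable [measurable]:
  assumes "f \<in> borel_measurable borel"
  shows "conv t f \<in> borel_measurable borel"
proof -
  note [measurable] = assms
  show ?thesis unfolding conv_eq[abs_def] by measurable
qed

lemma L2_borel: "f \<in> L2 \<mu> \<Longrightarrow> f \<in> borel_measurable borel"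
  using L2_measurable[of f \<mu>] by (simp cong: measurable_cong_sets)

text \<open>Cauchy-Schwarz for the splitting \<open>Z f = sqrt Z * (sqrt Z f)\<close>, where \<open>Z t (x - y) d\<mu>(y)\<close>
  has total mass 1.\<close>

lemma conv_pointwise:
  assumes t: "t > 0" and f: "f \<in> L2 \<mu>"
  shows "integrable \<mu> (\<lambda>y. Zc t (x - y) * f y)"
    and "integrable \<mu> (\<lambda>y. Z t (x - y) * (cmod (f y))\<^sup>2)"
    and "(cmod (conv t f x))\<^sup>2 \<le> (LINT y|\<mu>. Z t (x - y) * (cmod (f y))\<^sup>2)"
proof -
  note [measurable] = L2_borel[OF f]
  note nn = Z_nonneg[OF t]
  define u where "u y = complex_of_real (sqrt (Z t (x - y)))" for y
  define v where "v y = u y * f y" for y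
  have uv [measurable]: "u \<in> borel_measurable borel" "v \<in> borel_measurable borel"
    unfolding u_def v_def by measurable
  have u2: "(cmod (u y))\<^sup>2 = Z t (y - x)" for y
    using nn by (simp add: u_def Z_diff_commute[OF t])
  have v2: "(cmod (v y))\<^sup>2 = Z t (x - y) * (cmod (f y))\<^sup>2" for y
    using nn by (simp add: u_def v_def norm_mult power_mult_distrib)
  have u: "u \<in> L2 \<mu>" by (rule L2I) (simp_all add: u2 integrable_Z_shift[OF t])
  have "L2_norm \<mu> u = 1" by (simp add: L2_norm_def u2 integral_Z_shift[OF t])
  note u1 = this
  show int: "integrable \<mu> (\<lambda>y. Z t (x - y) * (cmod (f y))\<^sup>2)"
  proof (rule Bochner_Integration.integrable_bound)
    show "integrable \<mu> (\<lambda>y. (LINT \<xi>|\<mu>. phi t \<xi>) * (cmod (f y))\<^sup>2)"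
      using L2_integrable[OF f] by simp
    show "AE y in \<mu>. norm (Z t (x - y) * (cmod (f y))\<^sup>2) \<le> norm ((LINT \<xi>|\<mu>. phi t \<xi>) * (cmod (f y))\<^sup>2)"
    proof (rule AE_I2)
      fix y
      have "Z t (x - y) * (cmod (f y))\<^sup>2 \<le> (LINT \<xi>|\<mu>. phi t \<xi>) * (cmod (f y))\<^sup>2"
        by (intro mult_right_mono Z_bound[OF t]) simp
      moreover have "0 \<le> Z t (x - y) * (cmod (f y))\<^sup>2" using nn by simp
      ultimately show "norm (Z t (x - y) * (cmod (f y))\<^sup>2) \<le> norm ((LINT \<xi>|\<mu>. phi t \<xi>) * (cmod (f y))\<^sup>2)" by simp
    qed
  qed measurable
  have v: "v \<in> L2 \<mu>" by (rule L2I) (simp_all add: v2 int)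
  have eq: "Zc t (x - y) * f y = u y * v y" for y
    using nn by (simp add: u_def v_def Zc_eq[OF t] mult.assoc[symmetric] flip: of_real_mult)
  show int': "integrable \<mu> (\<lambda>y. Zc t (x - y) * f y)"
    unfolding eq by (rule L2_Cauchy_Schwarz(1)[OF u v])
  have "cmod (conv t f x) \<le> (LINT y|\<mu>. cmod (u y * v y))"
    unfolding conv_eq eq by (rule integral_norm_bound)
  also have "\<dots> \<le> L2_norm \<mu> v" using L2_Cauchy_Schwarz(2)[OF u v] by (simp add: u1)
  finally have "(cmod (conv t f x))\<^sup>2 \<le> (L2_norm \<mu> v)\<^sup>2" by (rule power_mono) simp
  then show "(cmod (conv t f x))\<^sup>2 \<le> (LINT y|\<mu>. Z t (x - y) * (cmod (f y))\<^sup>2)"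
    by (simp add: L2_norm_power2 v2)
qed

text \<open>The character is kept inside so that one statement serves both the transform of a
  convolution and, for \<open>\<xi> = 0\<close>, the integrability of the convolution
  itself.\<close>

lemma conv_integrable_pair:
  fixes g :: "'a \<Rightarrow> complex"
  assumes t: "t > 0" and g: "integrable \<mu> g"
  shows "integrable (\<mu> \<Otimes>\<^sub>M \<mu>) (\<lambda>(y, x). Zc t (x - y) * g y * ch \<xi> x)"
proof -
  interpret P: pair_sigma_finite \<mu> \<mu> ..
  have [measurable]: "g \<in> borel_measurable borel"
    using borel_measurable_integrable[OF g] by (simp cong: measurable_cong_sets)
  have n: "norm (Zc t (x - y) * g y * ch \<xi> x) = cmod (g y) * Z t (x - y)" for x y
    using Z_nonneg[OF t] by (simp add: norm_mult Zc_eq[OF t] mult.commute)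
  show ?thesis
  proof (rule P.Fubini_integrable)
    show "(\<lambda>(y, x). Zc t (x - y) * g y * ch \<xi> x) \<in> borel_measurable (\<mu> \<Otimes>\<^sub>M \<mu>)" by measurable
    show "integrable \<mu> (\<lambda>y. LINT x|\<mu>. norm (case (y, x) of (y, x) \<Rightarrow> Zc t (x - y) * g y * ch \<xi> x))"
      unfolding prod.case n using g by (simp add: integral_Z_shift[OF t])
    show "AE y in \<mu>. integrable \<mu> (\<lambda>x. case (y, x) of (y, x) \<Rightarrow> Zc t (x - y) * g y * ch \<xi> x)"
    proof (rule AE_I2)
      fix y
      have "integrable \<mu> (\<lambda>x. cmod (g y) * Z t (x - y))"
        using integrable_Z_shift[OF t] by simp
      then show "integrable \<mu> (\<lambda>x. case (y, x) of (y, x) \<Rightarrow> Zc t (x - y) * g y * ch \<xi> x)"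
        unfolding prod.case by (rule Bochner_Integration.integrable_bound) (auto simp: n)
    qed
  qed
qed

lemma conv_L2:
  assumes t: "t > 0" and f: "f \<in> L2 \<mu>"
  shows "conv t f \<in> L2 \<mu>" "L2_norm \<mu> (conv t f) \<le> L2_norm \<mu> f"
proof -
  interpret P: pair_sigma_finite \<mu> \<mu> ..
  note [measurable] = L2_borel[OF f]
  \<comment> \<open>The squared modulus as a complex function, so that
    \<open>conv_integrable_pair\<close> with the trivial character applies to it.\<close>
  define w where "w y = complex_of_real ((cmod (f y))\<^sup>2)" for y
  have w: "integrable \<mu> w" unfolding w_def by (rule integrable_of_real[OF L2_integrable[OF f]])
  define g where "g x = (LINT y|\<mu>. Z t (x - y) * (cmod (f y))\<^sup>2)" for x
  have int0: "integrable (\<mu> \<Otimes>\<^sub>M \<mu>) (\<lambda>(y, x). Z t (x - y) * (cmod (f y))\<^sup>2)"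
  proof -
    have "integrable (\<mu> \<Otimes>\<^sub>M \<mu>) (\<lambda>p. cmod (case p of (y, x) \<Rightarrow> Zc t (x - y) * w y * ch 0 x))"
      by (rule integrable_norm[OF conv_integrable_pair[OF t w]])
    moreover have "(\<lambda>p. cmod (case p of (y, x) \<Rightarrow> Zc t (x - y) * w y * ch 0 x))
        = (\<lambda>(y, x). Z t (x - y) * (cmod (f y))\<^sup>2)"
      using Z_nonneg[OF t] by (auto simp: fun_eq_iff norm_mult norm_power Zc_eq[OF t] w_def)
    ultimately show ?thesis by simp
  qed
  have g: "integrable \<mu> g"
    unfolding g_def by (rule P.integrable_snd[OF int0])
  have gi: "(LINT x|\<mu>. g x) = (L2_norm \<mu> f)\<^sup>2"
  proof -
    have "(LINT x|\<mu>. g x) = (LINT y|\<mu>. LINT x|\<mu>. Z t (x - y) * (cmod (f y))\<^sup>2)"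
      unfolding g_def by (rule P.Fubini_integral[OF int0])
    also have "\<dots> = (LINT y|\<mu>. (cmod (f y))\<^sup>2)" by (simp add: integral_Z_shift[OF t])
    finally show ?thesis by (simp add: L2_norm_power2)
  qed
  have le: "(cmod (conv t f x))\<^sup>2 \<le> g x" for x
    unfolding g_def by (rule conv_pointwise(3)[OF t f])
  show L2: "conv t f \<in> L2 \<mu>"
    by (rule L2_bound[OF _ g]) (simp_all add: le)
  have "(L2_norm \<mu> (conv t f))\<^sup>2 \<le> (L2_norm \<mu> f)\<^sup>2"
    unfolding gi[symmetric] L2_norm_power2[of _ "conv t f"]
    by (rule integral_mono[OF L2_integrable[OF L2] g le])
  then show "L2_norm \<mu> (conv t f) \<le> L2_norm \<mu> f" by (rule power2_le_imp_le) simp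
qed

lemma conv_L12:
  assumes t: "t > 0" and f: "f \<in> L12"
  shows "conv t f \<in> L12"
proof (rule L12I[OF _ conv_L2(1)[OF t L12_L2[OF f]]])
  interpret P: pair_sigma_finite \<mu> \<mu> ..
  show "integrable \<mu> (conv t f)"
    using P.integrable_snd[OF conv_integrable_pair[OF t L12_integrable[OF f], of 0]]
    by (simp add: conv_eq[abs_def])
qed

lemma FT_conv:
  assumes t: "t > 0" and f: "f \<in> L12"
  shows "FT (conv t f) \<xi> = of_real (phi t \<xi>) * FT f \<xi>"
proof -
  interpret P: pair_sigma_finite \<mu> \<mu> ..
  have "FT (conv t f) \<xi> = (LINT x|\<mu>. LINT y|\<mu>. Zc t (x - y) * f y * ch \<xi> x)"
    unfolding FT_def' conv_eq using conv_pointwise(1)[OF t L12_L2[OF f]] by simp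
  also have "\<dots> = (LINT y|\<mu>. LINT x|\<mu>. Zc t (x - y) * f y * ch \<xi> x)"
    by (rule P.Fubini_integral[OF conv_integrable_pair[OF t L12_integrable[OF f]]])
  also have "\<dots> = (LINT y|\<mu>. of_real (phi t \<xi>) * (f y * ch \<xi> y))"
  proof (rule Bochner_Integration.integral_cong)
    fix y
    have "(LINT x|\<mu>. Zc t (x - y) * f y * ch \<xi> x) = (LINT x|\<mu>. f y * ch \<xi> y * (Zc t (x - y) * ch \<xi> (x - y)))"
      by (intro Bochner_Integration.integral_cong) (simp_all add: ch_diff ac_simps)
    also have "\<dots> = f y * ch \<xi> y * (LINT x|\<mu>. Zc t (x - y) * ch \<xi> (x - y))" by simp
    also have "(LINT x|\<mu>. Zc t (x - y) * ch \<xi> (x - y)) = FT (Zc t) \<xi>"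
      unfolding FT_def' using integral_translate[of "\<lambda>x. Zc t x * ch \<xi> x" "- y"] by simp
    finally show "(LINT x|\<mu>. Zc t (x - y) * f y * ch \<xi> x) = of_real (phi t \<xi>) * (f y * ch \<xi> y)"
      by (simp add: FT_Zc[OF t] ac_simps)
  qed simp
  finally show ?thesis by (simp add: FT_def')
qed

lemma conv_diff:
  assumes t: "t > 0" and "f \<in> L2 \<mu>" "g \<in> L2 \<mu>"
  shows "conv t (\<lambda>x. f x - g x) x = conv t f x - conv t g x"
  using conv_pointwise(1)[OF t assms(2)] conv_pointwise(1)[OF t assms(3)]
  by (simp add: conv_eq right_diff_distrib)

lemma phi_mult_L2:
  assumes t: "t \<ge> 0" and f: "f \<in> L2 \<mu>"
  shows "(\<lambda>\<xi>. of_real (phi t \<xi>) * f \<xi>) \<in> L2 \<mu>"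
    and "L2_norm \<mu> (\<lambda>\<xi>. of_real (phi t \<xi>) * f \<xi>) \<le> L2_norm \<mu> f"
proof -
  note [measurable] = L2_borel[OF f]
  have le: "cmod (of_real (phi t \<xi>) * f \<xi>) \<le> cmod (f \<xi>)" for \<xi>
    using mult_right_mono[OF phi_le_1[OF t], of "cmod (f \<xi>)"] by (simp add: norm_mult)
  show L2: "(\<lambda>\<xi>. of_real (phi t \<xi>) * f \<xi>) \<in> L2 \<mu>"
    by (rule L2_bound[OF _ L2_integrable[OF f]]) (auto intro!: power_mono le)
  show "L2_norm \<mu> (\<lambda>\<xi>. of_real (phi t \<xi>) * f \<xi>) \<le> L2_norm \<mu> f"
    by (rule L2_norm_mono[OF f L2]) (simp add: le)
qed

text \<open>For integrable \<open>f\<close> this is \<open>FT_conv\<close>. Convolution and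
  multiplication by \<open>phi t\<close> are both contractions of \<open>L2\<close>, so the identity
  survives the limit.\<close>

lemma fourier_conv:
  assumes t: "t > 0" and f: "f \<in> L2 \<mu>"
  shows "AE \<xi> in \<mu>. fourier \<mu> ch (conv t f) \<xi> = of_real (phi t \<xi>) * fourier \<mu> ch f \<xi>"
proof (rule fourier_unique[OF conv_L2(1)[OF t f]])
  obtain F where F: "\<And>n::nat. F n \<in> L12" "(\<lambda>n. L2_norm \<mu> (\<lambda>x. F n x - f x)) \<longlonglongrightarrow> 0"
    "(\<lambda>n. L2_norm \<mu> (\<lambda>\<xi>. FT (F n) \<xi> - fourier \<mu> ch f \<xi>)) \<longlonglongrightarrow> 0"
    by (rule fourier_relE[OF fourier_rel_fourier[OF f]]) (rule that)
  have t0: "t \<ge> 0" using t by simp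
  show "fourier_rel (conv t f) (\<lambda>\<xi>. of_real (phi t \<xi>) * fourier \<mu> ch f \<xi>)"
  proof (rule fourier_relI[where F = "\<lambda>n. conv t (F n)"])
    show "(\<lambda>\<xi>. of_real (phi t \<xi>) * fourier \<mu> ch f \<xi>) \<in> L2 \<mu>"
      by (rule phi_mult_L2(1)[OF t0 fourier_L2[OF f]])
    show "conv t (F n) \<in> L12" for n by (rule conv_L12[OF t F(1)])
    show "(\<lambda>n. L2_norm \<mu> (\<lambda>x. conv t (F n) x - conv t f x)) \<longlonglongrightarrow> 0"
    proof (rule tendsto_sandwich[OF _ _ tendsto_const F(2)])
      have "L2_norm \<mu> (\<lambda>x. conv t (F n) x - conv t f x) \<le> L2_norm \<mu> (\<lambda>x. F n x - f x)" for n
      proof -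
        have "(\<lambda>x. conv t (F n) x - conv t f x) = conv t (\<lambda>x. F n x - f x)"
          by (rule ext) (rule conv_diff[OF t L12_L2[OF F(1)] f, symmetric])
        then show ?thesis using conv_L2(2)[OF t L2_diff[OF L12_L2[OF F(1)] f]] by simp
      qed
      then show "\<forall>\<^sub>F n in sequentially. L2_norm \<mu> (\<lambda>x. conv t (F n) x - conv t f x) \<le> L2_norm \<mu> (\<lambda>x. F n x - f x)"
        by simp
    qed simp
    show "(\<lambda>n. L2_norm \<mu> (\<lambda>\<xi>. FT (conv t (F n)) \<xi> - of_real (phi t \<xi>) * fourier \<mu> ch f \<xi>)) \<longlonglongrightarrow> 0"
    proof (rule tendsto_sandwich[OF _ _ tendsto_const F(3)])
      have "L2_norm \<mu> (\<lambda>\<xi>. FT (conv t (F n)) \<xi> - of_real (phi t \<xi>) * fourier \<mu> ch f \<xi>)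
          \<le> L2_norm \<mu> (\<lambda>\<xi>. FT (F n) \<xi> - fourier \<mu> ch f \<xi>)" for n
        using phi_mult_L2(2)[OF t0 L2_diff[OF FT_L2[OF F(1)] fourier_L2[OF f]]]
        by (simp add: FT_conv[OF t F(1)] right_diff_distrib)
      then show "\<forall>\<^sub>F n in sequentially. L2_norm \<mu> (\<lambda>\<xi>. FT (conv t (F n)) \<xi> - of_real (phi t \<xi>) * fourier \<mu> ch f \<xi>)
          \<le> L2_norm \<mu> (\<lambda>\<xi>. FT (F n) \<xi> - fourier \<mu> ch f \<xi>)" by simp
    qed simp
  qed
qed

lemma fourier_zero: "AE \<xi> in \<mu>. fourier \<mu> ch (\<lambda>x. 0) \<xi> = 0"
  using fourier_L12[OF L12_zero] by simp

lemma fourier_lincomb_eq: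
  assumes "f \<in> L2 \<mu>" "g \<in> L2 \<mu>"
    and "AE \<xi> in \<mu>. fourier \<mu> ch f \<xi> = F \<xi>" "AE \<xi> in \<mu>. fourier \<mu> ch g \<xi> = G \<xi>"
  shows "AE \<xi> in \<mu>. fourier \<mu> ch (\<lambda>x. c * f x + g x) \<xi> = c * F \<xi> + G \<xi>"
  using fourier_lincomb[OF assms(1,2), of c] assms(3,4) by eventually_elim simp

lemma Plancherel_eq:
  assumes f: "f \<in> L2 \<mu>" and "AE \<xi> in \<mu>. fourier \<mu> ch f \<xi> = F \<xi>" "F \<in> borel_measurable borel"
  shows "L2_norm \<mu> f = L2_norm \<mu> F"
proof -
  have "L2_norm \<mu> f = L2_norm \<mu> (\<lambda>\<xi>. fourier \<mu> ch f \<xi> - fourier \<mu> ch (\<lambda>x. 0) \<xi>)"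
    using Plancherel_diff[OF f L2_zero] by simp
  also have "\<dots> = L2_norm \<mu> F"
  proof (rule L2_norm_cong_AE)
    show "(\<lambda>\<xi>. fourier \<mu> ch f \<xi> - fourier \<mu> ch (\<lambda>x. 0) \<xi>) \<in> borel_measurable \<mu>"
      by (rule L2_measurable[OF L2_diff[OF fourier_L2[OF f] fourier_L2[OF L2_zero]]])
    show "AE \<xi> in \<mu>. fourier \<mu> ch f \<xi> - fourier \<mu> ch (\<lambda>x. 0) \<xi> = F \<xi>"
      using assms(2) fourier_zero by eventually_elim simp
  qed (use assms(3) in simp)
  finally show ?thesis .
qed

section \<open>The candidate solution and its Fourier multipliers\<close>

context
  fixes f :: "'a \<Rightarrow> complex"
  assumes f_Dom: "f \<in> Dom_D H \<mu> ch \<alpha>"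
begin

definition u :: "real \<Rightarrow> 'a \<Rightarrow> complex" where
  "u t = (if t = 0 then f else conv t f)"

text \<open>The candidate for the time derivative. With this choice the equation holds by
  definition, and the task is to show that it is the derivative of \<open>u\<close> and is
  continuous.\<close>

definition v :: "real \<Rightarrow> 'a \<Rightarrow> complex" where
  "v t x = - D_op H \<mu> ch \<alpha> (u t) x"

definition sym :: "'a \<Rightarrow> complex" where "sym \<xi> = of_real (gn \<xi> powr \<alpha>)"

lemma sym_measurable [measurable]: "sym \<in> borel_measurable borel"
  unfolding sym_def[abs_def] by measurable

lemma cmod_sym: "cmod (sym \<xi>) = gn \<xi> powr \<alpha>"
  by (simp add: sym_def)

abbreviation fhat :: "'a \<Rightarrow> complex" where "fhat \<equiv> fourier \<mu> ch f"

lemma f_L2: "f \<in> L2 \<mu>"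
  using f_Dom by (simp add: Dom_D_def)

lemma fhat_measurable [measurable]: "fhat \<in> borel_measurable borel"
  by (rule L2_borel[OF fourier_L2[OF f_L2]])

lemma sym_fhat_L2: "(\<lambda>\<xi>. sym \<xi> * fhat \<xi>) \<in> L2 \<mu>"
  using f_Dom by (simp add: Dom_D_def D_symbol_mult_def[abs_def] sym_def)

lemma u_L2: "t \<ge> 0 \<Longrightarrow> u t \<in> L2 \<mu>"
  using conv_L2(1)[OF _ f_L2, of t] f_L2 by (auto simp: u_def)

lemma fourier_u: "t \<ge> 0 \<Longrightarrow> AE \<xi> in \<mu>. fourier \<mu> ch (u t) \<xi> = of_real (phi t \<xi>) * fhat \<xi>"
  using fourier_conv[OF _ f_L2, of t] by (cases "t = 0") (auto simp: u_def)

lemma D_symbol_mult_u: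
  assumes t: "t \<ge> 0"
  shows "AE \<xi> in \<mu>. D_symbol_mult H \<mu> ch \<alpha> (u t) \<xi> = sym \<xi> * (of_real (phi t \<xi>) * fhat \<xi>)"
  using fourier_u[OF t] by eventually_elim (simp add: D_symbol_mult_def sym_def)

lemma D_symbol_mult_u_L2:
  assumes t: "t \<ge> 0"
  shows "D_symbol_mult H \<mu> ch \<alpha> (u t) \<in> L2 \<mu>"
proof (rule L2_cong_AE)
  have "(\<lambda>\<xi>. of_real (phi t \<xi>) * (sym \<xi> * fhat \<xi>)) \<in> L2 \<mu>"
    by (rule phi_mult_L2(1)[OF t sym_fhat_L2])
  then show "(\<lambda>\<xi>. sym \<xi> * (of_real (phi t \<xi>) * fhat \<xi>)) \<in> L2 \<mu>"
    by (simp add: ac_simps)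
  show "AE \<xi> in \<mu>. sym \<xi> * (of_real (phi t \<xi>) * fhat \<xi>) = D_symbol_mult H \<mu> ch \<alpha> (u t) \<xi>"
    using D_symbol_mult_u[OF t] by eventually_elim simp
  have [measurable]: "fourier \<mu> ch (u t) \<in> borel_measurable borel"
    by (rule L2_borel[OF fourier_L2[OF u_L2[OF t]]])
  show "D_symbol_mult H \<mu> ch \<alpha> (u t) \<in> borel_measurable \<mu>"
    unfolding D_symbol_mult_def[abs_def] by measurable
qed

lemma D_op_u_L2: "t \<ge> 0 \<Longrightarrow> D_op H \<mu> ch \<alpha> (u t) \<in> L2 \<mu>"
  unfolding D_op_def by (rule inv_fourier_L2[OF D_symbol_mult_u_L2])

lemma v_L2: "t \<ge> 0 \<Longrightarrow> v t \<in> L2 \<mu>"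
  unfolding v_def[abs_def] by (rule L2_uminus[OF D_op_u_L2])

lemma fourier_v:
  assumes t: "t \<ge> 0"
  shows "AE \<xi> in \<mu>. fourier \<mu> ch (v t) \<xi> = - (sym \<xi> * (of_real (phi t \<xi>) * fhat \<xi>))"
proof -
  have "AE \<xi> in \<mu>. fourier \<mu> ch (D_op H \<mu> ch \<alpha> (u t)) \<xi> = sym \<xi> * (of_real (phi t \<xi>) * fhat \<xi>)"
    using fourier_inv_fourier[OF D_symbol_mult_u_L2[OF t]] D_symbol_mult_u[OF t]
    unfolding D_op_def by eventually_elim simp
  from fourier_lincomb_eq[OF D_op_u_L2[OF t] L2_zero this fourier_zero, of "- 1"]
  show ?thesis by (simp add: v_def[abs_def])
qed

text \<open>Plancherel turns a limit in \<open>L2\<close> into dominated convergence for the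
  multipliers \<open>Q s\<close>. The majorant
  \<open>2 * gn \<xi> powr \<alpha> * cmod (fhat \<xi>)\<close> is square integrable because
  \<open>f\<close> is in the domain; the factor 2 covers both the difference quotient minus its
  limit and the difference of two values of \<open>phi\<close>.\<close>

lemma L2_tendsto_fhat:
  fixes t :: real
  assumes Q [measurable]: "\<And>s. s \<ge> 0 \<Longrightarrow> Q s \<in> borel_measurable borel"
    and g: "\<And>s. s \<ge> 0 \<Longrightarrow> s \<noteq> t \<Longrightarrow> g s \<in> L2 \<mu>"
    and gQ: "\<And>s. s \<ge> 0 \<Longrightarrow> s \<noteq> t \<Longrightarrow> AE \<xi> in \<mu>. fourier \<mu> ch (g s) \<xi> = of_real (Q s \<xi>) * fhat \<xi>"
    and dom: "\<And>s \<xi>. s \<ge> 0 \<Longrightarrow> s \<noteq> t \<Longrightarrow> \<bar>Q s \<xi>\<bar> \<le> 2 * gn \<xi> powr \<alpha>"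
    and lim: "\<And>\<xi>. ((\<lambda>s. Q s \<xi>) \<longlongrightarrow> 0) (at t within {0..})"
  shows "((\<lambda>s. L2_norm \<mu> (g s)) \<longlongrightarrow> 0) (at t within {0..})"
  unfolding tendsto_at_iff_sequentially
proof (intro allI impI)
  fix X :: "nat \<Rightarrow> real" assume X: "\<forall>i. X i \<in> {0..} - {t}" "X \<longlonglongrightarrow> t"
  have Xi: "X i \<ge> 0" "X i \<noteq> t" for i using X(1) by auto
  note [measurable] = Q[OF Xi(1)]
  have eq: "L2_norm \<mu> (g (X n)) = L2_norm \<mu> (\<lambda>\<xi>. of_real (Q (X n) \<xi>) * fhat \<xi>)" for n
    by (rule Plancherel_eq[OF g[OF Xi] gQ[OF Xi]]) measurable
  have "(\<lambda>n. L2_norm \<mu> (\<lambda>\<xi>. of_real (Q (X n) \<xi>) * fhat \<xi>)) \<longlonglongrightarrow> 0"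
  proof (rule L2_dominated_convergence)
    show "(\<lambda>\<xi>. 2 * (sym \<xi> * fhat \<xi>)) \<in> L2 \<mu>" by (rule L2_mult_left[OF sym_fhat_L2])
    show "AE \<xi> in \<mu>. cmod (of_real (Q (X n) \<xi>) * fhat \<xi>) \<le> cmod (2 * (sym \<xi> * fhat \<xi>))" for n
    proof (rule AE_I2)
      fix \<xi>
      have "\<bar>Q (X n) \<xi>\<bar> * cmod (fhat \<xi>) \<le> 2 * gn \<xi> powr \<alpha> * cmod (fhat \<xi>)"
        by (rule mult_right_mono[OF dom[OF Xi]]) simp
      then show "cmod (of_real (Q (X n) \<xi>) * fhat \<xi>) \<le> cmod (2 * (sym \<xi> * fhat \<xi>))"
        by (simp add: norm_mult cmod_sym mult.assoc)
    qed
    show "AE \<xi> in \<mu>. (\<lambda>n. of_real (Q (X n) \<xi>) * fhat \<xi>) \<longlonglongrightarrow> 0"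
    proof (rule AE_I2)
      fix \<xi>
      have "(\<lambda>n. Q (X n) \<xi>) \<longlonglongrightarrow> 0"
        using lim[of \<xi>] X unfolding tendsto_at_iff_sequentially comp_def by blast
      then have "(\<lambda>n. complex_of_real (Q (X n) \<xi>) * fhat \<xi>) \<longlonglongrightarrow> of_real 0 * fhat \<xi>"
        by (intro tendsto_intros)
      then show "(\<lambda>n. complex_of_real (Q (X n) \<xi>) * fhat \<xi>) \<longlonglongrightarrow> 0" by simp
    qed
  qed measurable
  then show "((\<lambda>s. L2_norm \<mu> (g s)) \<circ> X) \<longlonglongrightarrow> 0" by (simp add: comp_def eq)
qed

lemma phi_DERIV: "((\<lambda>s. phi s \<xi>) has_real_derivative - (gn \<xi> powr \<alpha>) * phi t \<xi>) (at t within A)"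
  unfolding phi_def by (auto intro!: derivative_eq_intros)

lemma u_derivative:
  assumes t: "t \<ge> 0"
  shows "((\<lambda>s. L2_norm \<mu> (\<lambda>x. (u s x - u t x) /\<^sub>R (s - t) - v t x)) \<longlongrightarrow> 0) (at t within {0..})"
proof (rule L2_tendsto_fhat[where Q = "\<lambda>s \<xi>. (phi s \<xi> - phi t \<xi>) / (s - t) + gn \<xi> powr \<alpha> * phi t \<xi>"])
  fix s :: real assume s: "s \<ge> 0"
  show "(\<lambda>\<xi>. (phi s \<xi> - phi t \<xi>) / (s - t) + gn \<xi> powr \<alpha> * phi t \<xi>) \<in> borel_measurable borel" by measurable
  assume st: "s \<noteq> t"
  define c where "c = complex_of_real (inverse (s - t))"
  \<comment> \<open>Brought into the nested form \<open>c * f + g\<close>, ending in zero, so that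
    linearity of the transform applies term by term.\<close>
  have eq: "(\<lambda>x. (u s x - u t x) /\<^sub>R (s - t) - v t x) = (\<lambda>x. c * u s x + (- c * u t x + (- 1 * v t x + 0)))"
    by (intro ext) (simp add: c_def scaleR_conv_of_real algebra_simps)
  have 1: "(\<lambda>x. - 1 * v t x + 0) \<in> L2 \<mu>" "(\<lambda>x. - c * u t x + (- 1 * v t x + 0)) \<in> L2 \<mu>"
    by (intro L2_add L2_mult_left u_L2 v_L2 t L2_zero)+
  show "(\<lambda>x. (u s x - u t x) /\<^sub>R (s - t) - v t x) \<in> L2 \<mu>"
    unfolding eq by (intro L2_add[OF _ 1(2)] L2_mult_left u_L2 s)
  have "AE \<xi> in \<mu>. fourier \<mu> ch (\<lambda>x. c * u s x + (- c * u t x + (- 1 * v t x + 0))) \<xi>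
      = c * (of_real (phi s \<xi>) * fhat \<xi>) + (- c * (of_real (phi t \<xi>) * fhat \<xi>) + (- 1 * (- (sym \<xi> * (of_real (phi t \<xi>) * fhat \<xi>))) + 0))"
    by (intro fourier_lincomb_eq fourier_u fourier_v fourier_zero u_L2 v_L2 1 s t L2_zero)
  then show "AE \<xi> in \<mu>. fourier \<mu> ch (\<lambda>x. (u s x - u t x) /\<^sub>R (s - t) - v t x) \<xi>
      = of_real ((phi s \<xi> - phi t \<xi>) / (s - t) + gn \<xi> powr \<alpha> * phi t \<xi>) * fhat \<xi>"
    unfolding eq
    by eventually_elim (simp add: c_def sym_def divide_inverse algebra_simps)
  fix \<xi>
  have g: "0 \<le> gn \<xi> powr \<alpha>" by simp
  have "\<bar>phi s \<xi> - phi t \<xi>\<bar> \<le> \<bar>s * gn \<xi> powr \<alpha> - t * gn \<xi> powr \<alpha>\<bar>"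
    unfolding phi_def mult_minus_left using s t by (intro exp_uminus_diff_le) auto
  also have "\<dots> = \<bar>s - t\<bar> * gn \<xi> powr \<alpha>"
    by (simp add: left_diff_distrib[symmetric] abs_mult)
  finally have "\<bar>(phi s \<xi> - phi t \<xi>) / (s - t)\<bar> \<le> gn \<xi> powr \<alpha>"
    using st by (simp add: abs_divide divide_le_eq mult.commute)
  moreover have "\<bar>gn \<xi> powr \<alpha> * phi t \<xi>\<bar> \<le> gn \<xi> powr \<alpha>"
    using mult_left_mono[OF phi_le_1[OF t] g, of \<xi>] by (simp add: abs_mult)
  ultimately show "\<bar>(phi s \<xi> - phi t \<xi>) / (s - t) + gn \<xi> powr \<alpha> * phi t \<xi>\<bar> \<le> 2 * gn \<xi> powr \<alpha>"
    by linarith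
next
  fix \<xi>
  have "((\<lambda>s. (phi s \<xi> - phi t \<xi>) / (s - t)) \<longlongrightarrow> - (gn \<xi> powr \<alpha>) * phi t \<xi>) (at t within {0..})"
    using phi_DERIV[of \<xi> t "{0..}"] by (simp add: has_field_derivative_iff)
  from tendsto_add[OF this tendsto_const[of "gn \<xi> powr \<alpha> * phi t \<xi>"]]
  show "((\<lambda>s. (phi s \<xi> - phi t \<xi>) / (s - t) + gn \<xi> powr \<alpha> * phi t \<xi>) \<longlongrightarrow> 0) (at t within {0..})" by simp
qed

lemma v_continuous:
  assumes t: "t \<ge> 0"
  shows "((\<lambda>s. L2_norm \<mu> (\<lambda>x. v s x - v t x)) \<longlongrightarrow> 0) (at t within {0..})"
proof (rule L2_tendsto_fhat[where Q = "\<lambda>s \<xi>. gn \<xi> powr \<alpha> * (phi t \<xi> - phi s \<xi>)"])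
  fix s :: real assume s: "s \<ge> 0"
  show "(\<lambda>\<xi>. gn \<xi> powr \<alpha> * (phi t \<xi> - phi s \<xi>)) \<in> borel_measurable borel" by measurable
  show "(\<lambda>x. v s x - v t x) \<in> L2 \<mu>" by (intro L2_diff v_L2 s t)
  have "AE \<xi> in \<mu>. fourier \<mu> ch (\<lambda>x. - 1 * v t x + v s x) \<xi>
      = - 1 * (- (sym \<xi> * (of_real (phi t \<xi>) * fhat \<xi>))) + - (sym \<xi> * (of_real (phi s \<xi>) * fhat \<xi>))"
    by (intro fourier_lincomb_eq fourier_v v_L2 s t)
  then show "AE \<xi> in \<mu>. fourier \<mu> ch (\<lambda>x. v s x - v t x) \<xi> = of_real (gn \<xi> powr \<alpha> * (phi t \<xi> - phi s \<xi>)) * fhat \<xi>"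
    by (simp add: sym_def algebra_simps)
  fix \<xi>
  have "\<bar>phi t \<xi> - phi s \<xi>\<bar> \<le> 2"
    using phi_le_1[OF s, of \<xi>] phi_le_1[OF t, of \<xi>] phi_pos(1)[of s \<xi>] phi_pos(1)[of t \<xi>] by linarith
  from mult_left_mono[OF this, of "gn \<xi> powr \<alpha>"]
  show "\<bar>gn \<xi> powr \<alpha> * (phi t \<xi> - phi s \<xi>)\<bar> \<le> 2 * gn \<xi> powr \<alpha>" by (simp add: abs_mult)
next
  fix \<xi>
  have "((\<lambda>s. phi s \<xi>) \<longlongrightarrow> phi t \<xi>) (at t within {0..})"
    using DERIV_continuous[OF phi_DERIV] by (simp add: continuous_within)
  then have "((\<lambda>s. gn \<xi> powr \<alpha> * (phi t \<xi> - phi s \<xi>)) \<longlongrightarrow> gn \<xi> powr \<alpha> * (phi t \<xi> - phi t \<xi>)) (at t within {0..})"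
    by (intro tendsto_intros)
  then show "((\<lambda>s. gn \<xi> powr \<alpha> * (phi t \<xi> - phi s \<xi>)) \<longlongrightarrow> 0) (at t within {0..})" by simp
qed

theorem classical_solution_u: "classical_solution H \<mu> ch \<alpha> f u"
  unfolding classical_solution_def
proof (intro exI[of _ v] conjI allI impI)
  show "C1_L2 \<mu> u v"
    unfolding C1_L2_def using u_L2 v_L2 u_derivative v_continuous by blast
  show "u t \<in> Dom_D H \<mu> ch \<alpha>" if "0 \<le> t" for t
    using u_L2[OF that] D_symbol_mult_u_L2[OF that] by (simp add: Dom_D_def)
  show "AE x in \<mu>. v t x + D_op H \<mu> ch \<alpha> (u t) x = 0" for t
    by (simp add: v_def)
  show "AE x in \<mu>. u 0 x = f x" by (simp add: u_def)
qed

end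

end

section \<open>The transition function\<close>

context selfdual_filtration
begin

lemma translate_vimage_coset: "(\<lambda>y. x + y) -` coset a n = coset (a - x) n"
  by (auto simp: algebra_simps)

text \<open>Averaging \<open>ch \<xi> (x - a)\<close> over \<open>\<xi> \<in> H (- n)\<close>
  produces the indicator of the coset. Character integrals thus determine a finite measure on
  cosets, hence on all Borel sets.\<close>

lemma measure_coset_eq_integral_ch:
  assumes fin: "finite_measure \<nu>" and sets [measurable_cong]: "sets \<nu> = sets borel"
  shows "complex_of_real (measure \<nu> (coset a n))
    = of_real (lam n) * (LINT \<xi>|\<mu>. indicator (H (- n)) \<xi> * (cnj (ch \<xi> a) * (LINT x|\<nu>. ch \<xi> x)))"
proof -
  interpret N: finite_measure \<nu> by fact
  interpret P: pair_sigma_finite \<mu> \<nu> ..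
  have space: "space \<nu> = UNIV" using sets_eq_imp_space_eq[OF sets] by simp
  define h where "h \<xi> x = indicator (H (- n)) \<xi> * ch \<xi> (x - a)" for \<xi> x
  have int: "integrable (\<mu> \<Otimes>\<^sub>M \<nu>) (\<lambda>(\<xi>, x). h \<xi> x)"
  proof (rule P.integrable_pair_bound)
    show "(\<lambda>(\<xi>, x). h \<xi> x) \<in> borel_measurable (\<mu> \<Otimes>\<^sub>M \<nu>)" unfolding h_def by measurable
    show "integrable \<mu> (indicator (H (- n)) :: 'a \<Rightarrow> real)"
      by (rule integrable_real_indicator) (auto simp: emeasure_H)
    show "integrable \<nu> (\<lambda>x. 1 :: real)" by simp
    show "cmod (case (\<xi>, x) of (\<xi>, x) \<Rightarrow> h \<xi> x) \<le> indicator (H (- n)) \<xi> * 1" for \<xi> x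
      by (simp add: h_def norm_mult indicator_def)
  qed
  have "(LINT \<xi>|\<mu>. indicator (H (- n)) \<xi> * (cnj (ch \<xi> a) * (LINT x|\<nu>. ch \<xi> x))) = (LINT \<xi>|\<mu>. LINT x|\<nu>. h \<xi> x)"
    by (simp add: h_def ch_diff mult.commute)
  also have "\<dots> = (LINT x|\<nu>. LINT \<xi>|\<mu>. h \<xi> x)"
    by (rule P.Fubini_integral[OF int, symmetric])
  also have "\<dots> = (LINT x|\<nu>. of_real (indicator (coset a n) x * lam (- n)))"
    unfolding h_def integral_H_ch_left right_ann_H
    by (intro Bochner_Integration.integral_cong) (auto simp: indicator_def)
  also have "\<dots> = of_real (measure \<nu> (coset a n) * lam (- n))"
    by (subst integral_complex_of_real) (simp add: space)
  finally have "of_real (lam n) * (LINT \<xi>|\<mu>. indicator (H (- n)) \<xi> * (cnj (ch \<xi> a) * (LINT x|\<nu>. ch \<xi> x)))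
      = complex_of_real ((lam n * lam (- n)) * measure \<nu> (coset a n))"
    by simp
  then show ?thesis by (simp add: lam_duality)
qed

lemma measure_eqI_ch:
  assumes fin: "finite_measure M" "finite_measure N" and sets: "sets M = sets borel" "sets N = sets borel"
    and eq: "\<And>\<xi>. (LINT x|M. ch \<xi> x) = (LINT x|N. ch \<xi> x)"
  shows "M = N"
proof (rule measure_eqI_Cosets[OF sets])
  interpret M: finite_measure M by fact
  interpret N: finite_measure N by fact
  show "emeasure M (coset a n) = emeasure N (coset a n)" for a n
  proof -
    have "complex_of_real (measure M (coset a n)) = of_real (measure N (coset a n))"
      unfolding measure_coset_eq_integral_ch[OF fin(1) sets(1)] measure_coset_eq_integral_ch[OF fin(2) sets(2)] eq ..
    then show ?thesis by (simp add: M.emeasure_eq_measure N.emeasure_eq_measure)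
  qed
  show "emeasure M (H n) \<noteq> \<infinity>" for n by simp
qed

end

context heat_semigroup
begin

section \<open>The convolution semigroup and its transition function\<close>

definition kap :: "real \<Rightarrow> 'a measure" where
  "kap t = (if t = 0 then return borel 0 else density \<mu> (\<lambda>x. ennreal (Z t x)))"

lemma sets_kap [simp, measurable_cong]: "sets (kap t) = sets borel"
  by (simp add: kap_def)

lemma space_kap [simp]: "space (kap t) = UNIV"
  using sets_eq_imp_space_eq[OF sets_kap] by simp

lemma prob_space_kap:
  assumes "t \<ge> 0"
  shows "prob_space (kap t)"
proof (cases "t = 0")
  case True
  then show ?thesis by (simp add: kap_def prob_space_return)
next
  case False
  then have t: "t > 0" using assms by simp
  have "(\<integral>\<^sup>+x. ennreal (Z t x) \<partial>\<mu>) = ennreal (LINT x|\<mu>. Z t x)"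
    by (rule nn_integral_eq_integral[OF Z_integrable[OF t]]) (simp add: Z_nonneg[OF t])
  then have "emeasure (density \<mu> (\<lambda>x. ennreal (Z t x))) UNIV = 1"
    by (subst emeasure_density) (simp_all add: Z_integral[OF t])
  then show ?thesis using False by (intro prob_spaceI) (simp add: kap_def)
qed

lemma finite_measure_kap: "t \<ge> 0 \<Longrightarrow> finite_measure (kap t)"
  using prob_space_kap by (simp add: prob_space_def)

lemma kap_ch: "t \<ge> 0 \<Longrightarrow> (LINT x|kap t. ch \<xi> x) = of_real (phi t \<xi>)"
proof (cases "t = 0")
  case True
  then show ?thesis by (simp add: kap_def integral_return)
next
  case False
  assume "t \<ge> 0"
  then have t: "t > 0" using False by simp
  have "(LINT x|kap t. ch \<xi> x) = (LINT x|\<mu>. Z t x *\<^sub>R ch \<xi> x)"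
    unfolding kap_def using False by (simp add: integral_density Z_nonneg[OF t])
  also have "\<dots> = FT (Zc t) \<xi>"
    by (simp add: FT_def' Zc_eq[OF t] scaleR_conv_of_real)
  finally show ?thesis by (simp add: FT_Zc[OF t])
qed

lemma measure_kap_coset:
  assumes t: "t \<ge> 0"
  shows "complex_of_real (measure (kap t) (coset a n))
    = of_real (lam n) * (LINT \<xi>|\<mu>. indicator (H (- n)) \<xi> * (cnj (ch \<xi> a) * of_real (phi t \<xi>)))"
  unfolding measure_coset_eq_integral_ch[OF finite_measure_kap[OF t] sets_kap] kap_ch[OF t] ..

text \<open>The inversion formula for the mass of a coset integrates over \<open>H (- n)\<close>
  only, so the indicator of that set is a majorant for all times, including the limit
  \<open>t = 0\<close>, where \<open>kap\<close> is a point mass.\<close>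

lemma measure_kap_tendsto:
  assumes X: "X \<longlonglongrightarrow> t" "\<And>n. X n \<ge> 0"
  shows "(\<lambda>i. measure (kap (X i)) (coset a n)) \<longlonglongrightarrow> measure (kap t) (coset a n)"
proof -
  have t: "t \<ge> 0" by (rule LIMSEQ_le_const[OF X(1)]) (use X(2) in auto)
  have "(\<lambda>i. LINT \<xi>|\<mu>. indicator (H (- n)) \<xi> * (cnj (ch \<xi> a) * of_real (phi (X i) \<xi>)))
      \<longlonglongrightarrow> (LINT \<xi>|\<mu>. indicator (H (- n)) \<xi> * (cnj (ch \<xi> a) * of_real (phi t \<xi>)))"
  proof (rule integral_dominated_convergence[where w = "indicator (H (- n))"])
    show "integrable \<mu> (indicator (H (- n)) :: 'a \<Rightarrow> real)"
      by (rule integrable_real_indicator) (auto simp: emeasure_H)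
    show "AE \<xi> in \<mu>. (\<lambda>i. indicator (H (- n)) \<xi> * (cnj (ch \<xi> a) * of_real (phi (X i) \<xi>)))
        \<longlonglongrightarrow> indicator (H (- n)) \<xi> * (cnj (ch \<xi> a) * of_real (phi t \<xi>))"
      unfolding phi_def by (intro AE_I2 tendsto_intros X)
    show "AE \<xi> in \<mu>. norm (indicator (H (- n)) \<xi> * (cnj (ch \<xi> a) * of_real (phi (X i) \<xi>))) \<le> indicator (H (- n)) \<xi>" for i
      using phi_le_1[OF X(2)] by (intro AE_I2) (simp add: norm_mult indicator_def)
  qed measurable
  then have "(\<lambda>i. complex_of_real (measure (kap (X i)) (coset a n))) \<longlonglongrightarrow> of_real (measure (kap t) (coset a n))"
    unfolding measure_kap_coset[OF t] measure_kap_coset[OF X(2)] by (intro tendsto_intros)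
  then show ?thesis by (simp only: tendsto_of_real_iff)
qed

text \<open>The mass of \<open>H n\<close> is the mean of \<open>phi t\<close> over
  \<open>H (- n)\<close>, where the norm is at most \<open>lam (- n)\<close> and the exponential
  lies above its tangent.\<close>

lemma measure_kap_H_ge:
  assumes t: "t \<ge> 0"
  shows "1 - t * lam (- n) powr \<alpha> \<le> measure (kap t) (H n)"
proof -
  have int: "integrable \<mu> (\<lambda>\<xi>. indicator (H (- n)) \<xi> * phi t \<xi>)"
    using integrable_indicator_phi[OF t, of 0 "- n"] by simp
  have intc: "integrable \<mu> (\<lambda>\<xi>. indicator (H (- n)) \<xi> * c :: real)" for c
    by (intro integrable_mult_left integrable_real_indicator) (auto simp: emeasure_H)
  have "complex_of_real (measure (kap t) (H n))
      = of_real (lam n) * (LINT \<xi>|\<mu>. indicator (H (- n)) \<xi> * (cnj (ch \<xi> 0) * of_real (phi t \<xi>)))"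
    using measure_kap_coset[OF t, of 0 n] by (simp only: coset_0)
  also have "\<dots> = of_real (lam n) * (LINT \<xi>|\<mu>. of_real (indicator (H (- n)) \<xi> * phi t \<xi>))"
    by (intro arg_cong2[where f = "(*)"] refl Bochner_Integration.integral_cong) (auto simp: indicator_def)
  also have "\<dots> = of_real (lam n * (LINT \<xi>|\<mu>. indicator (H (- n)) \<xi> * phi t \<xi>))"
    by (subst integral_complex_of_real) simp
  finally have eq: "measure (kap t) (H n) = lam n * (LINT \<xi>|\<mu>. indicator (H (- n)) \<xi> * phi t \<xi>)"
    by (simp only: of_real_eq_iff)
  have "lam n * (LINT \<xi>|\<mu>. indicator (H (- n)) \<xi> * (1 - t * lam (- n) powr \<alpha>)) \<le> measure (kap t) (H n)"
    unfolding eq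
  proof (rule mult_left_mono[OF integral_mono[OF intc int]])
    fix \<xi>
    show "indicator (H (- n)) \<xi> * (1 - t * lam (- n) powr \<alpha>) \<le> indicator (H (- n)) \<xi> * phi t \<xi>"
    proof (cases "\<xi> \<in> H (- n)")
      case True
      define y where "y = t * gn \<xi> powr \<alpha>"
      have "gn \<xi> powr \<alpha> \<le> lam (- n) powr \<alpha>"
        using gn_le[OF True] alpha_pos by (intro powr_mono2) auto
      then have "1 - t * lam (- n) powr \<alpha> \<le> 1 + - y"
        using mult_left_mono[OF _ t] by (simp add: y_def)
      also have "\<dots> \<le> exp (- y)" by (rule exp_ge_add_one_self)
      finally show ?thesis using True by (simp add: phi_def y_def)
    qed simp
  qed simp
  moreover have "lam n * (LINT \<xi>|\<mu>. indicator (H (- n)) \<xi> * (1 - t * lam (- n) powr \<alpha>))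
      = (lam n * lam (- n)) * (1 - t * lam (- n) powr \<alpha>)"
    by (simp add: mult.assoc)
  ultimately show ?thesis by (simp only: lam_duality mult_1)
qed

lemma distr_pair_ch:
  assumes M: "prob_space M" "sets M = sets borel" and N: "prob_space N" "sets N = sets borel"
  shows "(LINT z|distr (M \<Otimes>\<^sub>M N) borel (\<lambda>p. fst p + snd p). ch \<xi> z) = (LINT x|M. ch \<xi> x) * (LINT y|N. ch \<xi> y)"
proof -
  interpret M: prob_space M by fact
  interpret N: prob_space N by fact
  interpret P: pair_sigma_finite M N ..
  note [measurable_cong] = M(2) N(2)
  interpret P2: pair_prob_space M N ..
  have int: "integrable (M \<Otimes>\<^sub>M N) (\<lambda>(x, y). ch \<xi> x * ch \<xi> y)"
    by (rule P2.P.integrable_const_bound[of _ 1]) (auto simp: norm_mult)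
  have "(LINT z|distr (M \<Otimes>\<^sub>M N) borel (\<lambda>p. fst p + snd p). ch \<xi> z) = (LINT p|(M \<Otimes>\<^sub>M N). ch \<xi> (fst p + snd p))"
    by (rule integral_distr) measurable
  also have "\<dots> = (LINT p|(M \<Otimes>\<^sub>M N). (case p of (x, y) \<Rightarrow> ch \<xi> x * ch \<xi> y))"
    by (intro Bochner_Integration.integral_cong) (auto simp: ch_add)
  also have "\<dots> = (LINT x|M. LINT y|N. ch \<xi> x * ch \<xi> y)"
    using P.integral_fst'[OF int] by simp
  finally show ?thesis by simp
qed

text \<open>Character integrals turn convolution into multiplication, where the claim is
  \<open>phi_add\<close>.\<close>

lemma kap_convolution:
  assumes s: "s \<ge> 0" and t: "t \<ge> 0"
  shows "distr (kap s \<Otimes>\<^sub>M kap t) borel (\<lambda>p. fst p + snd p) = kap (s + t)"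
proof (rule measure_eqI_ch)
  interpret M: prob_space "kap s" by (rule prob_space_kap[OF s])
  interpret N: prob_space "kap t" by (rule prob_space_kap[OF t])
  interpret P: pair_prob_space "kap s" "kap t" ..
  show "finite_measure (distr (kap s \<Otimes>\<^sub>M kap t) borel (\<lambda>p. fst p + snd p))"
    by (rule P.finite_measure_distr) measurable
  show "finite_measure (kap (s + t))" using s t by (intro finite_measure_kap) simp
  show "(LINT x|distr (kap s \<Otimes>\<^sub>M kap t) borel (\<lambda>p. fst p + snd p). ch \<xi> x) = (LINT x|kap (s + t). ch \<xi> x)" for \<xi>
    using s t by (subst distr_pair_ch) (simp_all add: prob_space_kap kap_ch phi_add)
qed simp_all

definition K :: "real \<Rightarrow> 'a \<Rightarrow> 'a measure" where
  "K t x = distr (kap t) borel (\<lambda>y. x + y)"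

lemma sets_K [simp, measurable_cong]: "sets (K t x) = sets borel"
  by (simp add: K_def)

lemma prob_space_K: "t \<ge> 0 \<Longrightarrow> prob_space (K t x)"
  unfolding K_def by (intro prob_space.prob_space_distr prob_space_kap) simp_all

lemma K_0: "K 0 x = return borel x"
  by (simp add: K_def kap_def distr_return)

lemma emeasure_K: "B \<in> sets borel \<Longrightarrow> emeasure (K t x) B = emeasure (kap t) ((\<lambda>y. x + y) -` B)"
  unfolding K_def by (subst emeasure_distr) auto

lemma measure_K: "B \<in> sets borel \<Longrightarrow> measure (K t x) B = measure (kap t) ((\<lambda>y. x + y) -` B)"
  by (simp add: measure_def emeasure_K)

lemma measurable_K:
  assumes t: "t \<ge> 0"
  shows "K t \<in> borel \<rightarrow>\<^sub>M prob_algebra borel"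
proof (rule measurable_prob_algebraI[OF prob_space_K[OF t]])
  have "kap t \<in> space (subprob_algebra borel)"
    using prob_space_kap[OF t] by (simp add: space_subprob_algebra prob_space_imp_subprob_space)
  then have "(\<lambda>x. kap t) \<in> borel \<rightarrow>\<^sub>M subprob_algebra borel" by simp
  from measurable_distr2[OF _ this, of "\<lambda>x y. x + y" borel]
  show "K t \<in> borel \<rightarrow>\<^sub>M subprob_algebra borel"
    unfolding K_def[abs_def] by measurable
qed

lemma Chapman_Kolmogorov:
  assumes s: "s \<ge> 0" and t: "t \<ge> 0" and B: "B \<in> sets borel"
  shows "emeasure (K (s + t) x) B = (\<integral>\<^sup>+y. emeasure (K t y) B \<partial>K s x)"
proof -
  interpret N: prob_space "kap t" by (rule prob_space_kap[OF t])
  note [measurable] = B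
  have [measurable]: "(\<lambda>y. emeasure (K t y) B) \<in> borel_measurable borel"
    using measurable_compose[OF measurable_prob_algebraD[OF measurable_K[OF t]] measurable_emeasure_subprob_algebra[OF B]] .
  define E where "E = {z. x + z \<in> B}"
  have E [measurable]: "E \<in> sets borel" unfolding E_def by measurable
  have "emeasure (K (s + t) x) B = emeasure (kap (s + t)) E"
    by (simp add: emeasure_K[OF B] E_def vimage_def)
  also have "\<dots> = emeasure (kap s \<Otimes>\<^sub>M kap t) ((\<lambda>p. fst p + snd p) -` E)"
    unfolding kap_convolution[OF s t, symmetric]
    by (subst emeasure_distr) (auto simp: space_pair_measure)
  also have "\<dots> = (\<integral>\<^sup>+a. emeasure (kap t) (Pair a -` ((\<lambda>p. fst p + snd p) -` E)) \<partial>kap s)"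
  proof (rule N.emeasure_pair_measure_alt)
    have "(\<lambda>p. fst p + snd p) -` E \<inter> space (kap s \<Otimes>\<^sub>M kap t) \<in> sets (kap s \<Otimes>\<^sub>M kap t)" by measurable
    then show "(\<lambda>p. fst p + snd p) -` E \<in> sets (kap s \<Otimes>\<^sub>M kap t)" by (simp add: space_pair_measure)
  qed
  also have "\<dots> = (\<integral>\<^sup>+a. emeasure (K t (x + a)) B \<partial>kap s)"
    by (intro nn_integral_cong) (simp add: emeasure_K[OF B] E_def vimage_def add.assoc)
  also have "\<dots> = (\<integral>\<^sup>+y. emeasure (K t y) B \<partial>K s x)"
    unfolding K_def[of s] by (subst nn_integral_distr) auto
  finally show ?thesis .
qed

lemma transition_function_K: "transition_function K"
  unfolding transition_function_def
  using measurable_K K_0 Chapman_Kolmogorov by blast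

text \<open>For positive \<open>t\<close> the measure \<open>K t x\<close> has density
  \<open>Z t (y - x)\<close> in \<open>y\<close>, whereas the transition function is written with
  \<open>x - y\<close>; the kernel is even.\<close>

lemma measure_K_heat_transition:
  assumes t: "t \<ge> 0" and B: "B \<in> sets borel"
  shows "complex_of_real (measure (K t x) B) = heat_transition H \<mu> ch \<alpha> t x B"
proof (cases "t = 0")
  case True
  then show ?thesis using B by (simp add: K_0 heat_transition_def measure_return indicator_def)
next
  case False
  then have t: "t > 0" using t by simp
  interpret N: prob_space "kap t" by (rule prob_space_kap) (use t in simp)
  define E where "E = (\<lambda>y. x + y) -` B"
  have E [measurable]: "E \<in> sets borel"
    using measurable_sets[OF measurable_add_left B, of x] by (simp add: E_def)
  have intE: "integrable \<mu> (\<lambda>y. indicator E y * Z t y)"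
    by (rule Bochner_Integration.integrable_bound[OF Z_integrable[OF t]])
       (use E in \<open>auto simp: indicator_def\<close>)
  have "emeasure (kap t) E = (\<integral>\<^sup>+y. ennreal (Z t y) * indicator E y \<partial>\<mu>)"
    using False E by (simp add: kap_def emeasure_density)
  also have "\<dots> = (\<integral>\<^sup>+y. ennreal (indicator E y * Z t y) \<partial>\<mu>)"
    by (intro nn_integral_cong) (auto simp: indicator_def)
  also have "\<dots> = ennreal (LINT y|\<mu>. indicator E y * Z t y)"
    by (rule nn_integral_eq_integral[OF intE]) (simp add: Z_nonneg[OF t])
  finally have "measure (kap t) E = (LINT y|\<mu>. indicator E y * Z t y)"
    by (simp add: measure_def Z_nonneg[OF t])
  also have "\<dots> = (LINT y|\<mu>. indicator E (y + - x) * Z t (y + - x))"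
    by (intro integral_translate[of "\<lambda>y. indicator E y * Z t y", symmetric]) measurable
  also have "\<dots> = (LINT y|\<mu>. indicator B y * Z t (x - y))"
    by (intro Bochner_Integration.integral_cong) (simp_all add: E_def indicator_def Z_diff_commute[OF t, of x])
  finally have eq: "measure (K t x) B = (LINT y|\<mu>. indicator B y * Z t (x - y))"
    by (simp add: measure_K[OF B] E_def)
  have "heat_transition H \<mu> ch \<alpha> t x B = (LINT y|\<mu>. of_real (indicator B y * Z t (x - y)))"
    using False unfolding heat_transition_def set_lebesgue_integral_def Zc_def[symmetric]
    by (simp add: Zc_eq[OF t] scaleR_conv_of_real)
  then show ?thesis unfolding eq by (simp only: integral_complex_of_real)
qed

lemma heat_transition_translate:
  assumes t: "t \<ge> 0" and B: "B \<in> sets borel"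
  shows "heat_transition H \<mu> ch \<alpha> t (x + h) ((\<lambda>y. y + h) ` B) = heat_transition H \<mu> ch \<alpha> t x B"
proof -
  have im: "(\<lambda>y. y + h) ` B = (\<lambda>y. y - h) -` B"
  proof -
    have "y \<in> (\<lambda>y. y + h) ` B" if "y - h \<in> B" for y
      using that by (intro image_eqI[of _ _ "y - h"]) auto
    then show ?thesis by auto
  qed
  have "(\<lambda>y. y - h) \<in> borel \<rightarrow>\<^sub>M (borel :: 'a measure)" by measurable
  from measurable_sets[OF this B] have B': "(\<lambda>y. y + h) ` B \<in> sets borel" by (simp add: im)
  have "(\<lambda>y. x + h + y) -` ((\<lambda>y. y + h) ` B) = (\<lambda>y. x + y) -` B"
    unfolding im by (auto simp: algebra_simps)
  then show ?thesis
    unfolding measure_K_heat_transition[OF t B, symmetric] measure_K_heat_transition[OF t B', symmetric]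
    by (simp add: measure_K[OF B] measure_K[OF B'])
qed

end

section \<open>Paths with finitely many jumps along the dyadic numbers\<close>

definition dy :: "nat \<Rightarrow> nat \<Rightarrow> real" where "dy k i = real i / 2 ^ k"

definition dyadics :: "real set" where "dyadics = range (\<lambda>(k, i). dy k i)"

lemma dy_in_dyadics [simp]: "dy k i \<in> dyadics"
  by (auto simp: dyadics_def)

lemma dyadicsE:
  assumes "d \<in> dyadics"
  obtains k i where "d = dy k i"
  using assms by (auto simp: dyadics_def)

lemma dy_scale: "dy (k + j) (i * 2 ^ j) = dy k i"
  by (simp add: dy_def power_add)

lemma dy_double: "dy (Suc k) (2 * i) = dy k i"
  by (simp add: dy_def)

lemma dy_le_iff: "dy k i \<le> dy k j \<longleftrightarrow> i \<le> j"
  by (simp add: dy_def divide_le_cancel)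

lemma dy_nonneg: "0 \<le> dy k i"
  by (simp add: dy_def)

text \<open>Index of the first grid point of level \<open>k\<close> strictly to the right of a
  nonnegative \<open>t\<close>. Strictness makes the limits along these points right limits even if
  \<open>t\<close> is itself dyadic.\<close>

definition next_dy :: "nat \<Rightarrow> real \<Rightarrow> nat" where
  "next_dy k t = Suc (nat \<lfloor>t * 2 ^ k\<rfloor>)"

lemma next_dy_mono: "s \<le> t \<Longrightarrow> next_dy k s \<le> next_dy k t"
  unfolding next_dy_def by (intro Suc_le_mono[THEN iffD2] nat_mono floor_mono mult_right_mono) auto

lemma next_dy_bounds:
  assumes "t \<ge> 0"
  shows "t < dy k (next_dy k t)" "dy k (next_dy k t) \<le> t + 1 / 2 ^ k"
proof -
  have fl: "real (nat \<lfloor>t * 2 ^ k\<rfloor>) = of_int \<lfloor>t * 2 ^ k\<rfloor>"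
    using assms by (intro of_nat_nat) simp
  have "t * 2 ^ k < real (next_dy k t)" unfolding next_dy_def of_nat_Suc fl by linarith
  then show "t < dy k (next_dy k t)" by (simp add: dy_def pos_less_divide_eq)
  have "real (next_dy k t) \<le> t * 2 ^ k + 1" unfolding next_dy_def of_nat_Suc fl by linarith
  then have "dy k (next_dy k t) \<le> (t * 2 ^ k + 1) / 2 ^ k"
    unfolding dy_def by (rule divide_right_mono) simp
  then show "dy k (next_dy k t) \<le> t + 1 / 2 ^ k" by (simp add: add_divide_distrib)
qed

lemma next_dy_tendsto:
  assumes "t \<ge> 0"
  shows "(\<lambda>k. dy k (next_dy k t)) \<longlonglongrightarrow> t"
proof (rule tendsto_sandwich[OF _ _ tendsto_const])
  have "(\<lambda>k. t + (1 / 2) ^ k) \<longlonglongrightarrow> t + 0"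
    by (intro tendsto_intros LIMSEQ_realpow_zero) auto
  then show "(\<lambda>k. t + 1 / 2 ^ k) \<longlonglongrightarrow> t" by (simp add: power_one_over)
qed (use next_dy_bounds[OF assms] in \<open>auto intro!: always_eventually less_imp_le\<close>)

lemma dyadic_between:
  assumes "0 \<le> s" "s < t"
  shows "\<exists>d\<in>dyadics. s < d \<and> d < t"
proof -
  have "\<forall>\<^sub>F k in sequentially. dy k (next_dy k s) < t"
    by (rule order_tendstoD(2)[OF next_dy_tendsto[OF assms(1)] assms(2)])
  then obtain k where "dy k (next_dy k s) < t" by (auto simp: eventually_sequentially)
  then show ?thesis using next_dy_bounds(1)[OF assms(1)] by (intro bexI[of _ "dy k (next_dy k s)"]) auto
qed

lemma sum_lessThan_double: "(\<Sum>i<2 * (m::nat). f i) = (\<Sum>i<m. f (2 * i) + f (Suc (2 * i)) :: 'b::comm_monoid_add)"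
  by (induction m) (simp_all add: ac_simps)

context selfdual_filtration
begin

section \<open>Convergence modulo the subgroups\<close>

lemma tendsto_coset_iff: "(f \<longlongrightarrow> l) F \<longleftrightarrow> (\<forall>n. \<forall>\<^sub>F x in F. f x - l \<in> H n)"
proof
  assume "(f \<longlongrightarrow> l) F"
  then show "\<forall>n. \<forall>\<^sub>F x in F. f x - l \<in> H n"
    using topological_tendstoD[OF _ open_coset[of l]] by fastforce
next
  assume ev: "\<forall>n. \<forall>\<^sub>F x in F. f x - l \<in> H n"
  show "(f \<longlongrightarrow> l) F"
  proof (rule topological_tendstoI)
    fix U assume "open U" "l \<in> U"
    then obtain n where n: "coset l n \<subseteq> U" using coset_subset_open by blast
    have "\<forall>\<^sub>F x in F. f x - l \<in> H n" using ev by blast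
    then show "\<forall>\<^sub>F x in F. f x \<in> U"
      by (rule eventually_mono) (use n in auto)
  qed
qed

text \<open>Completeness from compactness: the compact cosets around \<open>x (N i)\<close> have the
  finite intersection property, witnessed by a late term of the sequence, and a common point is the
  limit.\<close>

lemma Cauchy_tendsto:
  fixes x :: "nat \<Rightarrow> 'a"
  assumes "\<And>n. \<exists>N. \<forall>k\<ge>N. x k - x N \<in> H n"
  shows "\<exists>l. x \<longlonglongrightarrow> l"
proof -
  have "\<forall>i::nat. \<exists>N. \<forall>k\<ge>N. x k - x N \<in> H (- int i)" using assms by blast
  from choice[OF this] obtain N where N: "\<And>i k. k \<ge> N i \<Longrightarrow> x k - x (N i) \<in> H (- int i)" by blast
  define C where "C j = (\<Inter>i\<le>j. coset (x (N i)) (- int i))" for j :: nat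
  have "(\<Inter>j. C j) \<noteq> {}"
  proof (rule nested_compact_nonempty)
    show "compact (C j)" for j
    proof -
      have "compact (coset (x (N 0)) (- int 0) \<inter> C j)"
        unfolding C_def by (intro compact_Int_closed[OF compact_coset] closed_INT ballI closed_coset)
      moreover have "coset (x (N 0)) (- int 0) \<inter> C j = C j" unfolding C_def by blast
      ultimately show ?thesis by simp
    qed
    show "C j \<noteq> {}" for j
    proof -
      have "N i \<le> Max (N ` {..j})" if "i \<le> j" for i using that by (intro Max_ge) auto
      then have "x (Max (N ` {..j})) \<in> C j" unfolding C_def using N by auto
      then show ?thesis by blast
    qed
    show "C (Suc j) \<subseteq> C j" for j unfolding C_def by fastforce
  qed
  then obtain l where l: "\<And>j. l \<in> C j" by blast
  have li: "l - x (N i) \<in> H (- int i)" for i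
    using l[of i] unfolding C_def by auto
  have "x \<longlonglongrightarrow> l"
    unfolding tendsto_coset_iff
  proof
    fix n
    define i where "i = nat (- n)"
    have sub: "H (- int i) \<subseteq> H n" by (intro H_mono) (simp add: i_def)
    have "x k - l \<in> H n" if "k \<ge> N i" for k
    proof -
      have "x k - l \<in> H (- int i)"
        using N[OF that] li[of i] H_diff_commute[of l "x (N i)"] by (blast intro: H_diff_trans)
      then show ?thesis using sub by blast
    qed
    then show "\<forall>\<^sub>F k in sequentially. x k - l \<in> H n" by (auto simp: eventually_sequentially)
  qed
  then show ?thesis by blast
qed

section \<open>Counting jumps over dyadic grids\<close>

definition jumps :: "int \<Rightarrow> (real \<Rightarrow> 'a) \<Rightarrow> nat \<Rightarrow> nat \<Rightarrow> nat" where
  "jumps n z k m = (\<Sum>i<m. of_bool (z (dy k (Suc i)) - z (dy k i) \<notin> H n))"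

text \<open>Stated for integer \<open>n\<close> and natural \<open>T\<close>, so that it is a
  countable conjunction and holds almost surely as soon as each instance does. Everything up to the
  regularity of the right limits then concerns a single path.\<close>

definition few_jumps :: "(real \<Rightarrow> 'a) \<Rightarrow> bool" where
  "few_jumps z \<longleftrightarrow> (\<forall>n. \<forall>T::nat. \<exists>N. \<forall>k. jumps n z k (T * 2 ^ k) \<le> N)"

lemma jumps_refine: "jumps n z k m \<le> jumps n z (Suc k) (2 * m)"
proof -
  have "jumps n z k m \<le> (\<Sum>i<m. of_bool (z (dy (Suc k) (Suc (2 * i))) - z (dy (Suc k) (2 * i)) \<notin> H n)
      + of_bool (z (dy (Suc k) (Suc (Suc (2 * i)))) - z (dy (Suc k) (Suc (2 * i))) \<notin> H n))"
    unfolding jumps_def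
  proof (rule sum_mono)
    fix i
    have eq: "dy k (Suc i) = dy (Suc k) (Suc (Suc (2 * i)))" "dy k i = dy (Suc k) (2 * i)"
      using dy_double[of k "Suc i"] dy_double[of k i] by simp_all
    show "of_bool (z (dy k (Suc i)) - z (dy k i) \<notin> H n)
        \<le> of_bool (z (dy (Suc k) (Suc (2 * i))) - z (dy (Suc k) (2 * i)) \<notin> H n)
        + (of_bool (z (dy (Suc k) (Suc (Suc (2 * i)))) - z (dy (Suc k) (Suc (2 * i))) \<notin> H n) :: nat)"
      unfolding eq using H_diff_trans[of "z (dy (Suc k) (Suc (Suc (2 * i))))" "z (dy (Suc k) (Suc (2 * i)))" n "z (dy (Suc k) (2 * i))"]
      by (auto simp: of_bool_def)
  qed
  also have "\<dots> = jumps n z (Suc k) (2 * m)"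
    unfolding jumps_def sum_lessThan_double ..
  finally show ?thesis .
qed

lemma jumps_refine': "jumps n z k m \<le> jumps n z (k + j) (m * 2 ^ j)"
proof (induction j)
  case (Suc j)
  also have "jumps n z (k + j) (m * 2 ^ j) \<le> jumps n z (Suc (k + j)) (2 * (m * 2 ^ j))"
    by (rule jumps_refine)
  finally show ?case by (simp add: ac_simps)
qed simp

lemma jumps_mono: "m \<le> m' \<Longrightarrow> jumps n z k m \<le> jumps n z k m'"
  unfolding jumps_def by (intro sum_mono2) auto

text \<open>Equal counts mean that every single increment in between lies in \<open>H n\<close>, and
  these add up.\<close>

lemma jumps_eq_imp:
  assumes "m \<le> m'" "jumps n z k m' = jumps n z k m"
  shows "z (dy k m') - z (dy k m) \<in> H n"
  using assms
proof (induction m' rule: dec_induct)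
  case (step j)
  have "jumps n z k m \<le> jumps n z k j" "jumps n z k j \<le> jumps n z k (Suc j)"
    using step.hyps by (auto intro: jumps_mono)
  then have eq: "jumps n z k j = jumps n z k m" "jumps n z k (Suc j) = jumps n z k j"
    using step.prems by auto
  from eq(2) have "z (dy k (Suc j)) - z (dy k j) \<in> H n" by (auto simp: jumps_def)
  then show ?case using step.IH[OF eq(1)] by (rule H_diff_trans)
qed simp

context
  fixes z :: "real \<Rightarrow> 'a"
  assumes few: "few_jumps z"
begin

text \<open>The jump count up to a dyadic time, over all grids that contain it. As a monotone
  function with values in the natural numbers it attains extrema, and where it is constant the path
  keeps its class modulo \<open>H n\<close>.\<close>

definition total_jumps :: "int \<Rightarrow> real \<Rightarrow> nat" where
  "total_jumps n d = Max {jumps n z k m | k m. dy k m = d}"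

lemma jumps_bounded: "\<exists>N. \<forall>k m. dy k m \<le> real T \<longrightarrow> jumps n z k m \<le> N"
proof -
  obtain N where N: "\<And>k. jumps n z k (T * 2 ^ k) \<le> N" using few unfolding few_jumps_def by blast
  have "jumps n z k m \<le> N" if "dy k m \<le> real T" for k m
  proof -
    have "real m \<le> real (T * 2 ^ k)" using that by (simp add: dy_def pos_divide_le_eq)
    then have "m \<le> T * 2 ^ k" by (simp only: of_nat_le_iff)
    then show ?thesis using N[of k] jumps_mono by (meson le_trans)
  qed
  then show ?thesis by blast
qed

lemma finite_jumps: "finite {jumps n z k m | k m. dy k m = d}"
proof -
  obtain T :: nat where T: "d \<le> real T" using real_arch_simple by blast
  obtain N where N: "\<And>k m. dy k m \<le> real T \<Longrightarrow> jumps n z k m \<le> N" using jumps_bounded by blast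
  have "{jumps n z k m | k m. dy k m = d} \<subseteq> {..N}" using N T by auto
  then show ?thesis by (rule finite_subset) simp
qed

lemma jumps_le_total: "jumps n z k m \<le> total_jumps n (dy k m)"
  unfolding total_jumps_def by (rule Max_ge[OF finite_jumps]) blast

lemma total_jumps_attained:
  assumes "d \<in> dyadics"
  shows "\<exists>k m. dy k m = d \<and> jumps n z k m = total_jumps n d"
proof -
  have "{jumps n z k m | k m. dy k m = d} \<noteq> {}" using assms by (auto elim!: dyadicsE)
  from Max_in[OF finite_jumps this] obtain k m where "total_jumps n d = jumps n z k m" "dy k m = d"
    unfolding total_jumps_def[symmetric] by blast
  then show ?thesis by metis
qed

lemma total_jumps_bounded: "\<exists>N. \<forall>d\<in>dyadics. d \<le> real T \<longrightarrow> total_jumps n d \<le> N"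
proof -
  obtain N where N: "\<And>k m. dy k m \<le> real T \<Longrightarrow> jumps n z k m \<le> N" using jumps_bounded by blast
  have "total_jumps n d \<le> N" if "d \<in> dyadics" "d \<le> real T" for d
    using total_jumps_attained[OF that(1), of n] N that(2) by force
  then show ?thesis by blast
qed

text \<open>Both times are placed on a common grid of level \<open>k + k'\<close>, refining one on
  which the count at \<open>d\<close> is maximal. If the totals agree, no jump is left between the
  two times on that grid.\<close>

lemma total_jumps_mono_strict:
  assumes "d \<in> dyadics" "d' \<in> dyadics" "d \<le> d'"
  shows "total_jumps n d \<le> total_jumps n d'"
    and "total_jumps n d = total_jumps n d' \<Longrightarrow> z d' - z d \<in> H n"
proof -
  obtain k m where km: "dy k m = d" "jumps n z k m = total_jumps n d"
    using total_jumps_attained[OF assms(1)] by blast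
  obtain k' m' where km': "d' = dy k' m'" using assms(2) by (rule dyadicsE)
  define K M M' where "K = k + k'" and "M = m * 2 ^ k'" and "M' = m' * 2 ^ k"
  have d: "dy K M = d" unfolding K_def M_def dy_scale by (rule km(1))
  have d': "dy K M' = d'" unfolding K_def M'_def km' by (subst add.commute) (rule dy_scale)
  have le: "M \<le> M'" using assms(3) unfolding d[symmetric] d'[symmetric] dy_le_iff .
  have 1: "total_jumps n d \<le> jumps n z K M" unfolding km(2)[symmetric] K_def M_def by (rule jumps_refine')
  have 2: "jumps n z K M \<le> jumps n z K M'" by (rule jumps_mono[OF le])
  have 3: "jumps n z K M' \<le> total_jumps n d'" using jumps_le_total[of n K M'] d' by simp
  show "total_jumps n d \<le> total_jumps n d'" using 1 2 3 by linarith
  assume "total_jumps n d = total_jumps n d'"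
  then have "jumps n z K M' = jumps n z K M" using 1 2 3 by linarith
  from jumps_eq_imp[OF le this] show "z d' - z d \<in> H n" unfolding d d' .
qed

lemma eq_total_jumps_imp:
  assumes "d \<in> dyadics" "d' \<in> dyadics" "total_jumps n d = total_jumps n d'"
  shows "z d' - z d \<in> H n"
proof (cases "d \<le> d'")
  case True
  then show ?thesis using total_jumps_mono_strict(2)[OF assms(1,2)] assms(3) by blast
next
  case False
  then have "z d - z d' \<in> H n" using total_jumps_mono_strict(2)[OF assms(2,1)] assms(3) by simp
  then show ?thesis by (simp add: H_diff_commute)
qed

text \<open>Among the dyadic times after \<open>t\<close> one with the least count is chosen.
  Between \<open>t\<close> and it the count cannot be smaller by minimality and cannot be larger by
  monotonicity.\<close>

lemma right_constant:
  assumes "t \<ge> 0"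
  shows "\<exists>d0\<in>dyadics. t < d0 \<and> (\<forall>d\<in>dyadics. t < d \<longrightarrow> d \<le> d0 \<longrightarrow> z d - z d0 \<in> H n)"
proof -
  obtain d1 where "d1 \<in> dyadics \<and> t < d1" using dyadic_between[of t "t + 1"] assms by auto
  from ex_has_least_nat[of "\<lambda>d. d \<in> dyadics \<and> t < d", OF this, of "total_jumps n"]
  obtain d0 where d0: "d0 \<in> dyadics" "t < d0"
    "\<And>d. d \<in> dyadics \<Longrightarrow> t < d \<Longrightarrow> total_jumps n d0 \<le> total_jumps n d" by blast
  have "z d - z d0 \<in> H n" if "d \<in> dyadics" "t < d" "d \<le> d0" for d
    using eq_total_jumps_imp[OF d0(1) that(1)] d0(3)[OF that(1,2)]
      total_jumps_mono_strict(1)[OF that(1) d0(1) that(3), of n] by simp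
  then show ?thesis using d0 by blast
qed

text \<open>The mirror image, with a greatest count before \<open>t\<close>. It exists because the
  counts are bounded on bounded time intervals.\<close>

lemma left_constant:
  assumes "t > 0"
  shows "\<exists>d0\<in>dyadics. d0 < t \<and> (\<forall>d\<in>dyadics. d0 \<le> d \<longrightarrow> d < t \<longrightarrow> z d - z d0 \<in> H n)"
proof -
  obtain T :: nat where T: "t \<le> real T" using real_arch_simple by blast
  obtain N where N: "\<And>d. d \<in> dyadics \<Longrightarrow> d \<le> real T \<Longrightarrow> total_jumps n d \<le> N"
    using total_jumps_bounded by blast
  have N': "\<forall>d. d \<in> dyadics \<and> d < t \<longrightarrow> total_jumps n d < Suc N"
    using N T by (auto simp: less_Suc_eq_le)
  obtain d1 where "d1 \<in> dyadics \<and> d1 < t" using dyadic_between[of 0 t] assms by auto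
  from ex_has_greatest_nat[of "\<lambda>d. d \<in> dyadics \<and> d < t", OF this N']
  obtain d0 where d0: "d0 \<in> dyadics" "d0 < t"
    "\<And>d. d \<in> dyadics \<Longrightarrow> d < t \<Longrightarrow> total_jumps n d \<le> total_jumps n d0" by blast
  have "z d - z d0 \<in> H n" if "d \<in> dyadics" "d0 \<le> d" "d < t" for d
    using eq_total_jumps_imp[OF d0(1) that(1)] d0(3)[OF that(1,3)]
      total_jumps_mono_strict(1)[OF d0(1) that(1,2), of n] by simp
  then show ?thesis using d0 by blast
qed

text \<open>Induction on the number of jumps modulo \<open>H 0\<close>: times with the same count
  have their values in one coset of \<open>H 0\<close>, so each value of the count enlarges the
  bounding subgroup at most once.\<close>

lemma dyadic_bounded: "\<exists>M. \<forall>d\<in>dyadics. d \<le> real T \<longrightarrow> z d \<in> H M"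
proof -
  have step: "\<exists>M. \<forall>d\<in>dyadics. d \<le> real T \<longrightarrow> total_jumps 0 d < j \<longrightarrow> z d \<in> H M" for j
  proof (induction j)
    case (Suc j)
    then obtain M where M: "\<And>d. d \<in> dyadics \<Longrightarrow> d \<le> real T \<Longrightarrow> total_jumps 0 d < j \<Longrightarrow> z d \<in> H M" by blast
    show ?case
    proof (cases "\<exists>d\<in>dyadics. total_jumps 0 d = j")
      case False
      then show ?thesis using M by (metis less_antisym)
    next
      case True
      then obtain d0 where d0: "d0 \<in> dyadics" "total_jumps 0 d0 = j" by blast
      obtain M0 where M0: "z d0 \<in> H M0" using ex_in_H by blast
      define M' where "M' = max M (max M0 0)"
      have sub: "H M \<subseteq> H M'" "H M0 \<subseteq> H M'" "H 0 \<subseteq> H M'" 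
        by (rule H_mono, simp add: M'_def)+
      have "z d \<in> H M'" if d: "d \<in> dyadics" "d \<le> real T" "total_jumps 0 d < Suc j" for d
      proof (cases "total_jumps 0 d = j")
        case True
        then have "z d - z d0 \<in> H 0" using eq_total_jumps_imp[OF d0(1) d(1)] d0(2) by simp
        then have "(z d - z d0) + z d0 \<in> H M'" using M0 sub by (intro H_add) auto
        then show ?thesis by simp
      next
        case False
        then show ?thesis using M[OF d(1,2)] d(3) sub by auto
      qed
      then show ?thesis by blast
    qed
  qed simp
  obtain N where N: "\<And>d. d \<in> dyadics \<Longrightarrow> d \<le> real T \<Longrightarrow> total_jumps 0 d \<le> N"
    using total_jumps_bounded by blast
  from step[of "Suc N"] N show ?thesis by (auto simp: less_Suc_eq_le)
qed

section \<open>Right limits and the regularity of the path they form\<close>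

definition right_lim :: "real \<Rightarrow> 'a" where
  "right_lim t = Lim sequentially (\<lambda>k. z (dy k (next_dy k t)))"

lemma right_lim_tendsto:
  assumes t: "t \<ge> 0"
  shows "(\<lambda>k. z (dy k (next_dy k t))) \<longlonglongrightarrow> right_lim t"
proof -
  have "\<exists>l. (\<lambda>k. z (dy k (next_dy k t))) \<longlonglongrightarrow> l"
  proof (rule Cauchy_tendsto)
    fix n
    obtain d0 where d0: "t < d0" "\<And>d. d \<in> dyadics \<Longrightarrow> t < d \<Longrightarrow> d \<le> d0 \<Longrightarrow> z d - z d0 \<in> H n"
      using right_constant[OF t] by blast
    have "\<forall>\<^sub>F k in sequentially. dy k (next_dy k t) < d0"
      by (rule order_tendstoD(2)[OF next_dy_tendsto[OF t] d0(1)])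
    then obtain N where N: "\<And>k. k \<ge> N \<Longrightarrow> dy k (next_dy k t) < d0" by (auto simp: eventually_sequentially)
    have z: "z (dy k (next_dy k t)) - z d0 \<in> H n" if "k \<ge> N" for k
      using N[OF that] next_dy_bounds(1)[OF t] by (intro d0(2)) auto
    have "z (dy k (next_dy k t)) - z (dy N (next_dy N t)) \<in> H n" if "k \<ge> N" for k
      using z[OF that] z[of N] H_diff_commute by (blast intro: H_diff_trans)
    then show "\<exists>N. \<forall>k\<ge>N. z (dy k (next_dy k t)) - z (dy N (next_dy N t)) \<in> H n" by blast
  qed
  then show ?thesis unfolding right_lim_def by (metis tendsto_Lim sequentially_bot)
qed

lemma right_lim_near:
  assumes t: "t \<ge> 0"
  shows "\<exists>d0. t < d0 \<and> (\<forall>d\<in>dyadics. t < d \<longrightarrow> d \<le> d0 \<longrightarrow> z d - right_lim t \<in> H n)"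
proof -
  obtain d0 where d0: "t < d0" "\<And>d. d \<in> dyadics \<Longrightarrow> t < d \<Longrightarrow> d \<le> d0 \<Longrightarrow> z d - z d0 \<in> H n"
    using right_constant[OF t] by blast
  have "\<forall>\<^sub>F k in sequentially. dy k (next_dy k t) < d0"
    by (rule order_tendstoD(2)[OF next_dy_tendsto[OF t] d0(1)])
  moreover have "\<forall>\<^sub>F k in sequentially. z (dy k (next_dy k t)) - right_lim t \<in> H n"
    using right_lim_tendsto[OF t] unfolding tendsto_coset_iff by blast
  ultimately have "\<forall>\<^sub>F k in sequentially. dy k (next_dy k t) < d0 \<and> z (dy k (next_dy k t)) - right_lim t \<in> H n"
    by (rule eventually_conj)
  then obtain k where k: "dy k (next_dy k t) < d0" "z (dy k (next_dy k t)) - right_lim t \<in> H n"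
    by (auto simp: eventually_sequentially)
  have zk: "z (dy k (next_dy k t)) - z d0 \<in> H n"
    using k(1) next_dy_bounds(1)[OF t] by (intro d0(2)) auto
  have "z d - right_lim t \<in> H n" if "d \<in> dyadics" "t < d" "d \<le> d0" for d
    using d0(2)[OF that] zk k(2) H_diff_commute by (blast intro: H_diff_trans)
  then show ?thesis using d0(1) by blast
qed

text \<open>Transfers a congruence from the dyadic times just after \<open>s\<close> to the right
  limit at \<open>s\<close>, through one dyadic time that is close enough for both. All three parts
  of regularity use it.\<close>

lemma right_lim_close:
  assumes "0 \<le> s" "s < b" and "\<And>d. d \<in> dyadics \<Longrightarrow> s < d \<Longrightarrow> d < b \<Longrightarrow> z d - c \<in> H n"
  shows "right_lim s - c \<in> H n"
proof -
  obtain d0 where d0: "s < d0" "\<And>d. d \<in> dyadics \<Longrightarrow> s < d \<Longrightarrow> d \<le> d0 \<Longrightarrow> z d - right_lim s \<in> H n"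
    using right_lim_near[OF assms(1)] by blast
  obtain d where d: "d \<in> dyadics" "s < d" "d < min d0 b"
    using dyadic_between[OF assms(1), of "min d0 b"] d0(1) assms(2) by auto
  have "z d - right_lim s \<in> H n" "z d - c \<in> H n" using d0(2) assms(3) d by auto
  then show ?thesis using H_diff_commute by (blast intro: H_diff_trans)
qed

lemma regular_path_right_lim: "regular_path H \<mu> right_lim"
  unfolding regular_path_def
proof (intro conjI allI impI)
  fix t :: real assume t: "0 \<le> t"
  show "(right_lim \<longlongrightarrow> right_lim t) (at_right t)"
    unfolding tendsto_coset_iff
  proof
    fix n
    obtain d0 where d0: "t < d0" "\<And>d. d \<in> dyadics \<Longrightarrow> t < d \<Longrightarrow> d \<le> d0 \<Longrightarrow> z d - right_lim t \<in> H n"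
      using right_lim_near[OF t] by blast
    have "right_lim s - right_lim t \<in> H n" if "t < s" "s < d0" for s
      by (rule right_lim_close[of s d0]) (use that t d0(2) in auto)
    then show "\<forall>\<^sub>F s in at_right t. right_lim s - right_lim t \<in> H n"
      using d0(1) by (auto simp: eventually_at_right_field)
  qed
next
  fix t :: real assume t: "0 < t"
  have near: "\<exists>d0 c. 0 \<le> d0 \<and> d0 < t \<and> (\<forall>s. d0 \<le> s \<longrightarrow> s < t \<longrightarrow> right_lim s - c \<in> H n)" for n
  proof -
    obtain d0 where d0: "d0 \<in> dyadics" "d0 < t" "\<And>d. d \<in> dyadics \<Longrightarrow> d0 \<le> d \<Longrightarrow> d < t \<Longrightarrow> z d - z d0 \<in> H n"
      using left_constant[OF t] by blast
    have "0 \<le> d0" using d0(1) dy_nonneg by (auto elim!: dyadicsE)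
    moreover have "right_lim s - z d0 \<in> H n" if "d0 \<le> s" "s < t" for s
      by (rule right_lim_close[of s t]) (use that \<open>0 \<le> d0\<close> d0(3) in auto)
    ultimately show ?thesis using d0(2) by blast
  qed
  \<comment> \<open>A sequence of values at times increasing from \<open>t / 2\<close> to
    \<open>t\<close>; it only serves to produce a candidate for the left limit.\<close>
  define x where "x k = right_lim (t - t / 2 ^ Suc k)" for k
  have x_lim: "(\<lambda>k. t - t / 2 ^ Suc k) \<longlonglongrightarrow> t"
  proof -
    have "(\<lambda>k. t - t * (1 / 2) ^ Suc k) \<longlonglongrightarrow> t - t * 0"
      by (intro tendsto_intros LIMSEQ_Suc LIMSEQ_realpow_zero) auto
    then show ?thesis by (simp add: power_one_over)
  qed
  have x_less: "t - t / 2 ^ Suc k < t" for k using t by simp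
  have "\<exists>l. x \<longlonglongrightarrow> l"
  proof (rule Cauchy_tendsto)
    fix n
    obtain d0 c where c: "d0 < t" "\<And>s. d0 \<le> s \<Longrightarrow> s < t \<Longrightarrow> right_lim s - c \<in> H n" using near by blast
    obtain N where N: "\<And>k. k \<ge> N \<Longrightarrow> d0 < t - t / 2 ^ Suc k"
      using order_tendstoD(1)[OF x_lim c(1)] unfolding eventually_sequentially by blast
    have xc: "x k - c \<in> H n" if "k \<ge> N" for k
      unfolding x_def by (intro c(2) x_less less_imp_le N that)
    have "x k - x N \<in> H n" if "k \<ge> N" for k
      using xc[OF that] xc[of N] H_diff_commute by (blast intro: H_diff_trans)
    then show "\<exists>N. \<forall>k\<ge>N. x k - x N \<in> H n" by blast
  qed
  then obtain l where l: "x \<longlonglongrightarrow> l" by blast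
  have "(right_lim \<longlongrightarrow> l) (at_left t)"
    unfolding tendsto_coset_iff
  proof
    fix n
    obtain d0 c where c: "d0 < t" "\<And>s. d0 \<le> s \<Longrightarrow> s < t \<Longrightarrow> right_lim s - c \<in> H n" using near by blast
    have "\<forall>\<^sub>F k in sequentially. d0 < t - t / 2 ^ Suc k \<and> x k - l \<in> H n"
      using order_tendstoD(1)[OF x_lim c(1)] l[unfolded tendsto_coset_iff] by (intro eventually_conj) auto
    then obtain k where k: "d0 < t - t / 2 ^ Suc k" "x k - l \<in> H n" by (auto simp: eventually_sequentially)
    have "x k - c \<in> H n" unfolding x_def by (intro c(2) x_less less_imp_le k)
    then have "right_lim s - l \<in> H n" if "d0 < s" "s < t" for s
      using c(2)[of s] that k(2) H_diff_commute[of "x k" c] by (meson H_diff_trans less_imp_le)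
    then show "\<forall>\<^sub>F s in at_left t. right_lim s - l \<in> H n"
      using c(1) by (auto simp: eventually_at_left_field)
  qed
  then show "\<exists>l. (right_lim \<longlongrightarrow> l) (at_left t)" by blast
next
  fix T :: real assume T: "0 \<le> T"
  \<comment> \<open>The right limit at \<open>t \<le> T\<close> is compared with dyadic times below
    \<open>t + 1\<close>, hence the margin.\<close>
  obtain N :: nat where N: "T + 1 \<le> real N" using real_arch_simple by blast
  obtain M where M: "\<And>d. d \<in> dyadics \<Longrightarrow> d \<le> real N \<Longrightarrow> z d \<in> H M" using dyadic_bounded by blast
  have "gnorm H \<mu> (right_lim t) \<le> lam M" if "t \<in> {0..T}" for t
  proof -
    have "right_lim t - 0 \<in> H M"
      by (rule right_lim_close[of t "t + 1"]) (use that N M in auto)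
    then show ?thesis using gn_le by simp
  qed
  then show "\<exists>C. \<forall>t\<in>{0..T}. gnorm H \<mu> (right_lim t) \<le> C" by blast
qed

end

end

section \<open>Dyadic random walks and their projective limit\<close>

context heat_semigroup
begin

text \<open>The increments of the walk on the grid of mesh \<open>1 / 2 ^ k\<close>, one coordinate
  for each step.\<close>

definition W :: "nat \<Rightarrow> (nat \<Rightarrow> 'a) measure" where
  "W k = PiM UNIV (\<lambda>_. kap (1 / 2 ^ k))"

lemma sets_W [measurable_cong, simp]: "sets (W k) = sets (PiM UNIV (\<lambda>_. borel))"
  unfolding W_def by (intro sets_PiM_cong) simp_all

lemma space_W [simp]: "space (W k) = UNIV"
  by (simp add: W_def space_PiM)

lemma prob_space_kap_dy: "prob_space (kap (1 / 2 ^ k))"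
  by (rule prob_space_kap) simp

lemma product_prob_space_W: "product_prob_space (\<lambda>_::nat. kap (1 / 2 ^ k))"
  by (rule product_prob_spaceI) (rule prob_space_kap_dy)

lemma prob_space_W: "prob_space (W k)"
  unfolding W_def by (rule prob_space_PiM) (rule prob_space_kap_dy)

lemma distr_W_component: "distr (W k) borel (\<lambda>w. w i) = kap (1 / 2 ^ k)"
proof -
  interpret product_prob_space "\<lambda>_::nat. kap (1 / 2 ^ k)" UNIV by (rule product_prob_space_W)
  have "distr (W k) borel (\<lambda>w. w i) = distr (W k) (kap (1 / 2 ^ k)) (\<lambda>w. w i)"
    by (rule distr_cong) simp_all
  then show ?thesis using PiM_component[of i] by (simp add: W_def)
qed

lemma indep_W: "prob_space.indep_vars (W k) (\<lambda>_. borel) (\<lambda>i w. w i) UNIV"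
proof -
  interpret prob_space "W k" by (rule prob_space_W)
  have "distr (W k) (PiM UNIV (\<lambda>_. borel)) (\<lambda>w. \<lambda>i\<in>UNIV. w i) = distr (W k) (W k) (\<lambda>w. w)"
    by (rule distr_cong) (simp_all add: restrict_def)
  also have "\<dots> = W k" by (simp add: distr_id)
  also have "\<dots> = PiM UNIV (\<lambda>i. distr (W k) borel (\<lambda>w. w i))"
    unfolding distr_W_component by (rule W_def)
  finally show ?thesis
    by (subst indep_vars_iff_distr_eq_PiM') simp_all
qed

lemma ch_sum: "ch \<xi> (\<Sum>j\<in>J. w j) = (\<Prod>j\<in>J. ch \<xi> (w j))"
  by (induction J rule: infinite_finite_induct) (simp_all add: ch_add)

lemma phi_power: "phi t \<xi> ^ n = phi (real n * t) \<xi>"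
  by (simp add: phi_def exp_of_nat_mult[symmetric])

lemma distr_W_sum:
  assumes "finite J"
  shows "distr (W k) borel (\<lambda>w. \<Sum>j\<in>J. w j) = kap (real (card J) / 2 ^ k)"
proof (rule measure_eqI_ch)
  interpret prob_space "W k" by (rule prob_space_W)
  show "finite_measure (distr (W k) borel (\<lambda>w. \<Sum>j\<in>J. w j))"
    by (rule finite_measure_distr) measurable
  show "finite_measure (kap (real (card J) / 2 ^ k))" by (rule finite_measure_kap) simp
  fix \<xi>
  have "indep_vars (\<lambda>_. borel) (\<lambda>j w. ch \<xi> (w j)) J"
    using indep_vars_compose2[OF indep_vars_subset[OF indep_W subset_UNIV], of J "\<lambda>_. ch \<xi>" "\<lambda>_. borel"] by simp
  moreover have "integrable (W k) (\<lambda>w. ch \<xi> (w j))" for j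
    by (rule integrable_const_bound[of _ 1]) auto
  ultimately have "(LINT w|W k. (\<Prod>j\<in>J. ch \<xi> (w j))) = (\<Prod>j\<in>J. (LINT w|W k. ch \<xi> (w j)))"
    by (rule indep_vars_lebesgue_integral[OF assms])
  also have "\<dots> = (\<Prod>j\<in>J. of_real (phi (1 / 2 ^ k) \<xi>))"
  proof (rule prod.cong)
    fix j
    have "(LINT w|W k. ch \<xi> (w j)) = (LINT x|distr (W k) borel (\<lambda>w. w j). ch \<xi> x)"
      by (rule integral_distr[symmetric]) measurable
    then show "(LINT w|W k. ch \<xi> (w j)) = of_real (phi (1 / 2 ^ k) \<xi>)"
      by (simp add: distr_W_component kap_ch)
  qed simp
  also have "\<dots> = of_real (phi (real (card J) / 2 ^ k) \<xi>)"
    by (simp add: phi_power flip: of_real_power)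
  finally have *: "(LINT w|W k. (\<Prod>j\<in>J. ch \<xi> (w j))) = of_real (phi (real (card J) / 2 ^ k) \<xi>)" .
  have "(LINT x|distr (W k) borel (\<lambda>w. \<Sum>j\<in>J. w j). ch \<xi> x) = (LINT w|W k. ch \<xi> (\<Sum>j\<in>J. w j))"
    by (rule integral_distr) measurable
  then show "(LINT x|distr (W k) borel (\<lambda>w. \<Sum>j\<in>J. w j). ch \<xi> x) = (LINT x|kap (real (card J) / 2 ^ k). ch \<xi> x)"
    by (simp add: ch_sum * kap_ch)
qed simp_all

lemma W_increment_indep:
  assumes "p \<le> q" and A: "A \<in> sets (PiM {..<p} (\<lambda>_. borel))" and C: "C \<in> sets borel"
  shows "measure (W k) {w. restrict w {..<p} \<in> A \<and> (\<Sum>j\<in>{p..<q}. w j) \<in> C}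
    = measure (W k) {w. restrict w {..<p} \<in> A} * measure (kap (real (q - p) / 2 ^ k)) C"
proof -
  interpret prob_space "W k" by (rule prob_space_W)
  have dj: "{..<p} \<inter> {p..<q} = {}" by auto
  have ind: "indep_var (PiM {..<p} (\<lambda>_. borel)) (\<lambda>w. restrict (\<lambda>i. w i) {..<p})
      (PiM {p..<q} (\<lambda>_. borel)) (\<lambda>w. restrict (\<lambda>i. w i) {p..<q})"
    by (rule indep_var_restrict[OF indep_W dj]) simp_all
  define B where "B = (\<lambda>r. \<Sum>j\<in>{p..<q}. r j) -` C \<inter> space (PiM {p..<q} (\<lambda>_. borel :: 'a measure))"
  have "(\<lambda>r. \<Sum>j\<in>{p..<q}. r j) \<in> PiM {p..<q} (\<lambda>_. borel) \<rightarrow>\<^sub>M (borel :: 'a measure)" by measurable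
  then have B: "B \<in> sets (PiM {p..<q} (\<lambda>_. borel))" unfolding B_def by (rule measurable_sets[OF _ C])
  have iff: "restrict w {p..<q} \<in> B \<longleftrightarrow> (\<Sum>j\<in>{p..<q}. w j) \<in> C" for w
    by (simp add: B_def space_PiM)
  have "measure (W k) ((\<lambda>w. \<Sum>j\<in>{p..<q}. w j) -` C) = measure (distr (W k) borel (\<lambda>w. \<Sum>j\<in>{p..<q}. w j)) C"
    using C by (subst measure_distr) simp_all
  also have "\<dots> = measure (kap (real (q - p) / 2 ^ k)) C" by (simp add: distr_W_sum)
  finally have law: "measure (W k) ((\<lambda>w. \<Sum>j\<in>{p..<q}. w j) -` C) = measure (kap (real (q - p) / 2 ^ k)) C" .
  show ?thesis using indep_varD[OF ind A B] law by (simp add: vimage_def iff)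
qed

text \<open>One step on the grid of level \<open>k\<close> is two steps on the grid of level
  \<open>k + 1\<close>. By the semigroup property the sums of increments with law
  \<open>W (Suc k)\<close> have law \<open>W k\<close>.\<close>

definition pair_sums :: "(nat \<Rightarrow> 'a) \<Rightarrow> nat \<Rightarrow> 'a" where
  "pair_sums w i = w (2 * i) + w (Suc (2 * i))"

lemma measurable_pair_sums [measurable]:
  "pair_sums \<in> PiM UNIV (\<lambda>_. borel) \<rightarrow>\<^sub>M PiM UNIV (\<lambda>_. borel)"
  unfolding pair_sums_def[abs_def] by (rule measurable_PiM_single') (auto simp: space_PiM)

lemma distr_pair_sums: "distr (W (Suc k)) (PiM UNIV (\<lambda>_. borel)) pair_sums = W k"
proof -
  interpret prob_space "W (Suc k)" by (rule prob_space_W)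
  let ?L = "\<lambda>i. {2 * i, Suc (2 * i)} :: nat set"
  have dj: "disjoint_family ?L" unfolding disjoint_family_on_def by auto
  have "indep_vars (\<lambda>i. PiM (?L i) (\<lambda>_. borel)) (\<lambda>i w. restrict (\<lambda>j. w j) (?L i)) UNIV"
    by (rule indep_vars_restrict[OF indep_W]) (use dj in auto)
  from indep_vars_compose2[OF this, of "\<lambda>i r. r (2 * i) + r (Suc (2 * i))" "\<lambda>_. borel"]
  have ind: "indep_vars (\<lambda>_. borel) (\<lambda>i w. pair_sums w i) UNIV"
    by (simp add: pair_sums_def)
  have law: "distr (W (Suc k)) borel (\<lambda>w. pair_sums w i) = kap (1 / 2 ^ k)" for i
    using distr_W_sum[of "?L i" "Suc k"] by (simp add: pair_sums_def)
  have "distr (W (Suc k)) (PiM UNIV (\<lambda>_. borel)) (\<lambda>w. \<lambda>i\<in>UNIV. pair_sums w i)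
      = PiM UNIV (\<lambda>i. distr (W (Suc k)) borel (\<lambda>w. pair_sums w i))"
    using ind by (rule indep_vars_iff_distr_eq_PiM'[THEN iffD1, rotated 2]) simp_all
  moreover have "(\<lambda>w. \<lambda>i\<in>UNIV. pair_sums w i) = pair_sums"
    by (simp add: restrict_def fun_eq_iff)
  ultimately show ?thesis by (simp only: law W_def[symmetric])
qed

lemma sum_pair_sums: "(\<Sum>j<m. pair_sums w j) = (\<Sum>j<2 * m. w j)"
  unfolding pair_sums_def sum_lessThan_double ..

section \<open>A measurable encoding of the group by real sequences\<close>

definition sep_sets :: "'a set set" where
  "sep_sets = (SOME F. countable F \<and> F \<subseteq> range (\<lambda>(a, n). coset a n) \<and> F \<noteq> {} \<and>
     (\<forall>x y. x \<noteq> y \<longrightarrow> (\<exists>C\<in>F. x \<in> C \<and> y \<notin> C)))"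

text \<open>For every \<open>n\<close> countably many cosets of \<open>H n\<close> cover the group.
  Distinct points differ modulo some \<open>H n\<close> and are then separated by the coset that
  contains one of them.\<close>

lemma sep_sets: "countable sep_sets" "sep_sets \<subseteq> range (\<lambda>(a, n). coset a n)" "sep_sets \<noteq> {}"
  "x \<noteq> y \<Longrightarrow> \<exists>C\<in>sep_sets. x \<in> C \<and> y \<notin> C"
proof -
  have "\<forall>n. \<exists>F. countable F \<and> F \<subseteq> range (\<lambda>a. coset a n) \<and> \<Union>F = UNIV"
    using countable_cosets_cover by blast
  from choice[OF this] obtain F where
    "\<forall>n. countable (F n) \<and> F n \<subseteq> range (\<lambda>a. coset a n) \<and> \<Union>(F n) = UNIV" ..
  then have F: "\<And>n. countable (F n)" "\<And>n. F n \<subseteq> range (\<lambda>a. coset a n)" "\<And>n. \<Union>(F n) = UNIV"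
    by simp_all
  define U where "U = (\<Union>n. F n)"
  have "\<exists>C\<in>U. x \<in> C \<and> y \<notin> C" if "x \<noteq> y" for x y
  proof -
    have "x - y \<noteq> 0" using that by simp
    then obtain n where n: "x - y \<notin> H n" using Inter_H by blast
    obtain C where C: "C \<in> F n" "x \<in> C" using F(3)[of n] by blast
    then obtain a where a: "C = coset a n" using F(2) by blast
    have "y \<notin> C"
    proof
      assume "y \<in> C"
      then have "x - a \<in> H n" "a - y \<in> H n" using C(2) H_diff_commute[of y a n] by (auto simp: a)
      then show False using n H_diff_trans by blast
    qed
    then show ?thesis using C by (auto simp: U_def)
  qed
  moreover have "countable U" unfolding U_def using F(1) by auto
  moreover have "U \<subseteq> range (\<lambda>(a, n). coset a n)" unfolding U_def using F(2) by fastforce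
  moreover have "U \<noteq> {}"
  proof -
    have "0 \<in> \<Union>(F 0)" using F(3) by simp
    then show ?thesis unfolding U_def by blast
  qed
  ultimately have "\<exists>F. countable F \<and> F \<subseteq> range (\<lambda>(a, n). coset a n) \<and> F \<noteq> {} \<and>
     (\<forall>x y. x \<noteq> y \<longrightarrow> (\<exists>C\<in>F. x \<in> C \<and> y \<notin> C))" by (intro exI[of _ U]) blast
  from someI_ex[OF this] have *: "countable sep_sets \<and> sep_sets \<subseteq> range (\<lambda>(a, n). coset a n) \<and> sep_sets \<noteq> {} \<and>
     (\<forall>x y. x \<noteq> y \<longrightarrow> (\<exists>C\<in>sep_sets. x \<in> C \<and> y \<notin> C))"
    unfolding sep_sets_def[symmetric] .
  show "countable sep_sets" "sep_sets \<subseteq> range (\<lambda>(a, n). coset a n)" "sep_sets \<noteq> {}" using * by simp_all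
  show "x \<noteq> y \<Longrightarrow> \<exists>C\<in>sep_sets. x \<in> C \<and> y \<notin> C" using * by blast
qed

text \<open>A continuous injection into a Polish space. Since the group is a countable union of compact sets,
  images of closed sets are Borel, so that the inverse is measurable.\<close>

definition code :: "'a \<Rightarrow> nat \<Rightarrow> real" where
  "code x i = indicator (from_nat_into sep_sets i) x"

definition decode :: "(nat \<Rightarrow> real) \<Rightarrow> 'a" where
  "decode y = (if y \<in> range code then inv code y else 0)"

lemma continuous_on_indicator_clopen:
  assumes "open C" "closed C"
  shows "continuous_on UNIV (indicator C :: 'a \<Rightarrow> real)"
proof (rule continuous_at_imp_continuous_on, rule ballI)
  fix x
  let ?V = "if x \<in> C then C else - C"
  have "open ?V" "x \<in> ?V" using assms by auto
  then have "\<forall>\<^sub>F y in nhds x. y \<in> ?V" by (rule eventually_nhds_in_open)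
  then have "\<forall>\<^sub>F y in nhds x. indicator C y = (indicator C x :: real)"
    by eventually_elim (auto split: if_splits)
  from isCont_cong[OF this] show "isCont (indicator C :: 'a \<Rightarrow> real) x" by simp
qed

lemma continuous_code: "continuous_on UNIV code"
proof -
  have "continuous_on UNIV (\<lambda>x. code x i)" for i
  proof -
    have "from_nat_into sep_sets i \<in> sep_sets" by (rule from_nat_into[OF sep_sets(3)])
    then obtain a n where "from_nat_into sep_sets i = coset a n" using sep_sets(2) by fastforce
    then show ?thesis unfolding code_def
      using continuous_on_indicator_clopen[OF open_coset closed_coset] by simp
  qed
  then show ?thesis by (rule continuous_on_coordinatewise_then_product)
qed

lemma inj_code: "inj code"
proof (rule injI, rule ccontr)
  fix x y assume eq: "code x = code y" and "x \<noteq> y"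
  then obtain C where C: "C \<in> sep_sets" "x \<in> C" "y \<notin> C" using sep_sets(4) by blast
  obtain i where "from_nat_into sep_sets i = C"
    using from_nat_into_surj[OF sep_sets(1) C(1)] by blast
  then have "code x i \<noteq> code y i" using C by (simp add: code_def)
  then show False using eq by simp
qed

lemma measurable_code [measurable]: "code \<in> borel \<rightarrow>\<^sub>M borel"
  by (rule borel_measurable_continuous_onI[OF continuous_code])

lemma decode_code [simp]: "decode (code x) = x"
  by (simp add: decode_def inv_f_f[OF inj_code])

lemma code_image_borel:
  assumes "compact A"
  shows "code ` A \<in> sets borel"
proof -
  have "continuous_on A code" by (rule continuous_on_subset[OF continuous_code]) simp
  then have "compact (code ` A)" using assms by (rule compact_continuous_image)
  then show ?thesis by (intro borel_closed compact_imp_closed)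
qed

lemma measurable_decode [measurable]: "decode \<in> borel \<rightarrow>\<^sub>M borel"
proof (rule borel_measurable_CosetsI)
  fix a n
  have "range code = (\<Union>n::int. code ` H n)" using Union_H by blast
  also have "\<dots> \<in> sets borel" by (intro sets.countable_UN') (auto intro: code_image_borel compact_H)
  finally have r: "range code \<in> sets borel" .
  \<comment> \<open>Sequences outside the range of \<open>code\<close> are decoded to the default
    value zero, so all of them are added when the coset contains zero.\<close>
  have "decode -` coset a n = code ` coset a n \<union> (if 0 \<in> coset a n then - range code else {})"
  proof (rule set_eqI)
    fix y
    show "y \<in> decode -` coset a n \<longleftrightarrow> y \<in> code ` coset a n \<union> (if 0 \<in> coset a n then - range code else {})"
    proof (cases "y \<in> range code")
      case True
      then obtain x where "y = code x" by blast
      then show ?thesis using inj_code by (auto simp del: mem_coset simp: inj_image_mem_iff)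
    next
      case False
      then show ?thesis by (auto simp: decode_def simp del: mem_coset)
    qed
  qed
  also have "\<dots> \<in> sets borel"
    using r by (intro sets.Un code_image_borel compact_coset) (auto simp: Compl_eq_Diff_UNIV)
  finally show "decode -` coset a n \<inter> space borel \<in> sets borel" by simp
qed

section \<open>Finite-dimensional laws and the projective limit\<close>

definition walk :: "nat \<Rightarrow> (nat \<Rightarrow> 'a) \<Rightarrow> real \<Rightarrow> 'a" where
  "walk k w t = (\<Sum>j<nat \<lfloor>t * 2 ^ k\<rfloor>. w j)"

lemma walk_dy: "walk k w (dy k i) = (\<Sum>j<i. w j)"
  by (simp add: walk_def dy_def)

lemma measurable_walk [measurable]: "(\<lambda>w. walk k w t) \<in> borel_measurable (PiM UNIV (\<lambda>_. borel))"
  unfolding walk_def by measurable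

text \<open>The joint law of the encoded walk of level \<open>k\<close>. It is meant for sets
  \<open>J\<close> of grid times, on which the floor in \<open>walk\<close> is exact and every finer
  grid gives the same law.\<close>

definition fdd :: "nat \<Rightarrow> real set \<Rightarrow> (real \<Rightarrow> nat \<Rightarrow> real) measure" where
  "fdd k J = distr (W k) (PiM J (\<lambda>_. borel)) (\<lambda>w. \<lambda>t\<in>J. code (walk k w t))"

lemma measurable_code_walk [measurable]:
  "(\<lambda>w. \<lambda>t\<in>J. code (walk k w t)) \<in> PiM UNIV (\<lambda>_. borel) \<rightarrow>\<^sub>M PiM J (\<lambda>_. borel)"
  by measurable

lemma dy_range_Suc: "range (dy k) \<subseteq> range (dy (Suc k))"
  using dy_double[of k] by (metis image_subset_iff rangeI)

lemma dy_range_mono: "k \<le> k' \<Longrightarrow> range (dy k) \<subseteq> range (dy k')"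
  by (rule lift_Suc_mono_le[of "\<lambda>k. range (dy k)"]) (rule dy_range_Suc)

lemma fdd_Suc:
  assumes "J \<subseteq> range (dy k)"
  shows "fdd (Suc k) J = fdd k J"
proof -
  have "fdd k J = distr (distr (W (Suc k)) (PiM UNIV (\<lambda>_. borel)) pair_sums) (PiM J (\<lambda>_. borel)) (\<lambda>w. \<lambda>t\<in>J. code (walk k w t))"
    unfolding fdd_def distr_pair_sums ..
  also have "\<dots> = distr (W (Suc k)) (PiM J (\<lambda>_. borel)) ((\<lambda>w. \<lambda>t\<in>J. code (walk k w t)) \<circ> pair_sums)"
    by (rule distr_distr) measurable
  also have "(\<lambda>w. \<lambda>t\<in>J. code (walk k w t)) \<circ> pair_sums = (\<lambda>w. \<lambda>t\<in>J. code (walk (Suc k) w t))"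
  proof (rule ext, simp only: comp_def, rule restrict_ext)
    fix w t assume "t \<in> J"
    then obtain i where i: "t = dy k i" using assms by blast
    have "walk (Suc k) w t = walk (Suc k) w (dy (Suc k) (2 * i))" by (simp only: i dy_double)
    then show "code (walk k (pair_sums w) t) = code (walk (Suc k) w t)"
      unfolding walk_dy by (simp add: i walk_dy sum_pair_sums)
  qed
  finally show ?thesis by (simp add: fdd_def restrict_def)
qed

lemma fdd_mono:
  assumes "k \<le> k'" "J \<subseteq> range (dy k)"
  shows "fdd k' J = fdd k J"
  using assms(1)
proof (induction k' rule: dec_induct)
  case (step m)
  have "J \<subseteq> range (dy m)" using assms(2) dy_range_mono[OF step.hyps(1)] by blast
  then show ?case using fdd_Suc step.IH by simp
qed simp

lemma finite_dyadics_level: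
  assumes "finite J" "J \<subseteq> dyadics"
  shows "\<exists>k. J \<subseteq> range (dy k)"
  using assms
proof (induction J rule: finite_induct)
  case (insert d J)
  then obtain k where k: "J \<subseteq> range (dy k)" by blast
  obtain l i where l: "d = dy l i" using insert.prems by (auto elim: dyadicsE)
  have "range (dy k) \<subseteq> range (dy (max k l))" "range (dy l) \<subseteq> range (dy (max k l))"
    by (rule dy_range_mono, simp)+
  then have "insert d J \<subseteq> range (dy (max k l))" using k l by blast
  then show ?case by blast
qed simp

text \<open>Any level whose grid contains \<open>J\<close> gives the same law by
  \<open>fdd_mono\<close>; the least one makes the family a function of \<open>J\<close>
  alone.\<close>

definition fdd_lim :: "real set \<Rightarrow> (real \<Rightarrow> nat \<Rightarrow> real) measure" where
  "fdd_lim J = fdd (LEAST k. J \<subseteq> range (dy k)) J"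

lemma fdd_lim_eq:
  assumes "J \<subseteq> range (dy k)"
  shows "fdd_lim J = fdd k J"
  unfolding fdd_lim_def
  by (rule fdd_mono[symmetric, OF Least_le[of "\<lambda>k. J \<subseteq> range (dy k)", OF assms] LeastI[of "\<lambda>k. J \<subseteq> range (dy k)", OF assms]])

lemma projective_fdd_lim: "projective_family dyadics fdd_lim (\<lambda>_. borel :: (nat \<Rightarrow> real) measure)"
proof (rule projective_family.intro)
  fix J L :: "real set" assume J: "J \<subseteq> L" "finite L" "L \<subseteq> dyadics"
  obtain k where k: "L \<subseteq> range (dy k)" using finite_dyadics_level J by blast
  have "distr (fdd k L) (PiM J (\<lambda>_. borel)) (\<lambda>f. restrict f J)
      = distr (W k) (PiM J (\<lambda>_. borel)) ((\<lambda>f. restrict f J) \<circ> (\<lambda>w. \<lambda>t\<in>L. code (walk k w t)))"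
    unfolding fdd_def by (rule distr_distr) (use J(1) in \<open>auto intro!: measurable_restrict_subset\<close>)
  also have "(\<lambda>f. restrict f J) \<circ> (\<lambda>w. \<lambda>t\<in>L. code (walk k w t)) = (\<lambda>w. \<lambda>t\<in>J. code (walk k w t))"
    using J(1) by (auto simp: fun_eq_iff restrict_def)
  finally show "fdd_lim J = distr (fdd_lim L) (PiM J (\<lambda>_. borel)) (\<lambda>f. restrict f J)"
    using fdd_lim_eq[OF k] fdd_lim_eq[of J k] k J(1) by (simp add: fdd_def restrict_def)
next
  fix J :: "real set" assume J: "finite J" "J \<subseteq> dyadics"
  show "prob_space (fdd_lim J)"
    unfolding fdd_lim_def fdd_def
    by (rule prob_space.prob_space_distr[OF prob_space_W]) measurable
qed

definition dyadic_law :: "(real \<Rightarrow> nat \<Rightarrow> real) measure" where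
  "dyadic_law = projective_family.lim dyadics fdd_lim (\<lambda>_. borel)"

lemma dyadic_law:
  shows prob_space_dyadic_law: "prob_space dyadic_law"
    and sets_dyadic_law [measurable_cong, simp]: "sets dyadic_law = sets (PiM dyadics (\<lambda>_. borel))"
    and emeasure_dyadic_law: "finite J \<Longrightarrow> J \<subseteq> dyadics \<Longrightarrow> X \<in> sets (PiM J (\<lambda>_. borel)) \<Longrightarrow>
      emeasure dyadic_law (prod_emb dyadics (\<lambda>_. borel) J X) = emeasure (fdd_lim J) X"
proof -
  interpret projective_family dyadics fdd_lim "\<lambda>_. borel :: (nat \<Rightarrow> real) measure"
    by (rule projective_fdd_lim)
  interpret polish_projective dyadics fdd_lim ..
  show "prob_space dyadic_law" unfolding dyadic_law_def by (rule P.prob_space_axioms)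
  show "sets dyadic_law = sets (PiM dyadics (\<lambda>_. borel))" by (simp add: dyadic_law_def)
  show "finite J \<Longrightarrow> J \<subseteq> dyadics \<Longrightarrow> X \<in> sets (PiM J (\<lambda>_. borel)) \<Longrightarrow>
      emeasure dyadic_law (prod_emb dyadics (\<lambda>_. borel) J X) = emeasure (fdd_lim J) X"
    unfolding dyadic_law_def by (rule emeasure_lim_emb)
qed

lemma space_dyadic_law: "space dyadic_law = space (PiM dyadics (\<lambda>_. borel))"
  by (rule sets_eq_imp_space_eq) simp

definition dyadic_process :: "real \<Rightarrow> (real \<Rightarrow> nat \<Rightarrow> real) \<Rightarrow> 'a" where
  "dyadic_process t \<omega> = (if t \<in> dyadics then decode (\<omega> t) else 0)"

lemma measurable_dyadic_process [measurable]: "dyadic_process t \<in> borel_measurable dyadic_law"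
  by (cases "t \<in> dyadics") (simp_all add: dyadic_process_def[abs_def])

text \<open>The bridge back to the walks: after decoding, the process on a grid of level
  \<open>k\<close> has the joint law of partial sums of independent increments, and probabilities
  are computed there.\<close>

lemma distr_dyadic_process:
  "distr dyadic_law (PiM {..m} (\<lambda>_. borel)) (\<lambda>\<omega>. \<lambda>i\<in>{..m}. dyadic_process (dy k i) \<omega>)
    = distr (W k) (PiM {..m} (\<lambda>_. borel)) (\<lambda>w. \<lambda>i\<in>{..m}. \<Sum>j<i. w j)"
proof -
  define J where "J = dy k ` {..m}"
  have J: "finite J" "J \<subseteq> dyadics" "J \<subseteq> range (dy k)" by (auto simp: J_def)
  have res: "(\<lambda>\<omega>. restrict \<omega> J) \<in> dyadic_law \<rightarrow>\<^sub>M PiM J (\<lambda>_. borel)"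
    unfolding measurable_cong_sets[OF sets_dyadic_law refl] by (rule measurable_restrict_subset[OF J(2)])
  have restr: "distr dyadic_law (PiM J (\<lambda>_. borel)) (\<lambda>\<omega>. restrict \<omega> J) = fdd k J"
  proof (rule measure_eqI)
    show "sets (distr dyadic_law (PiM J (\<lambda>_. borel)) (\<lambda>\<omega>. restrict \<omega> J)) = sets (fdd k J)"
      by (simp add: fdd_def)
    fix X assume "X \<in> sets (distr dyadic_law (PiM J (\<lambda>_. borel)) (\<lambda>\<omega>. restrict \<omega> J))"
    then have X: "X \<in> sets (PiM J (\<lambda>_. borel))" by simp
    have "emeasure (distr dyadic_law (PiM J (\<lambda>_. borel)) (\<lambda>\<omega>. restrict \<omega> J)) X
        = emeasure dyadic_law ((\<lambda>\<omega>. restrict \<omega> J) -` X \<inter> space dyadic_law)"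
      by (rule emeasure_distr[OF res X])
    also have "(\<lambda>\<omega>. restrict \<omega> J) -` X \<inter> space dyadic_law = prod_emb dyadics (\<lambda>_. borel) J X"
      unfolding prod_emb_def space_dyadic_law space_PiM ..
    finally show "emeasure (distr dyadic_law (PiM J (\<lambda>_. borel)) (\<lambda>\<omega>. restrict \<omega> J)) X = emeasure (fdd k J) X"
      using emeasure_dyadic_law[OF J(1,2) X] fdd_lim_eq[OF J(3)] by (simp add: restrict_def)
  qed
  define G where "G f = (\<lambda>i\<in>{..m}. decode (f (dy k i)))" for f :: "real \<Rightarrow> nat \<Rightarrow> real"
  have comp: "(\<lambda>f. f (dy k i)) \<in> PiM J (\<lambda>_. borel) \<rightarrow>\<^sub>M borel" if "i \<in> {..m}" for i
    using that by (intro measurable_component_singleton) (auto simp: J_def)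
  have G: "G \<in> PiM J (\<lambda>_. borel) \<rightarrow>\<^sub>M PiM {..m} (\<lambda>_. borel)"
    unfolding G_def[abs_def] by (intro measurable_restrict measurable_compose[OF comp measurable_decode])
  have "distr dyadic_law (PiM {..m} (\<lambda>_. borel)) (\<lambda>\<omega>. \<lambda>i\<in>{..m}. dyadic_process (dy k i) \<omega>)
      = distr dyadic_law (PiM {..m} (\<lambda>_. borel)) (G \<circ> (\<lambda>\<omega>. restrict \<omega> J))"
    by (intro distr_cong refl) (auto simp: G_def dyadic_process_def J_def restrict_def fun_eq_iff)
  also have "\<dots> = distr (fdd k J) (PiM {..m} (\<lambda>_. borel)) G"
    unfolding restr[symmetric] by (rule distr_distr[symmetric, OF G res])
  also have "\<dots> = distr (W k) (PiM {..m} (\<lambda>_. borel)) (G \<circ> (\<lambda>w. \<lambda>t\<in>J. code (walk k w t)))"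
    unfolding fdd_def by (rule distr_distr[OF G]) measurable
  also have "G \<circ> (\<lambda>w. \<lambda>t\<in>J. code (walk k w t)) = (\<lambda>w. \<lambda>i\<in>{..m}. \<Sum>j<i. w j)"
    by (auto simp: G_def J_def fun_eq_iff restrict_def walk_dy)
  finally show ?thesis .
qed

end

section \<open>The right-continuous version\<close>

text \<open>Dominated convergence for indicators. It carries probabilities from grid times over to
  the limit process.\<close>

lemma (in prob_space) prob_tendsto_of_AE_eventually:
  assumes Q: "\<And>k. {\<omega> \<in> space M. Q k \<omega>} \<in> events" and R: "{\<omega> \<in> space M. R \<omega>} \<in> events"
    and ev: "AE \<omega> in M. \<forall>\<^sub>F k in sequentially. Q k \<omega> \<longleftrightarrow> R \<omega>"
  shows "(\<lambda>k. prob {\<omega> \<in> space M. Q k \<omega>}) \<longlonglongrightarrow> prob {\<omega> \<in> space M. R \<omega>}"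
proof -
  let ?f = "\<lambda>k. indicator {\<omega> \<in> space M. Q k \<omega>} :: 'a \<Rightarrow> real"
  let ?g = "indicator {\<omega> \<in> space M. R \<omega>} :: 'a \<Rightarrow> real"
  have "(\<lambda>k. LINT \<omega>|M. ?f k \<omega>) \<longlonglongrightarrow> (LINT \<omega>|M. ?g \<omega>)"
  proof (rule integral_dominated_convergence[where w = "\<lambda>_. 1"])
    show "AE \<omega> in M. (\<lambda>k. ?f k \<omega>) \<longlonglongrightarrow> ?g \<omega>"
      using ev
    proof eventually_elim
      fix \<omega> assume "\<forall>\<^sub>F k in sequentially. Q k \<omega> \<longleftrightarrow> R \<omega>"
      then have "\<forall>\<^sub>F k in sequentially. ?f k \<omega> = ?g \<omega>"
        by eventually_elim (simp add: indicator_def)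
      then show "(\<lambda>k. ?f k \<omega>) \<longlonglongrightarrow> ?g \<omega>" by (rule tendsto_eventually)
    qed
  qed (use Q R in \<open>auto simp: indicator_def\<close>)
  then show ?thesis using Q R by simp
qed

context heat_semigroup
begin

abbreviation P0 :: "(real \<Rightarrow> nat \<Rightarrow> real) measure" where "P0 \<equiv> dyadic_law"

abbreviation zz :: "(real \<Rightarrow> nat \<Rightarrow> real) \<Rightarrow> real \<Rightarrow> 'a" where
  "zz \<omega> \<equiv> (\<lambda>t. dyadic_process t \<omega>)"

lemma measure_grid:
  assumes X: "X \<in> sets (PiM {..m} (\<lambda>_. borel))"
  shows "measure P0 {\<omega> \<in> space P0. (\<lambda>i\<in>{..m}. zz \<omega> (dy k i)) \<in> X}
    = measure (W k) {w. (\<lambda>i\<in>{..m}. \<Sum>j<i. w j) \<in> X}"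
proof -
  have "measure P0 {\<omega> \<in> space P0. (\<lambda>i\<in>{..m}. zz \<omega> (dy k i)) \<in> X}
      = measure (distr P0 (PiM {..m} (\<lambda>_. borel)) (\<lambda>\<omega>. \<lambda>i\<in>{..m}. zz \<omega> (dy k i))) X"
    using X by (subst measure_distr) (auto intro!: arg_cong[where f = "measure P0"])
  also have "\<dots> = measure (W k) {w. (\<lambda>i\<in>{..m}. \<Sum>j<i. w j) \<in> X}"
    unfolding distr_dyadic_process
    using X by (subst measure_distr) (auto intro!: arg_cong[where f = "measure (W k)"] simp: vimage_def)
  finally show ?thesis .
qed

text \<open>The values at grid times up to \<open>p\<close> are functions of the first
  \<open>p\<close> increments, and the difference between \<open>p\<close> and \<open>q\<close> is a
  sum of later ones. Translated to \<open>W k\<close>, the claim is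
  \<open>W_increment_indep\<close>.\<close>

lemma grid_increment_indep:
  fixes R :: "'r set"
  assumes R: "finite R" "\<And>r. r \<in> R \<Longrightarrow> i r \<le> p" and D: "\<And>r. r \<in> R \<Longrightarrow> D r \<in> sets borel"
    and pq: "p \<le> q" and C: "C \<in> sets borel"
  shows "measure P0 {\<omega> \<in> space P0. (\<forall>r\<in>R. zz \<omega> (dy k (i r)) \<in> D r) \<and> zz \<omega> (dy k q) - zz \<omega> (dy k p) \<in> C}
    = measure P0 {\<omega> \<in> space P0. \<forall>r\<in>R. zz \<omega> (dy k (i r)) \<in> D r} * measure (kap (real (q - p) / 2 ^ k)) C"
proof -
  let ?P = "PiM {..q} (\<lambda>_. borel :: 'a measure)"
  have comp: "(\<lambda>f. f j) \<in> ?P \<rightarrow>\<^sub>M borel" if "j \<le> q" for j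
    using that by (intro measurable_component_singleton) simp
  define X1 where "X1 = {f \<in> space ?P. \<forall>r\<in>R. f (i r) \<in> D r}"
  define X2 where "X2 = {f \<in> space ?P. f q - f p \<in> C}"
  have X1: "X1 \<in> sets ?P"
    unfolding X1_def
  proof (rule sets.sets_Collect_finite_All[OF _ R(1)])
    show "{f \<in> space ?P. f (i r) \<in> D r} \<in> sets ?P" if "r \<in> R" for r
      using measurable_sets[OF comp D[OF that], of "i r"] R(2)[OF that] pq
      by (simp add: vimage_def Int_def conj_commute)
  qed
  have "(\<lambda>f. f q - f p) \<in> ?P \<rightarrow>\<^sub>M borel"
    by (intro borel_measurable_diff' comp pq order_refl)
  from measurable_sets[OF this C] have X2: "X2 \<in> sets ?P"
    by (simp add: X2_def vimage_def Int_def conj_commute)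
  have sp: "(\<lambda>i\<in>{..q}. f i) \<in> space ?P" for f :: "nat \<Rightarrow> 'a" by (simp add: space_PiM)
  have iq: "i r \<le> q" if "r \<in> R" for r using R(2)[OF that] pq by simp
  have z1: "(\<lambda>i\<in>{..q}. f i) \<in> X1 \<longleftrightarrow> (\<forall>r\<in>R. f (i r) \<in> D r)" for f
    using sp[of f] iq by (auto simp: X1_def)
  have z2: "(\<lambda>i\<in>{..q}. f i) \<in> X2 \<longleftrightarrow> f q - f p \<in> C" for f
    using sp[of f] pq by (auto simp: X2_def)
  let ?Q = "PiM {..<p} (\<lambda>_. borel :: 'a measure)"
  define A where "A = {g \<in> space ?Q. \<forall>r\<in>R. (\<Sum>j<i r. g j) \<in> D r}"
  have A: "A \<in> sets ?Q"
    unfolding A_def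
  proof (rule sets.sets_Collect_finite_All[OF _ R(1)])
    fix r assume r: "r \<in> R"
    have "(\<lambda>g. \<Sum>j<i r. g j) \<in> ?Q \<rightarrow>\<^sub>M borel"
      using R(2)[OF r] by (intro borel_measurable_sum measurable_component_singleton) auto
    from measurable_sets[OF this D[OF r]] show "{g \<in> space ?Q. (\<Sum>j<i r. g j) \<in> D r} \<in> sets ?Q"
      by (simp add: vimage_def Int_def conj_commute)
  qed
  have wA: "restrict w {..<p} \<in> A \<longleftrightarrow> (\<forall>r\<in>R. (\<Sum>j<i r. w j) \<in> D r)" for w
  proof -
    have "(\<Sum>j<i r. restrict w {..<p} j) = (\<Sum>j<i r. w j)" if "r \<in> R" for r
      using R(2)[OF that] by (intro sum.cong) auto
    then show ?thesis by (auto simp: A_def space_PiM)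
  qed
  have wC: "(\<Sum>j<q. w j) - (\<Sum>j<p. w j) = (\<Sum>j\<in>{p..<q}. w j)" for w :: "nat \<Rightarrow> 'a"
    using sum_diff_nat_ivl[of 0 p q w] pq by (simp add: atLeast0LessThan)
  have "measure P0 {\<omega> \<in> space P0. (\<forall>r\<in>R. zz \<omega> (dy k (i r)) \<in> D r) \<and> zz \<omega> (dy k q) - zz \<omega> (dy k p) \<in> C}
      = measure P0 {\<omega> \<in> space P0. (\<lambda>i\<in>{..q}. zz \<omega> (dy k i)) \<in> X1 \<inter> X2}"
    by (simp add: z1 z2)
  also have "\<dots> = measure (W k) {w. (\<lambda>i\<in>{..q}. \<Sum>j<i. w j) \<in> X1 \<inter> X2}"
    by (rule measure_grid) (use X1 X2 in auto)
  also have "\<dots> = measure (W k) {w. restrict w {..<p} \<in> A \<and> (\<Sum>j\<in>{p..<q}. w j) \<in> C}"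
    by (simp add: z1 z2 wA wC)
  also have "\<dots> = measure (W k) {w. restrict w {..<p} \<in> A} * measure (kap (real (q - p) / 2 ^ k)) C"
    by (rule W_increment_indep[OF pq A C])
  also have "measure (W k) {w. restrict w {..<p} \<in> A} = measure (W k) {w. (\<lambda>i\<in>{..q}. \<Sum>j<i. w j) \<in> X1}"
    by (simp add: z1 wA)
  also have "\<dots> = measure P0 {\<omega> \<in> space P0. (\<lambda>i\<in>{..q}. zz \<omega> (dy k i)) \<in> X1}"
    by (rule measure_grid[OF X1, symmetric])
  also have "\<dots> = measure P0 {\<omega> \<in> space P0. \<forall>r\<in>R. zz \<omega> (dy k (i r)) \<in> D r}"
    by (simp add: z1)
  finally show ?thesis .
qed

sublocale P0: prob_space P0 by (rule prob_space_dyadic_law)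

lemma zz_pred: "C \<in> sets borel \<Longrightarrow> {\<omega> \<in> space P0. zz \<omega> t \<in> C} \<in> P0.events"
  using measurable_sets[OF measurable_dyadic_process] by (simp add: vimage_def Int_def conj_commute)

lemma zz_diff_pred: "C \<in> sets borel \<Longrightarrow> {\<omega> \<in> space P0. zz \<omega> t - zz \<omega> s \<in> C} \<in> P0.events"
  using measurable_sets[OF borel_measurable_diff'[OF measurable_dyadic_process measurable_dyadic_process]]
  by (simp add: vimage_def Int_def conj_commute)

lemma prob_grid_increment:
  assumes "p \<le> q" "C \<in> sets borel"
  shows "P0.prob {\<omega> \<in> space P0. zz \<omega> (dy k q) - zz \<omega> (dy k p) \<in> C} = measure (kap (real (q - p) / 2 ^ k)) C"
  using grid_increment_indep[of "{} :: nat set" "\<lambda>_. 0" p "\<lambda>_. UNIV" q C k] assms P0.prob_space by simp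

section \<open>The expected and the almost sure number of jumps\<close>

lemma real_jumps_eq:
  "real (jumps n (zz \<omega>) k m) = (\<Sum>i<m. indicator {\<omega>. zz \<omega> (dy k (Suc i)) - zz \<omega> (dy k i) \<notin> H n} \<omega>)"
  unfolding jumps_def of_nat_sum by (intro sum.cong) (auto simp: indicator_def)

lemma measurable_jump: "(\<lambda>\<omega>. indicator {\<omega>. zz \<omega> (dy k (Suc i)) - zz \<omega> (dy k i) \<notin> H n} \<omega> :: real) \<in> borel_measurable P0"
proof -
  have "(\<lambda>\<omega>. zz \<omega> (dy k (Suc i)) - zz \<omega> (dy k i)) \<in> P0 \<rightarrow>\<^sub>M borel"
    by (intro borel_measurable_diff' measurable_dyadic_process)
  moreover have "(indicator (- H n) :: 'a \<Rightarrow> real) \<in> borel_measurable borel" by simp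
  ultimately have "(\<lambda>\<omega>. indicator (- H n) (zz \<omega> (dy k (Suc i)) - zz \<omega> (dy k i)) :: real) \<in> borel_measurable P0"
    by (rule measurable_compose)
  then show ?thesis by (simp add: indicator_def)
qed

lemma measurable_real_jumps [measurable]: "(\<lambda>\<omega>. real (jumps n (zz \<omega>) k m)) \<in> borel_measurable P0"
  unfolding real_jumps_eq by (intro borel_measurable_sum measurable_jump)

text \<open>Linearity of expectation, with the bound of \<open>measure_kap_H_ge\<close> for each
  step. For \<open>m = T * 2 ^ k\<close> the estimate no longer depends on \<open>k\<close>.\<close>

lemma integral_jumps_le:
  "(\<integral>\<^sup>+\<omega>. ennreal (real (jumps n (zz \<omega>) k m)) \<partial>P0) \<le> ennreal (real m / 2 ^ k * lam (- n) powr \<alpha>)"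
proof -
  let ?J = "\<lambda>i. {\<omega>. zz \<omega> (dy k (Suc i)) - zz \<omega> (dy k i) \<notin> H n}"
  have int: "integrable P0 (indicator (?J i) :: _ \<Rightarrow> real)" for i
    by (rule P0.integrable_const_bound[of _ 1]) (auto simp: measurable_jump)
  have le: "(LINT \<omega>|P0. indicator (?J i) \<omega>) \<le> 1 / 2 ^ k * lam (- n) powr \<alpha>" for i
  proof -
    let ?G = "{\<omega> \<in> space P0. zz \<omega> (dy k (Suc i)) - zz \<omega> (dy k i) \<in> H n}"
    have G: "?G \<in> P0.events" by (rule zz_diff_pred) simp
    have "?G \<inter> space P0 = ?G" by blast
    then have b: "(LINT \<omega>|P0. indicator ?G \<omega>) = P0.prob ?G" by simp
    have c: "(LINT \<omega>|P0. 1) = (1 :: real)" by (simp add: P0.prob_space)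
    have "(LINT \<omega>|P0. indicator (?J i) \<omega>) = (LINT \<omega>|P0. 1 - indicator ?G \<omega> :: real)"
      by (intro Bochner_Integration.integral_cong) (auto simp: indicator_def)
    also have "\<dots> = (LINT \<omega>|P0. 1) - (LINT \<omega>|P0. indicator ?G \<omega>)"
      by (rule Bochner_Integration.integral_diff)
         (simp, rule integrable_real_indicator[OF G], simp add: less_top[symmetric])
    also have "\<dots> = 1 - measure (kap (1 / 2 ^ k)) (H n)"
      unfolding b c using prob_grid_increment[of i "Suc i" "H n" k] by simp
    also have "\<dots> \<le> 1 / 2 ^ k * lam (- n) powr \<alpha>"
      using measure_kap_H_ge[of "1 / 2 ^ k" n] by simp
    finally show ?thesis .
  qed
  have "(LINT \<omega>|P0. real (jumps n (zz \<omega>) k m)) = (\<Sum>i<m. LINT \<omega>|P0. indicator (?J i) \<omega>)"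
    unfolding real_jumps_eq using int by (intro Bochner_Integration.integral_sum)
  also have "\<dots> \<le> (\<Sum>i<m. 1 / 2 ^ k * lam (- n) powr \<alpha>)" by (intro sum_mono le)
  finally have "(LINT \<omega>|P0. real (jumps n (zz \<omega>) k m)) \<le> real m / 2 ^ k * lam (- n) powr \<alpha>" by simp
  moreover have "integrable P0 (\<lambda>\<omega>. real (jumps n (zz \<omega>) k m))"
    unfolding real_jumps_eq using int by (intro Bochner_Integration.integrable_sum)
  ultimately show ?thesis by (subst nn_integral_eq_integral) (auto intro: ennreal_leI)
qed

text \<open>The counts increase with \<open>k\<close> while their means stay bounded, so by monotone
  convergence their supremum has finite mean and is finite almost surely. Countably many pairs of
  \<open>n\<close> and \<open>T\<close> remain.\<close>

lemma AE_few_jumps: "AE \<omega> in P0. few_jumps (zz \<omega>)"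
proof -
  have "AE \<omega> in P0. \<exists>N. \<forall>k. jumps n (zz \<omega>) k (T * 2 ^ k) \<le> N" for n and T :: nat
  proof -
    define J where "J k \<omega> = ennreal (real (jumps n (zz \<omega>) k (T * 2 ^ k)))" for k \<omega>
    have meas: "J k \<in> borel_measurable P0" for k unfolding J_def by measurable
    have "J k \<omega> \<le> J (Suc k) \<omega>" for k \<omega>
      unfolding J_def using jumps_refine[of n "zz \<omega>" k "T * 2 ^ k"]
      by (intro ennreal_leI) (simp add: ac_simps)
    then have inc: "incseq J" by (intro incseq_SucI le_funI)
    have "(\<integral>\<^sup>+\<omega>. (SUP k. J k \<omega>) \<partial>P0) = (SUP k. integral\<^sup>N P0 (J k))"
      by (rule nn_integral_monotone_convergence_SUP[OF inc meas])
    also have "\<dots> \<le> ennreal (real T * lam (- n) powr \<alpha>)"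
    proof (rule SUP_least)
      fix k
      show "integral\<^sup>N P0 (J k) \<le> ennreal (real T * lam (- n) powr \<alpha>)"
        using integral_jumps_le[of n k "T * 2 ^ k"] by (simp add: J_def[abs_def])
    qed
    also have "\<dots> < \<infinity>" by simp
    finally have "(\<integral>\<^sup>+\<omega>. (SUP k. J k \<omega>) \<partial>P0) \<noteq> \<infinity>" by simp
    then have "AE \<omega> in P0. (SUP k. J k \<omega>) \<noteq> \<infinity>"
      using meas by (intro nn_integral_PInf_AE borel_measurable_SUP) auto
    then show ?thesis
    proof eventually_elim
      fix \<omega> assume "(SUP k. J k \<omega>) \<noteq> \<infinity>"
      then obtain r where r: "r \<ge> 0" "(SUP k. J k \<omega>) = ennreal r"
        by (cases "SUP k. J k \<omega>") auto
      have "jumps n (zz \<omega>) k (T * 2 ^ k) \<le> nat \<lceil>r\<rceil>" for k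
      proof -
        have "J k \<omega> \<le> ennreal r" unfolding r(2)[symmetric] by (rule SUP_upper) simp
        then have "real (jumps n (zz \<omega>) k (T * 2 ^ k)) \<le> r" using r(1) by (simp add: J_def)
        then show ?thesis by linarith
      qed
      then show "\<exists>N. \<forall>k. jumps n (zz \<omega>) k (T * 2 ^ k) \<le> N" by blast
    qed
  qed
  then show ?thesis unfolding few_jumps_def by (simp add: AE_all_countable)
qed

text \<open>On the exceptional null set and at negative times the value is zero, which makes every
  path regular and not only almost every path.\<close>

definition Y :: "real \<Rightarrow> (real \<Rightarrow> nat \<Rightarrow> real) \<Rightarrow> 'a" where
  "Y t \<omega> = (if 0 \<le> t \<and> few_jumps (zz \<omega>) then right_lim (zz \<omega>) t else 0)"

lemma few_jumps_events: "{\<omega> \<in> space P0. few_jumps (zz \<omega>)} \<in> P0.events"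
proof -
  have "few_jumps (zz \<omega>) \<longleftrightarrow> (\<forall>n. \<forall>T::nat. \<exists>N::nat. \<forall>k. real (jumps n (zz \<omega>) k (T * 2 ^ k)) \<le> real N)" for \<omega>
    unfolding few_jumps_def by simp
  moreover have "{\<omega> \<in> space P0. \<forall>n. \<forall>T::nat. \<exists>N::nat. \<forall>k. real (jumps n (zz \<omega>) k (T * 2 ^ k)) \<le> real N} \<in> P0.events"
    by measurable
  ultimately show ?thesis by simp
qed

lemma Y_tendsto:
  assumes "few_jumps (zz \<omega>)" "t \<ge> 0"
  shows "(\<lambda>k. zz \<omega> (dy k (next_dy k t))) \<longlonglongrightarrow> Y t \<omega>"
  using right_lim_tendsto[OF assms] assms by (simp add: Y_def)

text \<open>A member of \<open>Cosets\<close> is open and closed, so a convergent sequence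
  eventually lies on the same side of it as its limit.\<close>

lemma tendsto_Cosets_iff:
  assumes "(f \<longlongrightarrow> l) sequentially" "C \<in> Cosets"
  shows "\<forall>\<^sub>F k in sequentially. f k \<in> C \<longleftrightarrow> l \<in> C"
proof (cases "l \<in> C")
  case True
  show ?thesis
    using topological_tendstoD[OF assms(1) Cosets_open[OF assms(2)] True]
    by eventually_elim (use True in simp)
next
  case False
  have "open (- C)" using Cosets_closed[OF assms(2)] by (simp add: open_Compl)
  from topological_tendstoD[OF assms(1) this] False
  have "\<forall>\<^sub>F k in sequentially. f k \<in> - C" by simp
  then show ?thesis by eventually_elim (use False in simp)
qed

lemma measurable_Y [measurable]: "Y t \<in> borel_measurable P0"
proof (rule borel_measurable_CosetsI)
  fix a n
  show "Y t -` coset a n \<inter> space P0 \<in> P0.events"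
  proof (cases "0 \<le> t")
    case False
    then have "Y t -` coset a n \<inter> space P0 = (if 0 \<in> coset a n then space P0 else {})"
      by (auto simp: Y_def)
    then show ?thesis by (metis sets.top sets.empty_sets)
  next
    case True
    let ?F = "{\<omega> \<in> space P0. few_jumps (zz \<omega>)}"
    \<comment> \<open>Eventual membership along the grid times, with countable quantifiers. On the
      good event it is equivalent to membership of the limit.\<close>
    let ?E = "{\<omega> \<in> space P0. \<exists>N. \<forall>k. N \<le> k \<longrightarrow> zz \<omega> (dy k (next_dy k t)) \<in> coset a n}"
    have E: "?E \<in> P0.events"
      by (intro sets.sets_Collect_countable_Ex sets.sets_Collect_countable_All sets.sets_Collect_imp
          zz_pred coset_borel sets.sets_Collect_const)
    have iff: "Y t \<omega> \<in> coset a n \<longleftrightarrow> (\<exists>N. \<forall>k. N \<le> k \<longrightarrow> zz \<omega> (dy k (next_dy k t)) \<in> coset a n)"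
      if "few_jumps (zz \<omega>)" for \<omega>
    proof -
      have ev: "\<forall>\<^sub>F k in sequentially. zz \<omega> (dy k (next_dy k t)) \<in> coset a n \<longleftrightarrow> Y t \<omega> \<in> coset a n"
        by (rule tendsto_Cosets_iff[OF Y_tendsto[OF that True]]) simp
      then obtain N where N: "\<And>k. k \<ge> N \<Longrightarrow> zz \<omega> (dy k (next_dy k t)) \<in> coset a n \<longleftrightarrow> Y t \<omega> \<in> coset a n"
        unfolding eventually_sequentially by blast
      show ?thesis
      proof
        assume "Y t \<omega> \<in> coset a n"
        then show "\<exists>N. \<forall>k. N \<le> k \<longrightarrow> zz \<omega> (dy k (next_dy k t)) \<in> coset a n"
          using N by blast
      next
        assume "\<exists>N. \<forall>k. N \<le> k \<longrightarrow> zz \<omega> (dy k (next_dy k t)) \<in> coset a n"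
        then obtain M where "\<And>k. M \<le> k \<Longrightarrow> zz \<omega> (dy k (next_dy k t)) \<in> coset a n" by blast
        then show "Y t \<omega> \<in> coset a n" using N[of "max N M"] by (metis max.cobounded1 max.cobounded2)
      qed
    qed
    have "Y t -` coset a n \<inter> space P0 = (?F \<inter> ?E) \<union> ((space P0 - ?F) \<inter> {\<omega> \<in> space P0. 0 \<in> coset a n})"
    proof (rule set_eqI)
      fix \<omega>
      show "\<omega> \<in> Y t -` coset a n \<inter> space P0 \<longleftrightarrow> \<omega> \<in> (?F \<inter> ?E) \<union> ((space P0 - ?F) \<inter> {\<omega> \<in> space P0. 0 \<in> coset a n})"
      proof (cases "few_jumps (zz \<omega>)")
        case True
        then show ?thesis using iff[OF True] by (simp del: mem_coset) blast
      next
        case False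
        then show ?thesis by (auto simp: Y_def simp del: mem_coset)
      qed
    qed
    also have "\<dots> \<in> P0.events"
      by (rule sets.Un[OF sets.Int[OF few_jumps_events E]
          sets.Int[OF sets.compl_sets[OF few_jumps_events] sets.sets_Collect_const]])
    finally show ?thesis .
  qed
qed

lemma regular_path_zero: "regular_path H \<mu> (\<lambda>t. 0)"
  unfolding regular_path_def by (auto intro: tendsto_const)

lemma regular_path_Y: "regular_path H \<mu> (\<lambda>t. Y t \<omega>)"
proof (cases "few_jumps (zz \<omega>)")
  case False
  then show ?thesis using regular_path_zero by (simp add: Y_def)
next
  case True
  have reg: "regular_path H \<mu> (right_lim (zz \<omega>))" by (rule regular_path_right_lim[OF True])
  have eq: "Y t \<omega> = right_lim (zz \<omega>) t" if "0 \<le> t" for t using that True by (simp add: Y_def)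
  show ?thesis
    unfolding regular_path_def
  proof (intro conjI allI impI)
    fix t :: real assume t: "0 \<le> t"
    have "(right_lim (zz \<omega>) \<longlongrightarrow> right_lim (zz \<omega>) t) (at_right t)"
      using reg t unfolding regular_path_def by blast
    moreover have "\<forall>\<^sub>F s in at_right t. right_lim (zz \<omega>) s = Y s \<omega>"
      using t eq by (auto simp: eventually_at_filter intro!: always_eventually)
    ultimately show "((\<lambda>t. Y t \<omega>) \<longlongrightarrow> Y t \<omega>) (at_right t)"
      unfolding eq[OF t] by (rule Lim_transform_eventually)
  next
    fix t :: real assume t: "0 < t"
    obtain l where "(right_lim (zz \<omega>) \<longlongrightarrow> l) (at_left t)"
      using reg t unfolding regular_path_def by blast
    moreover have "\<forall>\<^sub>F s in at_left t. right_lim (zz \<omega>) s = Y s \<omega>"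
      unfolding eventually_at_left_field using t eq by (intro exI[of _ 0]) auto
    ultimately have "((\<lambda>t. Y t \<omega>) \<longlongrightarrow> l) (at_left t)"
      by (rule Lim_transform_eventually)
    then show "\<exists>l. ((\<lambda>t. Y t \<omega>) \<longlongrightarrow> l) (at_left t)" by blast
  next
    fix T :: real assume "0 \<le> T"
    then obtain C where C: "\<forall>t\<in>{0..T}. gnorm H \<mu> (right_lim (zz \<omega>) t) \<le> C"
      using reg unfolding regular_path_def by blast
    have "\<forall>t\<in>{0..T}. gnorm H \<mu> (Y t \<omega>) \<le> C" using C eq by simp
    then show "\<exists>C. \<forall>t\<in>{0..T}. gnorm H \<mu> (Y t \<omega>) \<le> C" by blast
  qed
qed

text \<open>Every time is replaced by the next grid point, where independence is available. The
  finitely many coset events agree with those of the limit for large \<open>k\<close>, so the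
  product formula passes to the limit.\<close>

lemma Y_increment_indep:
  assumes s: "s \<ge> 0" and t: "t \<ge> 0" and R: "finite R" "R \<subseteq> {0..s}"
    and D: "\<And>r. r \<in> R \<Longrightarrow> D r \<in> Cosets" and C: "C = coset a n"
  shows "P0.prob {\<omega> \<in> space P0. (\<forall>r\<in>R. Y r \<omega> \<in> D r) \<and> Y (s + t) \<omega> - Y s \<omega> \<in> C}
    = P0.prob {\<omega> \<in> space P0. \<forall>r\<in>R. Y r \<omega> \<in> D r} * measure (kap t) C"
proof -
  let ?i = "\<lambda>k r. next_dy k r"
  define B where "B k = {\<omega> \<in> space P0. \<forall>r\<in>R. zz \<omega> (dy k (?i k r)) \<in> D r}" for k
  define E where "E k = {\<omega> \<in> space P0. (\<forall>r\<in>R. zz \<omega> (dy k (?i k r)) \<in> D r)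
    \<and> zz \<omega> (dy k (?i k (s + t))) - zz \<omega> (dy k (?i k s)) \<in> C}" for k
  have Db: "D r \<in> sets borel" if "r \<in> R" for r using Cosets_open[OF D[OF that]] by (rule borel_open)
  have Cc: "C \<in> Cosets" using C by simp
  have Cb: "C \<in> sets borel" using C by simp
  have Yp: "{\<omega> \<in> space P0. Y r \<omega> \<in> D r} \<in> P0.events" if "r \<in> R" for r
    using measurable_sets[OF measurable_Y Db[OF that]] by (simp add: vimage_def Int_def conj_commute)
  have Yd: "{\<omega> \<in> space P0. Y (s + t) \<omega> - Y s \<omega> \<in> C} \<in> P0.events"
    using measurable_sets[OF borel_measurable_diff'[OF measurable_Y measurable_Y] Cb]
    by (simp add: vimage_def Int_def conj_commute)
  have all_ev: "\<forall>\<^sub>F k in sequentially. \<forall>r\<in>R. zz \<omega> (dy k (?i k r)) \<in> D r \<longleftrightarrow> Y r \<omega> \<in> D r"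
    if "few_jumps (zz \<omega>)" for \<omega>
  proof (rule eventually_ball_finite[OF R(1)], rule ballI)
    fix r assume r: "r \<in> R"
    then have "0 \<le> r" using R(2) by auto
    then show "\<forall>\<^sub>F k in sequentially. zz \<omega> (dy k (?i k r)) \<in> D r \<longleftrightarrow> Y r \<omega> \<in> D r"
      by (intro tendsto_Cosets_iff[OF Y_tendsto[OF that] D[OF r]])
  qed
  have limB: "(\<lambda>k. P0.prob (B k)) \<longlonglongrightarrow> P0.prob {\<omega> \<in> space P0. \<forall>r\<in>R. Y r \<omega> \<in> D r}"
    unfolding B_def
  proof (rule P0.prob_tendsto_of_AE_eventually)
    show "{\<omega> \<in> space P0. \<forall>r\<in>R. zz \<omega> (dy k (?i k r)) \<in> D r} \<in> P0.events" for k
      by (intro sets.sets_Collect_finite_All R zz_pred Db) 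
    show "{\<omega> \<in> space P0. \<forall>r\<in>R. Y r \<omega> \<in> D r} \<in> P0.events"
      by (intro sets.sets_Collect_finite_All R Yp)
    show "AE \<omega> in P0. \<forall>\<^sub>F k in sequentially. (\<forall>r\<in>R. zz \<omega> (dy k (?i k r)) \<in> D r) \<longleftrightarrow> (\<forall>r\<in>R. Y r \<omega> \<in> D r)"
      using AE_few_jumps
    proof eventually_elim
      fix \<omega> assume "few_jumps (zz \<omega>)"
      from all_ev[OF this] show "\<forall>\<^sub>F k in sequentially. (\<forall>r\<in>R. zz \<omega> (dy k (?i k r)) \<in> D r) \<longleftrightarrow> (\<forall>r\<in>R. Y r \<omega> \<in> D r)"
        by eventually_elim blast
    qed
  qed
  have limE: "(\<lambda>k. P0.prob (E k)) \<longlonglongrightarrow> P0.prob {\<omega> \<in> space P0. (\<forall>r\<in>R. Y r \<omega> \<in> D r) \<and> Y (s + t) \<omega> - Y s \<omega> \<in> C}"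
    unfolding E_def
  proof (rule P0.prob_tendsto_of_AE_eventually)
    show "{\<omega> \<in> space P0. (\<forall>r\<in>R. zz \<omega> (dy k (?i k r)) \<in> D r) \<and> zz \<omega> (dy k (?i k (s + t))) - zz \<omega> (dy k (?i k s)) \<in> C} \<in> P0.events" for k
      by (intro sets.sets_Collect_conj sets.sets_Collect_finite_All R zz_pred zz_diff_pred Db Cb)
    show "{\<omega> \<in> space P0. (\<forall>r\<in>R. Y r \<omega> \<in> D r) \<and> Y (s + t) \<omega> - Y s \<omega> \<in> C} \<in> P0.events"
      by (intro sets.sets_Collect_conj sets.sets_Collect_finite_All R Yp Yd)
    show "AE \<omega> in P0. \<forall>\<^sub>F k in sequentially.
        ((\<forall>r\<in>R. zz \<omega> (dy k (?i k r)) \<in> D r) \<and> zz \<omega> (dy k (?i k (s + t))) - zz \<omega> (dy k (?i k s)) \<in> C)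
        \<longleftrightarrow> ((\<forall>r\<in>R. Y r \<omega> \<in> D r) \<and> Y (s + t) \<omega> - Y s \<omega> \<in> C)"
      using AE_few_jumps
    proof eventually_elim
      fix \<omega> assume few: "few_jumps (zz \<omega>)"
      have st: "0 \<le> s + t" using s t by simp
      have "(\<lambda>k. zz \<omega> (dy k (?i k (s + t))) - zz \<omega> (dy k (?i k s))) \<longlonglongrightarrow> Y (s + t) \<omega> - Y s \<omega>"
        by (intro tendsto_diff Y_tendsto few st s)
      from tendsto_Cosets_iff[OF this Cc] all_ev[OF few]
      show "\<forall>\<^sub>F k in sequentially.
        ((\<forall>r\<in>R. zz \<omega> (dy k (?i k r)) \<in> D r) \<and> zz \<omega> (dy k (?i k (s + t))) - zz \<omega> (dy k (?i k s)) \<in> C)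
        \<longleftrightarrow> ((\<forall>r\<in>R. Y r \<omega> \<in> D r) \<and> Y (s + t) \<omega> - Y s \<omega> \<in> C)"
        by eventually_elim blast
    qed
  qed
  \<comment> \<open>The time between the two grid points. It may differ from \<open>t\<close> but
    tends to it, and the mass of a coset under \<open>kap\<close> is continuous in time.\<close>
  define \<tau> where "\<tau> k = real (?i k (s + t) - ?i k s) / 2 ^ k" for k
  have le: "?i k s \<le> ?i k (s + t)" for k using t by (intro next_dy_mono) simp
  have "\<tau> = (\<lambda>k. dy k (?i k (s + t)) - dy k (?i k s))"
    using le by (intro ext) (simp add: \<tau>_def dy_def of_nat_diff diff_divide_distrib)
  moreover have "(\<lambda>k. dy k (?i k (s + t)) - dy k (?i k s)) \<longlonglongrightarrow> (s + t) - s"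
    using s t by (intro tendsto_diff next_dy_tendsto) auto
  ultimately have "\<tau> \<longlonglongrightarrow> t" by simp
  then have limC: "(\<lambda>k. measure (kap (\<tau> k)) C) \<longlonglongrightarrow> measure (kap t) C"
    unfolding C by (rule measure_kap_tendsto) (simp add: \<tau>_def)
  have "P0.prob (E k) = P0.prob (B k) * measure (kap (\<tau> k)) C" for k
    unfolding E_def B_def \<tau>_def
  proof (rule grid_increment_indep[OF R(1) _ Db le Cb])
    show "?i k r \<le> ?i k s" if "r \<in> R" for r using that R(2) by (intro next_dy_mono) auto
  qed
  then have "(\<lambda>k. P0.prob (E k)) \<longlonglongrightarrow> P0.prob {\<omega> \<in> space P0. \<forall>r\<in>R. Y r \<omega> \<in> D r} * measure (kap t) C"
    using tendsto_mult[OF limB limC] by simp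
  with limE show ?thesis by (rule LIMSEQ_unique)
qed

text \<open>The grid point next to 0 is \<open>dy k 1\<close>, where the law
  \<open>kap (1 / 2 ^ k)\<close> gives \<open>H n\<close> a mass tending to 1. Hence each
  \<open>H n\<close> contains the value almost surely, and their intersection is zero.\<close>

lemma AE_Y_0: "AE \<omega> in P0. Y 0 \<omega> = 0"
proof -
  have "AE \<omega> in P0. Y 0 \<omega> \<in> H n" for n
  proof -
    let ?Q = "\<lambda>k \<omega>. zz \<omega> (dy k (next_dy k 0)) \<in> H n"
    have "P0.prob {\<omega> \<in> space P0. ?Q k \<omega>} = measure (kap (1 / 2 ^ k)) (H n)" for k
    proof -
      let ?P = "PiM {..1::nat} (\<lambda>_. borel :: 'a measure)"
      define X where "X = {f \<in> space ?P. f 1 \<in> H n}"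
      have "(\<lambda>f. f 1) \<in> ?P \<rightarrow>\<^sub>M borel" by (intro measurable_component_singleton) simp
      from measurable_sets[OF this H_borel] have X: "X \<in> sets ?P"
        by (simp add: X_def vimage_def Int_def conj_commute)
      have z: "(\<lambda>i\<in>{..1}. f i) \<in> X \<longleftrightarrow> f 1 \<in> H n" for f by (simp add: X_def space_PiM)
      have "P0.prob {\<omega> \<in> space P0. ?Q k \<omega>} = measure P0 {\<omega> \<in> space P0. (\<lambda>i\<in>{..1}. zz \<omega> (dy k i)) \<in> X}"
        by (simp add: z next_dy_def del: One_nat_def) simp
      also have "\<dots> = measure (W k) {w. (\<lambda>i\<in>{..1}. \<Sum>j<i. w j) \<in> X}" by (rule measure_grid[OF X])
      also have "\<dots> = measure (W k) {w. (\<Sum>j<1. w j) \<in> H n}" by (simp only: z)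
      also have "\<dots> = measure (distr (W k) borel (\<lambda>w. \<Sum>j\<in>{..<1}. w j)) (H n)"
        by (subst measure_distr) (simp_all add: vimage_def)
      also have "\<dots> = measure (kap (1 / 2 ^ k)) (H n)" by (subst distr_W_sum) simp_all
      finally show ?thesis .
    qed
    moreover have "(\<lambda>k. measure (kap (1 / 2 ^ k)) (coset 0 n)) \<longlonglongrightarrow> measure (kap 0) (coset 0 n)"
    proof (rule measure_kap_tendsto)
      have "(\<lambda>k. (1 / 2 :: real) ^ k) \<longlonglongrightarrow> 0" by (rule LIMSEQ_realpow_zero) auto
      then show "(\<lambda>k. 1 / 2 ^ k :: real) \<longlonglongrightarrow> 0" by (simp add: power_one_over)
    qed simp
    moreover have "measure (kap 0) (coset 0 n) = 1" by (simp add: kap_def measure_return)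
    ultimately have 1: "(\<lambda>k. P0.prob {\<omega> \<in> space P0. ?Q k \<omega>}) \<longlonglongrightarrow> 1" by simp
    have ev: "{\<omega> \<in> space P0. Y 0 \<omega> \<in> H n} \<in> P0.events"
      using measurable_sets[OF measurable_Y H_borel] by (simp add: vimage_def Int_def conj_commute)
    have "(\<lambda>k. P0.prob {\<omega> \<in> space P0. ?Q k \<omega>}) \<longlonglongrightarrow> P0.prob {\<omega> \<in> space P0. Y 0 \<omega> \<in> H n}"
    proof (rule P0.prob_tendsto_of_AE_eventually[OF zz_pred[OF H_borel] ev])
      show "AE \<omega> in P0. \<forall>\<^sub>F k in sequentially. ?Q k \<omega> \<longleftrightarrow> Y 0 \<omega> \<in> H n"
        using AE_few_jumps by eventually_elim (intro tendsto_Cosets_iff Y_tendsto; simp)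
    qed
    from LIMSEQ_unique[OF this 1] have "P0.prob {\<omega> \<in> space P0. Y 0 \<omega> \<in> H n} = 1" .
    then show ?thesis using P0.prob_eq_1[OF ev] by (auto elim: eventually_mono)
  qed
  then have "AE \<omega> in P0. \<forall>n. Y 0 \<omega> \<in> H n" by (simp add: AE_all_countable)
  then show ?thesis
  proof eventually_elim
    fix \<omega> assume "\<forall>n. Y 0 \<omega> \<in> H n"
    then have "Y 0 \<omega> \<in> (\<Inter>n. H n)" by blast
    then show "Y 0 \<omega> = 0" by (simp add: Inter_H)
  qed
qed

end

section \<open>The Markov property\<close>

context heat_semigroup
begin

lemma Int_stable_cylinders:
  "Int_stable {{\<omega> \<in> S. \<forall>r\<in>R. X r \<omega> \<in> D r} | R D. finite R \<and> R \<subseteq> T \<and> (\<forall>r\<in>R. D r \<in> Cosets)}"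
  (is "Int_stable ?G")
proof (rule Int_stableI)
  fix A B assume "A \<in> ?G" "B \<in> ?G"
  then obtain R D R' D' where A: "A = {\<omega> \<in> S. \<forall>r\<in>R. X r \<omega> \<in> D r}" "finite R" "R \<subseteq> T" "\<forall>r\<in>R. D r \<in> Cosets"
    and B: "B = {\<omega> \<in> S. \<forall>r\<in>R'. X r \<omega> \<in> D' r}" "finite R'" "R' \<subseteq> T" "\<forall>r\<in>R'. D' r \<in> Cosets"
    by blast
  define E where "E r = (if r \<in> R \<inter> R' then D r \<inter> D' r else if r \<in> R then D r else D' r)" for r
  have E: "\<forall>r\<in>R \<union> R'. E r \<in> Cosets"
    using A(4) B(4) Int_stable_Cosets by (auto simp: E_def Int_stable_def)
  have eq: "A \<inter> B = {\<omega> \<in> S. \<forall>r\<in>R \<union> R'. X r \<omega> \<in> E r}"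
    unfolding A(1) B(1) E_def by auto
  have "finite (R \<union> R') \<and> R \<union> R' \<subseteq> T" using A B by simp
  then show "A \<inter> B \<in> ?G" unfolding eq using E by blast
qed

text \<open>Independence of the increment from all cylinder events up to time \<open>s\<close> extends to the
  whole past by Dynkin's lemma; the joint law of the past and the increment is then a product
  measure, and the Markov property is Fubini's theorem.\<close>

lemma markov_property_of_indep:
  fixes X :: "real \<Rightarrow> 'w \<Rightarrow> 'a"
  assumes N: "prob_space N" and X: "\<And>t. t \<ge> 0 \<Longrightarrow> X t \<in> N \<rightarrow>\<^sub>M borel"
    and s: "s \<ge> 0" and t: "t \<ge> 0"
    and indep: "\<And>R D a n. finite R \<Longrightarrow> R \<subseteq> {0..s} \<Longrightarrow> (\<And>r. r \<in> R \<Longrightarrow> D r \<in> Cosets) \<Longrightarrow>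
      measure N {\<omega> \<in> space N. (\<forall>r\<in>R. X r \<omega> \<in> D r) \<and> X (s + t) \<omega> - X s \<omega> \<in> coset a n}
        = measure N {\<omega> \<in> space N. \<forall>r\<in>R. X r \<omega> \<in> D r} * measure (kap t) (coset a n)"
    and B: "B \<in> sets borel"
  shows "AE \<omega> in N. real_cond_exp N (past N X s) (\<lambda>\<omega>'. indicator B (X (s + t) \<omega>')) \<omega> = measure (K t (X s \<omega>)) B"
proof -
  interpret prob_space N by fact
  interpret kt: prob_space "kap t" by (rule prob_space_kap[OF t])
  have Xst [measurable]: "X (s + t) \<in> N \<rightarrow>\<^sub>M borel" "X s \<in> N \<rightarrow>\<^sub>M borel" using X s t by simp_all
  note [measurable] = B
  define inc where "inc \<omega> = X (s + t) \<omega> - X s \<omega>" for \<omega>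
  have inc [measurable]: "inc \<in> N \<rightarrow>\<^sub>M borel" unfolding inc_def by measurable
  let ?S = "space N"
  define G1 where "G1 = {{\<omega> \<in> ?S. \<forall>r\<in>R. X r \<omega> \<in> D r} | R D. finite R \<and> R \<subseteq> {0..s} \<and> (\<forall>r\<in>R. D r \<in> Cosets)}"
  define G2 where "G2 = {inc -` C \<inter> ?S | C. C \<in> Cosets}"
  have Cosets_b: "C \<in> sets borel" if "C \<in> Cosets" for C using Cosets_open[OF that] by (rule borel_open)
  have cyl: "{\<omega> \<in> ?S. \<forall>r\<in>R. X r \<omega> \<in> D r} \<in> events" if "finite R" "R \<subseteq> {0..s}" "\<forall>r\<in>R. D r \<in> Cosets" for R D
  proof (rule sets.sets_Collect_finite_All[OF _ that(1)])
    fix r assume r: "r \<in> R"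
    then have "X r \<in> N \<rightarrow>\<^sub>M borel" using that(2) by (intro X) auto
    from measurable_sets[OF this Cosets_b] that(3) r show "{\<omega> \<in> ?S. X r \<omega> \<in> D r} \<in> events"
      by (simp add: vimage_def Int_def conj_commute)
  qed
  have G1: "G1 \<subseteq> events" unfolding G1_def using cyl by blast
  have G2: "G2 \<subseteq> events" unfolding G2_def using measurable_sets[OF inc Cosets_b] by blast
  have law: "distr N borel inc = kap t"
  proof (rule measure_eqI_Cosets)
    show "emeasure (distr N borel inc) (coset a n) = emeasure (kap t) (coset a n)" for a n
    proof -
      have "emeasure (distr N borel inc) (coset a n) = ennreal (prob {\<omega> \<in> ?S. inc \<omega> \<in> coset a n})"
        by (subst emeasure_distr[OF inc coset_borel])
           (simp add: emeasure_eq_measure vimage_def Int_def conj_commute del: mem_coset)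
      \<comment> \<open>With no condition on the past, the independence assumption becomes the law
        of the increment.\<close>
      also have "\<dots> = ennreal (measure (kap t) (coset a n))"
        using indep[of "{}" "\<lambda>_. {}" a n] prob_space by (simp add: inc_def del: mem_coset)
      finally show ?thesis by (simp add: kt.emeasure_eq_measure)
    qed
    show "emeasure (distr N borel inc) (H n) \<noteq> \<infinity>" for n
    proof -
      interpret D: prob_space "distr N borel inc" by (rule prob_space_distr[OF inc])
      show ?thesis by simp
    qed
  qed simp_all
  have "indep_set G1 G2"
  proof (rule indep_setI[OF G1 G2])
    fix a b assume "a \<in> G1" "b \<in> G2"
    then obtain R D C where a: "a = {\<omega> \<in> ?S. \<forall>r\<in>R. X r \<omega> \<in> D r}" "finite R" "R \<subseteq> {0..s}" "\<forall>r\<in>R. D r \<in> Cosets"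
      and b: "b = inc -` C \<inter> ?S" "C \<in> Cosets" unfolding G1_def G2_def by blast
    show "prob (a \<inter> b) = prob a * prob b"
    proof (cases rule: Cosets_cases[OF b(2)])
      case 1
      then show ?thesis by (simp add: b(1))
    next
      case (2 c n)
      have "a \<inter> b = {\<omega> \<in> ?S. (\<forall>r\<in>R. X r \<omega> \<in> D r) \<and> X (s + t) \<omega> - X s \<omega> \<in> coset c n}"
        unfolding a(1) b(1) 2 inc_def by blast
      then have "prob (a \<inter> b) = prob a * measure (kap t) C"
        using indep[of R D c n] a 2 by (simp del: mem_coset)
      also have "measure (kap t) C = prob b"
        unfolding law[symmetric] b(1) by (rule measure_distr[OF inc Cosets_b[OF b(2)]])
      finally show ?thesis .
    qed
  qed
  moreover have "Int_stable G1" unfolding G1_def by (rule Int_stable_cylinders)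
  moreover have "Int_stable G2"
  proof (rule Int_stableI)
    fix a b assume "a \<in> G2" "b \<in> G2"
    then obtain C C' where C: "a = inc -` C \<inter> ?S" "b = inc -` C' \<inter> ?S" "C \<in> Cosets" "C' \<in> Cosets"
      unfolding G2_def by blast
    have "C \<inter> C' \<in> Cosets" using C(3,4) Int_stable_Cosets unfolding Int_stable_def by blast
    moreover have "a \<inter> b = inc -` (C \<inter> C') \<inter> ?S" unfolding C(1,2) by blast
    ultimately show "a \<inter> b \<in> G2" unfolding G2_def by blast
  qed
  ultimately have ind: "indep_set (sigma_sets ?S G1) (sigma_sets ?S G2)" by (rule indep_set_sigma_sets)
  \<comment> \<open>The cylinder events over cosets generate a \<sigma>-algebra that makes each
    \<open>X r\<close> with \<open>0 \<le> r \<le> s\<close> Borel measurable, so it contains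
    \<open>past N X s\<close>.\<close>
  define S1 where "S1 = sigma ?S G1"
  have G1_Pow: "G1 \<subseteq> Pow ?S" unfolding G1_def by blast
  have space_S1: "space S1 = ?S" unfolding S1_def using G1_Pow by (rule space_measure_of)
  have sets_S1: "sets S1 = sigma_sets ?S G1" unfolding S1_def using G1_Pow by (rule sets_measure_of)
  have S1_events: "sets S1 \<subseteq> events" unfolding sets_S1 by (rule sets.sigma_sets_subset[OF G1])
  have X_S1: "X r \<in> S1 \<rightarrow>\<^sub>M borel" if r: "0 \<le> r" "r \<le> s" for r
  proof (rule borel_measurable_CosetsI)
    fix a n
    have "{\<omega> \<in> ?S. \<forall>q\<in>{r}. X q \<omega> \<in> coset a n} \<in> G1"
      unfolding G1_def using r by (intro CollectI exI[of _ "{r}"] exI[of _ "\<lambda>_. coset a n"]) (simp del: mem_coset)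
    then have "{\<omega> \<in> ?S. \<forall>q\<in>{r}. X q \<omega> \<in> coset a n} \<in> sets S1" unfolding sets_S1 by (rule sigma_sets.Basic)
    then show "X r -` coset a n \<inter> space S1 \<in> sets S1"
      by (simp add: space_S1 vimage_def Int_def conj_commute del: mem_coset)
  qed
  let ?past = "past N X s"
  let ?gen = "{X r -` B \<inter> space N | r B. 0 \<le> r \<and> r \<le> s \<and> B \<in> sets borel}"
  have gen_Pow: "?gen \<subseteq> Pow ?S" by blast
  have space_past: "space ?past = ?S" unfolding past_def using gen_Pow by (rule space_measure_of)
  have sets_past: "sets ?past = sigma_sets ?S ?gen" unfolding past_def using gen_Pow by (rule sets_measure_of)
  have past_S1: "sets ?past \<subseteq> sets S1"
    unfolding sets_past space_S1[symmetric]
  proof (rule sets.sigma_sets_subset, safe)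
    fix r and C :: "'a set" assume "0 \<le> r" "r \<le> s" "C \<in> sets borel"
    then show "X r -` C \<inter> space S1 \<in> sets S1" by (intro measurable_sets[OF X_S1])
  qed
  have X_past: "X s \<in> ?past \<rightarrow>\<^sub>M borel"
  proof (rule measurableI)
    fix C :: "'a set" assume "C \<in> sets borel"
    then have "X s -` C \<inter> ?S \<in> ?gen" using s by blast
    then show "X s -` C \<inter> space ?past \<in> sets ?past"
      unfolding space_past sets_past by (rule sigma_sets.Basic)
  qed simp
  have pair: "(\<lambda>\<omega>. (\<omega>, inc \<omega>)) \<in> N \<rightarrow>\<^sub>M S1 \<Otimes>\<^sub>M borel"
  proof (rule measurable_Pair[OF _ inc])
    show "(\<lambda>\<omega>. \<omega>) \<in> N \<rightarrow>\<^sub>M S1"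
      by (rule measurableI) (use S1_events space_S1 in \<open>auto dest: sets.sets_into_space\<close>)
  qed
  have idm: "(\<lambda>\<omega>. \<omega>) \<in> N \<rightarrow>\<^sub>M S1"
    by (rule measurableI) (use S1_events space_S1 in \<open>auto dest: sets.sets_into_space\<close>)
  \<comment> \<open>The measure restricted to that \<sigma>-algebra: independence is known only for
    its sets, so the product identity is formulated over it.\<close>
  define M1 where "M1 = distr N S1 (\<lambda>\<omega>. \<omega>)"
  interpret M1: prob_space M1 unfolding M1_def by (rule prob_space_distr[OF idm])
  have prod: "M1 \<Otimes>\<^sub>M kap t = distr N (S1 \<Otimes>\<^sub>M borel) (\<lambda>\<omega>. (\<omega>, inc \<omega>))"
  proof (rule pair_measure_eqI)
    show "sigma_finite_measure M1" by unfold_locales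
    show "sigma_finite_measure (kap t)" by unfold_locales
    show "sets (M1 \<Otimes>\<^sub>M kap t) = sets (distr N (S1 \<Otimes>\<^sub>M borel) (\<lambda>\<omega>. (\<omega>, inc \<omega>)))"
      by (simp add: M1_def cong: sets_pair_measure_cong)
    fix A C assume "A \<in> sets M1" "C \<in> sets (kap t)"
    then have A: "A \<in> sets S1" and C: "C \<in> sets borel" by (simp_all add: M1_def)
    have AS: "A \<subseteq> ?S" using sets.sets_into_space[OF A] space_S1 by simp
    have "inc -` C \<inter> ?S \<in> sigma_sets ?S G2"
    proof -
      have "inc \<in> ?S \<rightarrow> UNIV" by simp
      from sigma_sets_vimage_commute[OF this, of Cosets] C show ?thesis
        unfolding sets_borel_Cosets G2_def by blast
    qed
    then have "prob (A \<inter> (inc -` C \<inter> ?S)) = prob A * prob (inc -` C \<inter> ?S)"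
      using indep_setD[OF ind] A unfolding sets_S1 by blast
    also have "prob (inc -` C \<inter> ?S) = measure (kap t) C"
      unfolding law[symmetric] by (rule measure_distr[OF inc C, symmetric])
    finally have eq: "prob (A \<inter> (inc -` C \<inter> ?S)) = prob A * measure (kap t) C" .
    have "emeasure (distr N (S1 \<Otimes>\<^sub>M borel) (\<lambda>\<omega>. (\<omega>, inc \<omega>))) (A \<times> C) = emeasure N ((\<lambda>\<omega>. (\<omega>, inc \<omega>)) -` (A \<times> C) \<inter> ?S)"
      using A C by (intro emeasure_distr[OF pair]) simp
    also have "(\<lambda>\<omega>. (\<omega>, inc \<omega>)) -` (A \<times> C) \<inter> ?S = A \<inter> (inc -` C \<inter> ?S)" by blast
    also have "emeasure N (A \<inter> (inc -` C \<inter> ?S)) = ennreal (prob A) * ennreal (measure (kap t) C)"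
      unfolding emeasure_eq_measure eq by (simp add: ennreal_mult)
    also have "ennreal (prob A) = emeasure M1 A"
      unfolding M1_def using AS by (subst emeasure_distr[OF idm A]) (simp add: emeasure_eq_measure Int_absorb2)
    finally show "emeasure M1 A * emeasure (kap t) C = emeasure (distr N (S1 \<Otimes>\<^sub>M borel) (\<lambda>\<omega>. (\<omega>, inc \<omega>))) (A \<times> C)"
      by (simp add: kt.emeasure_eq_measure)
  qed
  let ?k = "\<lambda>\<omega>. measure (K t (X s \<omega>)) B"
  have Km: "(\<lambda>x. measure (K t x) B) \<in> borel_measurable borel"
    by (rule measurable_compose[OF measurable_K[OF t] measurable_measure_prob_algebra[OF B]])
  have kN [measurable]: "?k \<in> borel_measurable N" by (rule measurable_compose[OF Xst(2) Km])
  have k_bound: "0 \<le> ?k \<omega>" "?k \<omega> \<le> 1" for \<omega>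
    using prob_space.prob_le_1[OF prob_space_K[OF t]] by simp_all
  have key: "prob (A \<inter> {\<omega> \<in> ?S. X (s + t) \<omega> \<in> B}) = (LINT \<omega>|N. indicator A \<omega> * ?k \<omega>)" if A: "A \<in> sets S1" for A
  proof -
    have AN [measurable]: "A \<in> events" using A S1_events by blast
    have AS: "A \<subseteq> ?S" using sets.sets_into_space[OF AN] .
    note [measurable] = A X_S1[OF s order_refl]
    define g where "g p = (indicator A (fst p) * indicator B (X s (fst p) + snd p) :: ennreal)" for p
    have g: "g \<in> borel_measurable (S1 \<Otimes>\<^sub>M borel)" unfolding g_def by measurable
    have g': "g \<in> borel_measurable (M1 \<Otimes>\<^sub>M kap t)"
      using g by (simp add: M1_def cong: measurable_cong_sets sets_pair_measure_cong)
    have "emeasure N (A \<inter> {\<omega> \<in> ?S. X (s + t) \<omega> \<in> B}) = (\<integral>\<^sup>+\<omega>. indicator (A \<inter> {\<omega> \<in> ?S. X (s + t) \<omega> \<in> B}) \<omega> \<partial>N)"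
      by (rule nn_integral_indicator[symmetric]) measurable
    also have "\<dots> = (\<integral>\<^sup>+\<omega>. g (\<omega>, inc \<omega>) \<partial>N)"
      by (intro nn_integral_cong) (auto simp: g_def inc_def indicator_def)
    also have "\<dots> = (\<integral>\<^sup>+p. g p \<partial>(M1 \<Otimes>\<^sub>M kap t))"
      unfolding prod using g by (subst nn_integral_distr[OF pair]) simp_all
    also have "\<dots> = (\<integral>\<^sup>+\<omega>. \<integral>\<^sup>+y. g (\<omega>, y) \<partial>kap t \<partial>M1)"
      by (rule kt.nn_integral_fst[OF g', symmetric])
    also have "\<dots> = (\<integral>\<^sup>+\<omega>. \<integral>\<^sup>+y. g (\<omega>, y) \<partial>kap t \<partial>N)"
      unfolding M1_def
      by (rule nn_integral_distr[OF idm kt.borel_measurable_nn_integral_fst[OF g', unfolded M1_def]])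
    also have "\<dots> = (\<integral>\<^sup>+\<omega>. ennreal (indicator A \<omega> * ?k \<omega>) \<partial>N)"
    proof (rule nn_integral_cong)
      fix \<omega>
      have "(\<integral>\<^sup>+y. g (\<omega>, y) \<partial>kap t) = indicator A \<omega> * (\<integral>\<^sup>+y. indicator ((\<lambda>y. X s \<omega> + y) -` B) y \<partial>kap t)"
        unfolding g_def by (subst nn_integral_cmult[symmetric]) (auto simp: indicator_def intro!: nn_integral_cong)
      also have "\<dots> = indicator A \<omega> * emeasure (kap t) ((\<lambda>y. X s \<omega> + y) -` B)"
        using measurable_sets[OF measurable_add_left B] by (subst nn_integral_indicator) simp_all
      also have "\<dots> = ennreal (indicator A \<omega> * ?k \<omega>)"
        unfolding measure_K[OF B] kt.emeasure_eq_measure by (simp add: indicator_def)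
      finally show "(\<integral>\<^sup>+y. g (\<omega>, y) \<partial>kap t) = ennreal (indicator A \<omega> * ?k \<omega>)" .
    qed
    also have "\<dots> = ennreal (LINT \<omega>|N. indicator A \<omega> * ?k \<omega>)"
    proof (rule nn_integral_eq_integral)
      show "integrable N (\<lambda>\<omega>. indicator A \<omega> * ?k \<omega>)"
        using k_bound by (intro integrable_const_bound[of _ 1]) (auto simp: indicator_def)
    qed (simp add: k_bound)
    finally show ?thesis
      unfolding emeasure_eq_measure by (subst (asm) ennreal_inj) (auto simp: k_bound intro!: Bochner_Integration.integral_nonneg)
  qed
  interpret finite_measure_subalgebra N ?past
  proof
    show "subalgebra N ?past"
      unfolding subalgebra_def using space_past past_S1 S1_events by blast
  qed
  show ?thesis
  proof (rule real_cond_exp_charact)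
    fix A assume "A \<in> sets ?past"
    then have A: "A \<in> sets S1" using past_S1 by blast
    then have AN: "A \<in> events" using S1_events by blast
    have "(LINT \<omega>:A|N. indicator B (X (s + t) \<omega>) :: real) = (LINT \<omega>|N. indicator (A \<inter> {\<omega> \<in> ?S. X (s + t) \<omega> \<in> B}) \<omega>)"
      unfolding set_lebesgue_integral_def by (intro Bochner_Integration.integral_cong) (auto simp: indicator_def)
    also have "\<dots> = prob (A \<inter> {\<omega> \<in> ?S. X (s + t) \<omega> \<in> B})"
      using sets.sets_into_space[OF AN] by (simp add: Int_absorb2 le_infI1)
    also have "\<dots> = (LINT \<omega>:A|N. ?k \<omega>)"
      unfolding key[OF A] set_lebesgue_integral_def by simp
    finally show "(LINT \<omega>:A|N. indicator B (X (s + t) \<omega>)) = (LINT \<omega>:A|N. ?k \<omega>)" .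
  next
    show "integrable N (\<lambda>\<omega>'. indicator B (X (s + t) \<omega>') :: real)"
      by (rule integrable_const_bound[of _ 1]) (auto simp: indicator_def)
    show "integrable N ?k" using k_bound by (intro integrable_const_bound[of _ 1]) auto
    show "?k \<in> borel_measurable ?past" by (rule measurable_compose[OF X_past Km])
  qed
qed

end

context heat_semigroup
begin

text \<open>The canonical space of regular paths. Regularity involves uncountably many times and
  need not be an event of the product, so it is imposed on the points of the space, with the trace
  of the product \<sigma>-algebra.\<close>

definition path_space :: "(real \<Rightarrow> 'a) measure" where
  "path_space = restrict_space (PiM UNIV (\<lambda>_. borel)) {p. regular_path H \<mu> p}"

lemma space_path_space: "space path_space = {p. regular_path H \<mu> p}"
  by (simp add: path_space_def space_restrict_space space_PiM)

lemma measurable_path_component: "(\<lambda>p. p t) \<in> path_space \<rightarrow>\<^sub>M borel"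
  unfolding path_space_def by (intro measurable_restrict_space1 measurable_component_singleton) simp

definition shifted_path :: "'a \<Rightarrow> (real \<Rightarrow> nat \<Rightarrow> real) \<Rightarrow> real \<Rightarrow> 'a" where
  "shifted_path x \<omega> = (\<lambda>t. x + Y t \<omega>)"

lemma regular_path_shift:
  assumes "regular_path H \<mu> p"
  shows "regular_path H \<mu> (\<lambda>t. x + p t)"
  unfolding regular_path_def
proof (intro conjI allI impI)
  fix t :: real
  show "((\<lambda>t. x + p t) \<longlongrightarrow> x + p t) (at_right t)" if "0 \<le> t"
    using assms that unfolding regular_path_def by (intro tendsto_add tendsto_const) blast
  show "\<exists>l. ((\<lambda>t. x + p t) \<longlongrightarrow> l) (at_left t)" if "0 < t"
  proof -
    obtain l where "(p \<longlongrightarrow> l) (at_left t)" using assms \<open>0 < t\<close> unfolding regular_path_def by blast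
    then have "((\<lambda>t. x + p t) \<longlongrightarrow> x + l) (at_left t)" by (intro tendsto_add tendsto_const)
    then show ?thesis by blast
  qed
  fix T :: real assume "0 \<le> T"
  then obtain C where C: "\<And>t. t \<in> {0..T} \<Longrightarrow> gn (p t) \<le> C"
    using assms unfolding regular_path_def by blast
  have "gn (x + p t) \<le> max (gn x) C" if "t \<in> {0..T}" for t
    using gn_add_le[of x "p t"] C[OF that] by linarith
  then show "\<exists>C. \<forall>t\<in>{0..T}. gn (x + p t) \<le> C" by blast
qed

text \<open>Joint measurability in the starting point and the sample is what makes
  \<open>path_law\<close> a kernel.\<close>

lemma measurable_shifted_path:
  "case_prod shifted_path \<in> borel \<Otimes>\<^sub>M P0 \<rightarrow>\<^sub>M path_space"
  unfolding path_space_def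
proof (rule measurable_restrict_space2)
  show "case_prod shifted_path \<in> space (borel \<Otimes>\<^sub>M P0) \<rightarrow> {p. regular_path H \<mu> p}"
    using regular_path_shift[OF regular_path_Y] by (auto simp: shifted_path_def)
  show "case_prod shifted_path \<in> borel \<Otimes>\<^sub>M P0 \<rightarrow>\<^sub>M PiM UNIV (\<lambda>_. borel)"
  proof (rule measurable_PiM_single')
    show "(\<lambda>p. case_prod shifted_path p t) \<in> borel \<Otimes>\<^sub>M P0 \<rightarrow>\<^sub>M borel" for t
      unfolding shifted_path_def case_prod_beta by measurable
  qed (simp add: space_PiM)
qed

lemma measurable_shifted_path_Y: "shifted_path x \<in> P0 \<rightarrow>\<^sub>M path_space"
  using measurable_Pair2[OF measurable_shifted_path, of x] by simp

definition path_law :: "'a \<Rightarrow> (real \<Rightarrow> 'a) measure" where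
  "path_law x = distr P0 path_space (shifted_path x)"

lemma space_path_law: "space (path_law x) = space path_space"
  by (simp add: path_law_def)

lemma prob_space_path_law: "prob_space (path_law x)"
  unfolding path_law_def by (rule P0.prob_space_distr[OF measurable_shifted_path_Y])

lemma measurable_path_law: "path_law \<in> borel \<rightarrow>\<^sub>M prob_algebra path_space"
proof (rule measurable_prob_algebraI[OF prob_space_path_law])
  have "P0 \<in> space (subprob_algebra P0)"
    using prob_space_imp_subprob_space[OF prob_space_dyadic_law] by (simp add: space_subprob_algebra)
  then have "(\<lambda>x. P0) \<in> borel \<rightarrow>\<^sub>M subprob_algebra P0" by simp
  from measurable_distr2[OF measurable_shifted_path this]
  show "path_law \<in> borel \<rightarrow>\<^sub>M subprob_algebra path_space" by (simp add: path_law_def[abs_def])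
qed

lemma measure_path_law:
  assumes "{p \<in> space path_space. Q p} \<in> sets path_space"
  shows "measure (path_law x) {p \<in> space (path_law x). Q p} = P0.prob {\<omega> \<in> space P0. Q (shifted_path x \<omega>)}"
proof -
  have "measure (path_law x) {p \<in> space path_space. Q p}
      = P0.prob (shifted_path x -` {p \<in> space path_space. Q p} \<inter> space P0)"
    unfolding path_law_def by (rule measure_distr[OF measurable_shifted_path_Y assms])
  also have "shifted_path x -` {p \<in> space path_space. Q p} \<inter> space P0 = {\<omega> \<in> space P0. Q (shifted_path x \<omega>)}"
    using measurable_space[OF measurable_shifted_path_Y] by blast
  finally show ?thesis by (simp add: space_path_law)
qed

lemma path_component_event: "C \<in> sets borel \<Longrightarrow> {p \<in> space path_space. p r \<in> C} \<in> sets path_space"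
  using measurable_sets[OF measurable_path_component] by (simp add: vimage_def Int_def conj_commute)

lemma path_increment_event: "C \<in> sets borel \<Longrightarrow> {p \<in> space path_space. p t - p s \<in> C} \<in> sets path_space"
  using measurable_sets[OF borel_measurable_diff'[OF measurable_path_component measurable_path_component]]
  by (simp add: vimage_def Int_def conj_commute)

text \<open>The shift by \<open>x\<close> carries cosets to cosets and cancels in increments, so
  this reduces to the process started at zero.\<close>

lemma path_law_increment_indep:
  assumes s: "s \<ge> 0" and t: "t \<ge> 0" and R: "finite R" "R \<subseteq> {0..s}"
    and D: "\<And>r. r \<in> R \<Longrightarrow> D r \<in> Cosets"
  shows "measure (path_law x) {p \<in> space (path_law x). (\<forall>r\<in>R. p r \<in> D r) \<and> p (s + t) - p s \<in> coset a n}
    = measure (path_law x) {p \<in> space (path_law x). \<forall>r\<in>R. p r \<in> D r} * measure (kap t) (coset a n)"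
proof -
  have Db: "D r \<in> sets borel" if "r \<in> R" for r using Cosets_open[OF D[OF that]] by (rule borel_open)
  have ev: "{p \<in> space path_space. \<forall>r\<in>R. p r \<in> D r} \<in> sets path_space"
    by (intro sets.sets_Collect_finite_All R path_component_event Db)
  have ev2: "{p \<in> space path_space. (\<forall>r\<in>R. p r \<in> D r) \<and> p (s + t) - p s \<in> coset a n} \<in> sets path_space"
    by (intro sets.sets_Collect_conj ev path_increment_event coset_borel)
  define E where "E r = (\<lambda>y. x + y) -` D r" for r
  have E: "E r \<in> Cosets" if "r \<in> R" for r
    using D[OF that] by (cases rule: Cosets_cases) (simp_all add: E_def translate_vimage_coset)
  have 1: "x + Y r \<omega> \<in> D r \<longleftrightarrow> Y r \<omega> \<in> E r" for r \<omega> by (simp add: E_def)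
  have 2: "x + Y (s + t) \<omega> - (x + Y s \<omega>) = Y (s + t) \<omega> - Y s \<omega>" for \<omega> by simp
  show ?thesis
    unfolding measure_path_law[OF ev] measure_path_law[OF ev2] shifted_path_def 1 2
    by (rule Y_increment_indep[OF s t R E refl])
qed

theorem markov_process_path_law: "markov_process K path_space (\<lambda>t p. p t) path_law"
  unfolding markov_process_def
proof (intro conjI allI impI ballI)
  show "(\<lambda>p. p t) \<in> path_space \<rightarrow>\<^sub>M borel" for t by (rule measurable_path_component)
  show "path_law \<in> borel \<rightarrow>\<^sub>M prob_algebra path_space" by (rule measurable_path_law)
  show "AE p in path_law x. p 0 = x" for x
  proof -
    have "{p \<in> space path_space. p 0 \<in> {x}} \<in> sets path_space" by (rule path_component_event) simp
    then have ev: "{p \<in> space path_space. p 0 = x} \<in> sets path_space" by simp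
    show ?thesis
      unfolding path_law_def AE_distr_iff[OF measurable_shifted_path_Y ev]
      using AE_Y_0 by eventually_elim (simp add: shifted_path_def)
  qed
  fix x and s t :: real and B :: "'a set" assume s: "0 \<le> s" and t: "0 \<le> t" and B: "B \<in> sets borel"
  show "AE p in path_law x. real_cond_exp (path_law x) (past path_space (\<lambda>t p. p t) s)
      (\<lambda>p. indicator B (p (s + t))) p = measure (K t (p s)) B"
  proof -
    \<comment> \<open>The construction \<open>past\<close> depends on its first argument only
      through the underlying set, so the law may replace the path space there.\<close>
    have "AE p in path_law x. real_cond_exp (path_law x) (past (path_law x) (\<lambda>t p. p t) s)
      (\<lambda>p. indicator B (p (s + t))) p = measure (K t (p s)) B"
    proof (rule markov_property_of_indep[OF prob_space_path_law _ s t _ B])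
      show "(\<lambda>p. p r) \<in> path_law x \<rightarrow>\<^sub>M borel" for r
        using measurable_path_component by (simp add: path_law_def)
    qed (rule path_law_increment_indep[OF s t])
    then show ?thesis by (simp add: past_def space_path_law)
  qed
qed

end

theorem theorem7p1:
  fixes H :: "int \<Rightarrow> 'a::{topological_ab_group_add, t2_space, second_countable_topology} set"
    and \<mu> :: "'a measure"
    and ch :: "'a \<Rightarrow> 'a \<Rightarrow> complex"
    and \<alpha> :: real
  assumes "locally_compact_space (euclidean :: 'a topology)"
    and "totally_disconnected_set (UNIV :: 'a set)"
    and "selfduality ch"
    and "\<And>n. add_subgroup (H n)" and "\<And>n. compact (H n)" and "\<And>n. open (H n)"
    and "\<And>n. H n \<subseteq> H (n + 1)"
    and "\<exists>M. \<forall>n. subgroup_index (H (n + 1)) (H n) \<le> M"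
    and "\<And>n. annihilator ch (H n) = H (- n)"
    and "(\<Inter>n. H n) = {0}" and "(\<Union>n. H n) = UNIV"
    and "haar_measure \<mu>" and "emeasure \<mu> (H 0) = 1"
    and "\<alpha> > 0"
  shows "(\<forall>f \<in> Dom_D H \<mu> ch \<alpha>.
            classical_solution H \<mu> ch \<alpha> f
              (\<lambda>t. if t = 0 then f
                   else fun_convolution \<mu> (\<lambda>x. heat_kernel H \<mu> ch \<alpha> x t) f)) \<and>
         (\<exists>K. transition_function K \<and>
            (\<forall>t\<ge>0. \<forall>x. \<forall>B\<in>sets borel.
               complex_of_real (measure (K t x) B) = heat_transition H \<mu> ch \<alpha> t x B) \<and>
            (\<forall>t\<ge>0. \<forall>x h. \<forall>B\<in>sets borel.
               heat_transition H \<mu> ch \<alpha> t (x + h) ((\<lambda>y. y + h) ` B)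
                 = heat_transition H \<mu> ch \<alpha> t x B) \<and>
            (\<exists>(\<Omega> :: (real \<Rightarrow> 'a) measure) X Pr. markov_process K \<Omega> X Pr \<and>
               (\<forall>\<omega>\<in>space \<Omega>. regular_path H \<mu> (\<lambda>t. X t \<omega>))))"
proof -
  have char: "ch \<xi> \<in> characters" for \<xi>
  proof -
    \<comment> \<open>The points of \<open>dual_topology\<close> form the union of the generating
      sets, all of which consist of characters; so each \<open>ch \<xi>\<close> is a character
      because the image of \<open>ch\<close> is this set of points.\<close>
    have "ch ` topspace euclidean = topspace dual_topology"
      using assms(3) by (intro homeomorphic_imp_surjective_map) (simp add: selfduality_def)
    then have "ch \<xi> \<in> topspace dual_topology" by auto
    then show ?thesis unfolding dual_topology_def topology_generated_by_topspace by auto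
  qed
  have add: "ch (\<xi> + \<eta>) x = ch \<xi> x * ch \<eta> x" for \<xi> \<eta> x
    using assms(3) unfolding selfduality_def by blast
  interpret heat_semigroup H \<mu> ch \<alpha>
    by unfold_locales (fact char add assms)+
  show ?thesis
  proof (intro conjI ballI)
    fix f assume f: "f \<in> Dom_D H \<mu> ch \<alpha>"
    have "u f = (\<lambda>t. if t = 0 then f else fun_convolution \<mu> (\<lambda>x. heat_kernel H \<mu> ch \<alpha> x t) f)"
      using u_def[OF f] by (intro ext) (simp add: conv_def)
    with classical_solution_u[OF f]
    show "classical_solution H \<mu> ch \<alpha> f
        (\<lambda>t. if t = 0 then f else fun_convolution \<mu> (\<lambda>x. heat_kernel H \<mu> ch \<alpha> x t) f)"
      by simp
  next
    have "\<forall>p\<in>space path_space. regular_path H \<mu> (\<lambda>t. p t)"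
      by (simp add: space_path_space)
    then show "\<exists>K. transition_function K \<and>
            (\<forall>t\<ge>0. \<forall>x. \<forall>B\<in>sets borel.
               complex_of_real (measure (K t x) B) = heat_transition H \<mu> ch \<alpha> t x B) \<and>
            (\<forall>t\<ge>0. \<forall>x h. \<forall>B\<in>sets borel.
               heat_transition H \<mu> ch \<alpha> t (x + h) ((\<lambda>y. y + h) ` B)
                 = heat_transition H \<mu> ch \<alpha> t x B) \<and>
            (\<exists>(\<Omega> :: (real \<Rightarrow> 'a) measure) X Pr. markov_process K \<Omega> X Pr \<and>
               (\<forall>\<omega>\<in>space \<Omega>. regular_path H \<mu> (\<lambda>t. X t \<omega>)))"
      using transition_function_K measure_K_heat_transition heat_transition_translate markov_process_path_law
      by (intro exI[of _ K] exI[of _ path_space] exI[of _ "\<lambda>t p. p t"] exI[of _ path_law] conjI allI impI ballI) blast+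
  qed
qed

end
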